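(* Let $d\ge1$ and let $f\in\mathbb{Z}[\mathbb{Z}^d]$ be irreducible in $\mathbb{Z}[\mathbb{Z}^d]$, adjusted, and with positive constant term $\widehat{f}(\mathbf{0})>0$. For every $N\ge1$ there are an irreducible $g_N\in\mathbb{Z}[N\mathbb{Z}^d]$ and an integer $e_N\ge1$ such that $$\langle f\rangle_{\mathbb{Z}[\mathbb{Z}^d]}\cap\mathbb{Z}[N\mathbb{Z}^d]=\langle g_N\rangle_{\mathbb{Z}[N\mathbb{Z}^d]}\quad\text{and}\quad f_{\langle N\rangle}=g_N^{e_N}.$$ The multiplicity $e_N$ can be (effectively, given $N$) computed from the absolutely irreducible factorization of $f$ in $\mathbb{C}[\mathbb{Z}^d]$. If the support of $f$ generates a finite-index subgroup of $\mathbb{Z}^d$, then there is an integer $Q(f)\geq 1$, which can also be computed from the absolutely irreducible factors of $f$, such that $e_N=1$ for every $N\ge1$ that is relatively prime to $Q(f)$. Finally, $$\langle f^k\rangle_{\mathbb{Z}[\mathbb{Z}^d]}\cap\mathbb{Z}[N\mathbb{Z}^d]=\langle g_N^k\rangle_{\mathbb{Z}[N\mathbb{Z}^d]}$$ for every $k\ge1$ (and every $N\ge 1$).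
   Context: For a ring $A$, $A[\mathbb{Z}^d]$ is identified with the Laurent polynomial ring $A[x_1^{\pm1},\dots,x_d^{\pm1}]$; $f=\sum_{\mathbf{n}}\widehat{f}(\mathbf{n})\mathbf{x}^{\mathbf{n}}$ and $\operatorname{supp} f=\{\mathbf{n}\in\mathbb{Z}^d:\widehat{f}(\mathbf{n})\ne0\}$. $\mathbb{Z}[N\mathbb{Z}^d]=\mathbb{Z}[x_1^{\pm N},\dots,x_d^{\pm N}]$. $\langle h\rangle_A$ denotes the principal ideal of the ring $A$ generated by $h$. The Newton polytope $\mathcal{N}_f$ is the convex hull of $\operatorname{supp} f$ in $\mathbb{R}^d$; $f$ is adjusted if $\mathbf{0}$ is an extreme point of $\mathcal{N}_f$. The $N$th decimation of $f$ is $$f_{\langle N\rangle}(x_1,\dots,x_d)=\prod_{k_1=0}^{N-1}\cdots\prod_{k_d=0}^{N-1} f(e^{2\pi i k_1/N}x_1,\dots,e^{2\pi i k_d/N}x_d).$$ A polynomial in $\mathbb{C}[\mathbb{Z}^d]$ is absolutely irreducible if it is irreducible in the unique factorization domain $\mathbb{C}[\mathbb{Z}^d]$; the absolutely irreducible factorization of $f$ is its factorization into irreducibles in $\mathbb{C}[\mathbb{Z}^d]$ (its factors can be taken to have coefficients in a number field). *)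

theory Defs
  imports
    "HOL-Analysis.Analysis"
    "HOL-Library.Poly_Mapping"
    "HOL-Library.Nat_Bijection"
    "HOL-Computational_Algebra.Polynomial_Factorial"
    "HOL-Computational_Algebra.Group_Closure"
begin

section \<open>Laurent polynomials\<close>

text \<open>
  \<open>('d, 'a) laurent\<close> is the group ring \<open>A[Z^d]\<close> with \<open>d = CARD('d)\<close>: the multiplication of
  \<^typ>\<open>'b \<Rightarrow>\<^sub>0 'c\<close> is convolution, \<^const>\<open>Poly_Mapping.keys\<close> is the support and
  \<^const>\<open>Poly_Mapping.lookup\<close> gives the coefficients.
\<close>

type_synonym ('d, 'a) laurent = "(int ^ 'd) \<Rightarrow>\<^sub>0 'a"

definition newton_polytope :: "('d::finite, 'a::zero) laurent \<Rightarrow> (real ^ 'd) set" where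
  "newton_polytope f = convex hull ((\<lambda>n. \<chi> i. real_of_int (n $ i)) ` Poly_Mapping.keys f)"

definition adjusted :: "('d::finite, 'a::zero) laurent \<Rightarrow> bool" where
  "adjusted f \<longleftrightarrow> 0 extreme_point_of newton_polytope f"

definition to_complex :: "('d::finite, int) laurent \<Rightarrow> ('d, complex) laurent" where
  "to_complex f = Poly_Mapping.map of_int f"

text \<open>The substitution \<open>x\<^sub>i \<mapsto> z\<^sub>i x\<^sub>i\<close>.\<close>

definition rescale :: "('d::finite \<Rightarrow> complex) \<Rightarrow> ('d, complex) laurent \<Rightarrow> ('d, complex) laurent" where
  "rescale z f =
     (\<Sum>n\<in>Poly_Mapping.keys f. Poly_Mapping.single n (Poly_Mapping.lookup f n * (\<Prod>i\<in>UNIV. z i powi (n $ i))))"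

lemma lookup_rescale:
  "Poly_Mapping.lookup (rescale z f) n = Poly_Mapping.lookup f n * (\<Prod>i\<in>UNIV. z i powi (n $ i))"
  by (cases "n \<in> Poly_Mapping.keys f")
     (auto simp: rescale_def lookup_sum lookup_single when_def in_keys_iff if_distrib sum.delta)

text \<open>The decimation has integer coefficients, but is defined, as a product over roots of unity,
  in \<open>C[Z^d]\<close>.\<close>

definition decimation :: "nat \<Rightarrow> ('d::finite, int) laurent \<Rightarrow> ('d, complex) laurent" where
  "decimation N f =
     (\<Prod>k\<in>{k :: 'd \<Rightarrow> nat. \<forall>i. k i < N}.
        rescale (\<lambda>i. exp (2 * of_real pi * \<i> * of_nat (k i) / of_nat N)) (to_complex f))"

section \<open>Subrings\<close>

definition sublattice_ring :: "nat \<Rightarrow> ('d::finite, int) laurent set" where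
  "sublattice_ring N = {f. \<forall>n\<in>Poly_Mapping.keys f. \<forall>i. int N dvd n $ i}"

definition principal_ideal_in :: "'a::comm_ring_1 set \<Rightarrow> 'a \<Rightarrow> 'a set" where
  "principal_ideal_in A h = {a * h | a. a \<in> A}"

definition unit_in :: "'a::comm_ring_1 set \<Rightarrow> 'a \<Rightarrow> bool" where
  "unit_in A a \<longleftrightarrow> a \<in> A \<and> (\<exists>b\<in>A. a * b = 1)"

text \<open>\<^const>\<open>irreducible\<close>, relative to a subring \<open>A\<close>.\<close>

definition irreducible_in :: "'a::comm_ring_1 set \<Rightarrow> 'a \<Rightarrow> bool" where
  "irreducible_in A p \<longleftrightarrow> p \<in> A \<and> p \<noteq> 0 \<and> \<not> unit_in A p \<and>
     (\<forall>a\<in>A. \<forall>b\<in>A. p = a * b \<longrightarrow> unit_in A a \<or> unit_in A b)"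

lemma irreducible_in_UNIV: "irreducible_in UNIV p \<longleftrightarrow> irreducible p"
  by (auto simp: irreducible_in_def irreducible_def unit_in_def dvd_def; metis)

definition finite_index :: "'a::ab_group_add set \<Rightarrow> bool" where
  "finite_index G \<longleftrightarrow> finite (UNIV // {(x, y). x - y \<in> G})"

section \<open>Computability\<close>

text \<open>
  Partial recursive functions, presented by programs: \<open>computes P xs y\<close> says that \<open>P\<close> terminates
  on the input \<open>xs\<close> with output \<open>y\<close>.
\<close>

datatype program =
    Zero
  | Succ
  | Proj nat
  | Comp program "program list"
  | PrimRec program program
  | Mu program

inductive computes :: "program \<Rightarrow> nat list \<Rightarrow> nat \<Rightarrow> bool" where
  zero: "computes Zero xs 0"
| succ: "computes Succ (x # xs) (Suc x)"
| proj: "i < length xs \<Longrightarrow> computes (Proj i) xs (xs ! i)"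
| comp: "list_all2 (\<lambda>G y. computes G xs y) Gs ys \<Longrightarrow> computes F ys z \<Longrightarrow>
     computes (Comp F Gs) xs z"
| rec_0: "computes F xs y \<Longrightarrow> computes (PrimRec F G) (0 # xs) y"
| rec_Suc: "computes (PrimRec F G) (n # xs) y \<Longrightarrow> computes G (n # y # xs) z \<Longrightarrow>
     computes (PrimRec F G) (Suc n # xs) z"
| mu: "computes F (n # xs) 0 \<Longrightarrow> (\<And>m. m < n \<Longrightarrow> \<exists>y>0. computes F (m # xs) y) \<Longrightarrow>
     computes (Mu F) xs n"

lemma computes_functional: "computes P xs y \<Longrightarrow> computes P xs z \<Longrightarrow> y = z"
proof (induction arbitrary: z rule: computes.induct)
  case (comp xs Gs ys F y)
  from comp.prems obtain ys' where
    "list_all2 (\<lambda>G y. computes G xs y) Gs ys'" "computes F ys' z"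
    by cases auto
  moreover from this comp.IH(1) have "ys' = ys"
    by (auto simp: list_all2_conv_all_nth intro!: nth_equalityI)
  ultimately show ?case
    using comp.IH(2) by blast
next
  case (rec_Suc F G n xs y w)
  from rec_Suc.prems show ?case
    by cases (use rec_Suc.IH in blast)
next
  case (mu F n xs)
  from mu.prems have z: "computes F (z # xs) 0" "\<And>m. m < z \<Longrightarrow> \<exists>y>0. computes F (m # xs) y"
    by (cases; blast)+
  have "\<not> z < n"
    using mu.IH(2)[of z] z(1) by fastforce
  moreover have "\<not> n < z"
    using mu.IH(1) z(2)[of n] by fastforce
  ultimately show ?case by simp
qed (erule computes.cases; auto)+

section \<open>Absolutely irreducible factorizations as finite data\<close>

text \<open>
  All coefficients lie in a number field \<open>Q(\<theta>) = Q[t]/(p)\<close> and are written as polynomials in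
  \<open>\<theta>\<close> over the rationals; a Laurent polynomial is a list of terms (exponent, coefficient).  Terms
  may repeat an exponent and coefficients need not be reduced modulo \<open>p\<close>: an algorithm has to cope
  with every presentation.  A factorization \<open>u f\<^sub>1 \<dots> f\<^sub>r\<close>, with \<open>u\<close> a unit of \<open>C[Z^d]\<close>, is
  presented by \<open>(p, u, [f\<^sub>1, \<dots>, f\<^sub>r])\<close>.  If \<open>f\<close> is constant then \<open>r = 0\<close>.
\<close>

type_synonym 'd terms = "((int ^ 'd) \<times> rat poly) list"
type_synonym 'd factor_data = "rat poly \<times> 'd terms \<times> 'd terms list"

definition terms_at :: "complex \<Rightarrow> 'd::finite terms \<Rightarrow> ('d, complex) laurent" where
  "terms_at \<theta> ts =
     (\<Sum>(n, a)\<leftarrow>ts. Poly_Mapping.single n (poly (map_poly of_rat a) \<theta>))"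

text \<open>Which root \<open>\<theta>\<close> of \<open>p\<close> is meant is not part of the data: another choice only replaces the
  factorization of \<open>f\<close> by a Galois conjugate one.\<close>

definition abs_factorization :: "('d::finite, int) laurent \<Rightarrow> 'd factor_data \<Rightarrow> bool" where
  "abs_factorization f = (\<lambda>(p, u, fs).
     irreducible p \<and>
     (\<exists>\<theta>::complex. poly (map_poly of_rat p) \<theta> = 0 \<and>
        terms_at \<theta> u dvd 1 \<and>
        (\<forall>h\<in>set fs. irreducible (terms_at \<theta> h)) \<and>
        to_complex f = terms_at \<theta> u * (\<Prod>h\<leftarrow>fs. terms_at \<theta> h)))"

text \<open>Coding by natural numbers; \<open>ds\<close> lists the coordinates \<open>1, \<dots>, d\<close>.  (The generic
  \<open>to_nat\<close> of class \<^class>\<open>countable\<close> would not do: it need not be computable.)\<close>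

definition encode_rat :: "rat \<Rightarrow> nat" where
  "encode_rat q = (case quotient_of q of (a, b) \<Rightarrow> prod_encode (int_encode a, int_encode b))"

definition encode_poly :: "rat poly \<Rightarrow> nat" where
  "encode_poly p = list_encode (map encode_rat (coeffs p))"

definition encode_vec :: "'d list \<Rightarrow> int ^ 'd::finite \<Rightarrow> nat" where
  "encode_vec ds n = list_encode (map (\<lambda>i. int_encode (n $ i)) ds)"

definition encode_terms :: "'d list \<Rightarrow> 'd::finite terms \<Rightarrow> nat" where
  "encode_terms ds ts =
     list_encode (map (\<lambda>(n, a). prod_encode (encode_vec ds n, encode_poly a)) ts)"

definition encode_data :: "'d list \<Rightarrow> 'd::finite factor_data \<Rightarrow> nat" where
  "encode_data ds = (\<lambda>(p, u, fs).
     list_encode [encode_poly p, encode_terms ds u, list_encode (map (encode_terms ds) fs)])"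

end

theory Submission
  imports Defs "HOL-Computational_Algebra.Field_as_Ring" "HOL-Number_Theory.Cong"
begin

text \<open>
Write \<open>R = Z[Z^d]\<close> and \<open>x^n\<close> for the monomial with exponent \<open>n\<close>.

The decimation is a product of rotations of \<open>f\<close> by \<open>N\<close>th roots of unity.  It is
invariant under the Galois group, so it has integer coefficients, and it is invariant under
rotations, so its exponents are divisible by \<open>N\<close>; moreover it is a multiple of \<open>f\<close> in \<open>R\<close>
(\<open>decimation_integral_multiple\<close>, \<open>supp_dec\<close>).  The subring \<open>Z[N Z^d]\<close> is isomorphic to \<open>R\<close> by dilation
of the exponents, and Laurent polynomials over a factorial ring have unique factorization
(\<open>laurent_irreducible_dvd_mult\<close>).  If \<open>h\<close> lies in the contraction, say \<open>h = f t\<close>, then a power of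
\<open>h\<close>, being the decimation of \<open>h\<close>, is the product of the decimations of \<open>f\<close> and \<open>t\<close>; hence every
prime factor of the decimation of \<open>f\<close> in \<open>Z[N Z^d]\<close> divides \<open>h\<close>.  As \<open>f\<close> divides one of these prime
factors, that factor generates the contraction and is the only one, so the decimation is a power
of it up to a unit (\<open>contraction_principal\<close>).  The vertex \<open>0\<close> of the Newton polytope and the sign of
the constant term make the unit equal to \<open>1\<close> (\<open>normalized_contraction\<close>).

The generator \<open>g\<close> is not divisible by \<open>f^2\<close>: otherwise \<open>f\<close> divides all Euler derivatives
\<open>x_i dg/dx_i\<close>, which lie in \<open>Z[N Z^d]\<close> again and are therefore multiples of \<open>g\<close>; for reasons of degree
they vanish, so \<open>g\<close> is a constant, \<open>f\<close> is one up to a monomial, and \<open>g\<close> is associated to \<open>f\<close>, which is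
absurd (\<open>contraction_unramified\<close>).  So \<open>g = f q\<close> with \<open>f\<close> not dividing \<open>q\<close>,
and the statement about \<open>f^k\<close> follows by induction on \<open>k\<close> (\<open>contraction_powers\<close>).

Since the decimation is \<open>(f q)^e\<close>, the number \<open>e\<close> is the multiplicity of
\<open>f\<close> in it.  If a variable \<open>x_i\<close> occurs in \<open>f\<close>, this is certified by writing the decimation as
\<open>f^e Q\<close> and giving a Bezout relation \<open>A f + B Q = r\<close>, where \<open>r\<close> is nonzero and free of \<open>x_i\<close>
(\<open>multiplicity_certificate_sound\<close>, \<open>bezout_free_of_variable\<close>).  All these identities can be checked in
polynomial arithmetic over the rationals, with a root of unity replaced by a variable \<open>t\<close>; if \<open>f\<close> is a
constant, then \<open>e = N^d\<close>.  The integer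
polynomial \<open>f\<close> can be recovered from any presentation of its factorization in the same manner:
guess it, and check the identity modulo the minimal polynomial.  An unbounded
search through all certificates is thus a program for \<open>e\<close> (\<open>multiplicity_program\<close>).

If \<open>e > 1\<close>, then \<open>f\<close> has a complex factor in common with one of its nontrivial
rotations, by the tuple \<open>z^k\<close>, where \<open>z\<close> is a primitive root of unity.  By conjugation the same happens
for the rotations by \<open>z^(a k)\<close>, for all \<open>a\<close> prime to \<open>N\<close> (\<open>conjugate_common_factor\<close>).  If \<open>N\<close> has no
small factors, there are more such \<open>a\<close> than pairs of irreducible factors of \<open>f\<close>, so some factor \<open>h\<close>
is mapped to an associate of itself by a nontrivial rotation (\<open>no_common_factor_with_rotation\<close>).  The
support of \<open>h\<close> then satisfies a congruence modulo \<open>N\<close>, and simultaneous Diophantine approximation turns it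
into an equation: a nonzero integral functional \<open>v\<close> is constant on the support.  The Euler derivation of
\<open>v\<close> multiplies \<open>h\<close> by a constant, hence maps \<open>f\<close> to a multiple of \<open>f\<close>, hence to \<open>0\<close>, so
\<open>v\<close> vanishes on the support of \<open>f\<close> (\<open>rotation_stabilizer_trivial\<close>).  This is impossible if that support
generates a subgroup of finite index.  Both bounds on the factors of \<open>N\<close> depend only on a bound for the
total width of \<open>f\<close>, and \<open>Q\<close> is the factorial of their sum.
\<close>

section \<open>Laurent polynomials and their homomorphisms\<close>

abbreviation supp :: "('d::finite, 'a::zero) laurent \<Rightarrow> (int ^ 'd) set" where
  "supp f \<equiv> Poly_Mapping.keys f"

abbreviation cf :: "('d::finite, 'a::zero) laurent \<Rightarrow> int ^ 'd \<Rightarrow> 'a" where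
  "cf f n \<equiv> Poly_Mapping.lookup f n"

abbreviation sg :: "int ^ 'd::finite \<Rightarrow> 'a::zero \<Rightarrow> ('d, 'a) laurent" where
  "sg \<equiv> Poly_Mapping.single"

lemma laurent_eqI: "(\<And>n. cf f n = cf g n) \<Longrightarrow> f = g"
  by (simp add: poly_mapping_eqI)

lemma cf_sg: "cf (sg m c) n = (if m = n then c else 0)"
  by (auto simp: lookup_single when_def)

lemma laurent_sum_on:
  assumes "finite A" "supp f \<subseteq> A"
  shows "f = (\<Sum>n\<in>A. sg n (cf f n))"
proof (rule laurent_eqI)
  fix n
  have "cf (\<Sum>n\<in>A. sg n (cf f n)) n = (\<Sum>m\<in>A. if m = n then cf f n else 0)"
    by (auto simp: lookup_sum cf_sg intro!: sum.cong)
  also have "\<dots> = cf f n"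
    using assms by (auto simp: sum.delta in_keys_iff)
  finally show "cf f n = cf (\<Sum>n\<in>A. sg n (cf f n)) n" by simp
qed

lemma laurent_sum: "f = (\<Sum>n\<in>supp f. sg n (cf f n))"
  by (rule laurent_sum_on) auto

lemma sg_mult_sg: "sg a c * sg b e = sg (a + b) (c * e)"
  by (rule mult_single)

lemma cf_sg_mult:
  fixes f :: "('d::finite, 'a::comm_ring_1) laurent"
  shows "cf (sg a c * f) n = c * cf f (n - a)"
proof -
  have "sg a c * f = sg a c * (\<Sum>m\<in>supp f. sg m (cf f m))"
    using laurent_sum[of f] by simp
  also have "\<dots> = (\<Sum>m\<in>supp f. sg (a + m) (c * cf f m))"
    by (simp add: sum_distrib_left sg_mult_sg)
  finally have "cf (sg a c * f) n = (\<Sum>m\<in>supp f. if m = n - a then c * cf f m else 0)"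
    by (auto simp: lookup_sum cf_sg algebra_simps intro!: sum.cong)
  also have "\<dots> = c * cf f (n - a)"
    by (auto simp: sum.delta in_keys_iff)
  finally show ?thesis .
qed

lemma cf_mult_on:
  fixes f :: "('d::finite, 'a::comm_ring_1) laurent"
  assumes "finite A" "supp f \<subseteq> A"
  shows "cf (f * g) n = (\<Sum>a\<in>A. cf f a * cf g (n - a))"
proof -
  have "f * g = (\<Sum>a\<in>A. sg a (cf f a) * g)"
    by (subst laurent_sum_on[OF assms]) (simp add: sum_distrib_right)
  then show ?thesis by (simp add: lookup_sum cf_sg_mult)
qed

lemma cf_mult:
  fixes f :: "('d::finite, 'a::comm_ring_1) laurent"
  shows "cf (f * g) n = (\<Sum>a\<in>supp f. cf f a * cf g (n - a))"
  by (rule cf_mult_on) auto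

lemma supp_multE:
  fixes f :: "('d::finite, 'a::comm_ring_1) laurent"
  assumes "n \<in> supp (f * g)"
  obtains a b where "a \<in> supp f" "b \<in> supp g" "n = a + b"
  using keys_mult[of f g] assms by auto

lemma supp_sg_mult:
  fixes f :: "('d::finite, 'a::idom) laurent"
  assumes "c \<noteq> 0"
  shows "n \<in> supp (sg a c * f) \<longleftrightarrow> n - a \<in> supp f"
  using assms by (simp add: in_keys_iff cf_sg_mult)

lemma supp_diff: "supp (f - g) \<subseteq> supp f \<union> supp (g :: ('d::finite, 'a::ab_group_add) laurent)"
  by (auto simp: in_keys_iff lookup_minus)

lemma supp_add: "supp (f + g) \<subseteq> supp f \<union> supp (g :: ('d::finite, 'a::ab_group_add) laurent)"
  by (auto simp: in_keys_iff lookup_add)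

text \<open>All coefficient homomorphisms, rotations, slices, dilations and derivations below are of this form.\<close>

definition map_terms ::
  "(int ^ 'd::finite \<Rightarrow> int ^ 'e::finite) \<Rightarrow> (int ^ 'd \<Rightarrow> 'a \<Rightarrow> 'b) \<Rightarrow> ('d, 'a::zero) laurent \<Rightarrow> ('e, 'b::comm_monoid_add) laurent" where
  "map_terms \<alpha> \<beta> f = (\<Sum>n\<in>supp f. sg (\<alpha> n) (\<beta> n (cf f n)))"

lemma map_terms_on:
  assumes "finite A" "supp f \<subseteq> A" "\<And>n. \<beta> n 0 = 0"
  shows "map_terms \<alpha> \<beta> f = (\<Sum>n\<in>A. sg (\<alpha> n) (\<beta> n (cf f n)))"
  unfolding map_terms_def using assms
  by (intro sum.mono_neutral_left) (auto simp: in_keys_iff)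

lemma map_terms_add:
  fixes f g :: "('d::finite, 'a::ab_group_add) laurent" and \<beta> :: "int ^ 'd \<Rightarrow> 'a \<Rightarrow> 'b::ab_group_add"
  assumes "\<And>n a b. \<beta> n (a + b) = \<beta> n a + \<beta> n b"
  shows "map_terms \<alpha> \<beta> (f + g) = map_terms \<alpha> \<beta> f + map_terms \<alpha> \<beta> g"
proof -
  let ?A = "supp f \<union> supp g"
  have z: "\<beta> n 0 = 0" for n
    using assms[of n 0 0] by simp
  have A: "finite ?A" "supp f \<subseteq> ?A" "supp g \<subseteq> ?A" "supp (f + g) \<subseteq> ?A"
    using supp_add by auto
  show ?thesis
    by (simp add: map_terms_on[where \<beta> = \<beta>, OF A(1,2) z] map_terms_on[where \<beta> = \<beta>, OF A(1,3) z]
        map_terms_on[where \<beta> = \<beta>, OF A(1,4) z] lookup_add assms single_add sum.distrib)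
qed

lemma map_terms_sg: "(\<And>n. \<beta> n 0 = 0) \<Longrightarrow> map_terms \<alpha> \<beta> (sg n c) = sg (\<alpha> n) (\<beta> n c)"
  by (subst map_terms_on[of "{n}"]) (auto simp: lookup_single)

lemma map_terms_zero [simp]: "map_terms \<alpha> \<beta> 0 = 0"
  by (simp add: map_terms_def)

lemma map_terms_sum:
  fixes \<beta> :: "int ^ 'd::finite \<Rightarrow> 'a::ab_group_add \<Rightarrow> 'b::ab_group_add"
  assumes "\<And>n a b. \<beta> n (a + b) = \<beta> n a + \<beta> n b"
  shows "map_terms \<alpha> \<beta> (sum F A) = (\<Sum>x\<in>A. map_terms \<alpha> \<beta> (F x))"
  by (induction A rule: infinite_finite_induct) (simp_all add: map_terms_add[of \<beta>, OF assms])

lemma map_terms_mult: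
  fixes f g :: "('d::finite, 'a::comm_ring_1) laurent"
    and \<beta> :: "int ^ 'd \<Rightarrow> 'a \<Rightarrow> 'b::comm_ring_1"
  assumes add: "\<And>n a b. \<beta> n (a + b) = \<beta> n a + \<beta> n b"
    and mult: "\<And>n m a b. \<beta> (n + m) (a * b) = \<beta> n a * \<beta> m b"
    and \<alpha>: "\<And>n m. \<alpha> (n + m) = \<alpha> n + \<alpha> m"
  shows "map_terms \<alpha> \<beta> (f * g) = map_terms \<alpha> \<beta> f * map_terms \<alpha> \<beta> g"
proof -
  have z: "\<beta> n 0 = 0" for n
    using add[of n 0 0] by simp
  have "f * g = (\<Sum>n\<in>supp f. \<Sum>m\<in>supp g. sg (n + m) (cf f n * cf g m))"
    by (subst laurent_sum[of f], subst laurent_sum[of g]) (simp add: sum_product sg_mult_sg)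
  then have "map_terms \<alpha> \<beta> (f * g) =
      (\<Sum>n\<in>supp f. \<Sum>m\<in>supp g. sg (\<alpha> n + \<alpha> m) (\<beta> n (cf f n) * \<beta> m (cf g m)))"
    by (simp add: map_terms_sum[of \<beta>, OF add] map_terms_sg[of \<beta>, OF z] mult \<alpha>)
  also have "\<dots> = map_terms \<alpha> \<beta> f * map_terms \<alpha> \<beta> g"
    by (simp add: map_terms_def sum_product sg_mult_sg)
  finally show ?thesis .
qed

lemma cf_map_terms_inj:
  assumes "inj \<alpha>" "\<And>n. \<beta> n 0 = 0"
  shows "cf (map_terms \<alpha> \<beta> f) (\<alpha> n) = \<beta> n (cf f n)"
proof -
  have "cf (map_terms \<alpha> \<beta> f) (\<alpha> n) = (\<Sum>m\<in>supp f. if m = n then \<beta> n (cf f n) else 0)"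
    using assms by (auto simp: map_terms_def lookup_sum cf_sg inj_eq intro!: sum.cong)
  also have "\<dots> = \<beta> n (cf f n)"
    using assms by (auto simp: sum.delta in_keys_iff)
  finally show ?thesis .
qed

lemma cf_map_terms:
  assumes "\<And>n. \<beta> n 0 = 0"
  shows "cf (map_terms (\<lambda>n. n) \<beta> f) n = \<beta> n (cf f n)"
  using cf_map_terms_inj[of "\<lambda>n. n" \<beta> f n] assms by simp

definition ring_map :: "('a::comm_ring_1 \<Rightarrow> 'b::comm_ring_1) \<Rightarrow> bool" where
  "ring_map \<phi> \<longleftrightarrow> \<phi> 1 = 1 \<and> (\<forall>a b. \<phi> (a + b) = \<phi> a + \<phi> b) \<and> (\<forall>a b. \<phi> (a * b) = \<phi> a * \<phi> b)"

lemma ring_mapD: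
  assumes "ring_map \<phi>"
  shows "\<phi> 1 = 1" "\<phi> 0 = 0" "\<phi> (a + b) = \<phi> a + \<phi> b" "\<phi> (a * b) = \<phi> a * \<phi> b"
    "\<phi> (- a) = - \<phi> a" "\<phi> (a - b) = \<phi> a - \<phi> b" "\<phi> (a ^ k) = \<phi> a ^ k"
    "\<phi> (sum F A) = (\<Sum>x\<in>A. \<phi> (F x))" "\<phi> (prod F A) = (\<Prod>x\<in>A. \<phi> (F x))"
proof -
  note h = assms[unfolded ring_map_def]
  show 1: "\<phi> 1 = 1" and m: "\<phi> (a * b) = \<phi> a * \<phi> b" and ad: "\<phi> (a + b) = \<phi> a + \<phi> b"
    using h by auto
  show z: "\<phi> 0 = 0"
    using h by (metis add_cancel_right_right)
  have mi: "\<phi> (- b) = - \<phi> b" for b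
    using h z by (metis add.right_inverse eq_neg_iff_add_eq_0 add.commute)
  show "\<phi> (- a) = - \<phi> a" by (rule mi)
  show "\<phi> (a - b) = \<phi> a - \<phi> b"
    using h mi by (metis add_uminus_conv_diff)
  show "\<phi> (a ^ k) = \<phi> a ^ k"
    by (induction k) (use h in auto)
  show "\<phi> (sum F A) = (\<Sum>x\<in>A. \<phi> (F x))"
    by (induction A rule: infinite_finite_induct) (use h z in auto)
  show "\<phi> (prod F A) = (\<Prod>x\<in>A. \<phi> (F x))"
    by (induction A rule: infinite_finite_induct) (use h z in auto)
qed

lemma ring_map_dvd: "ring_map \<phi> \<Longrightarrow> a dvd b \<Longrightarrow> \<phi> a dvd \<phi> b"
  by (auto simp: ring_mapD dvd_def)

definition lmap :: "('a::comm_ring_1 \<Rightarrow> 'b::comm_ring_1) \<Rightarrow> ('d::finite, 'a) laurent \<Rightarrow> ('d, 'b) laurent" where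
  "lmap \<phi> = map_terms (\<lambda>n. n) (\<lambda>_. \<phi>)"

lemma cf_lmap: "\<phi> 0 = 0 \<Longrightarrow> cf (lmap \<phi> f) n = \<phi> (cf f n)"
  by (simp add: lmap_def cf_map_terms)

lemma lmap_sg: "\<phi> 0 = 0 \<Longrightarrow> lmap \<phi> (sg n c) = sg n (\<phi> c)"
  by (simp add: lmap_def map_terms_sg)

lemma ring_map_lmap: "ring_map \<phi> \<Longrightarrow> ring_map (lmap \<phi> :: ('d::finite, _) laurent \<Rightarrow> _)"
  by (subst ring_map_def)
    (auto simp: lmap_def ring_mapD map_terms_add map_terms_mult map_terms_sg simp flip: single_one)

lemma to_complex_eq: "to_complex = lmap of_int"
  by (intro ext laurent_eqI) (simp add: to_complex_def cf_lmap Poly_Mapping.map.rep_eq when_def)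

lemma ring_map_of_int: "ring_map (of_int :: int \<Rightarrow> 'a::comm_ring_1)"
  by (simp add: ring_map_def)

lemma ring_map_to_complex: "ring_map (to_complex :: ('d::finite, int) laurent \<Rightarrow> _)"
  by (simp add: to_complex_eq ring_map_lmap ring_map_of_int)

lemma cf_to_complex: "cf (to_complex f) n = of_int (cf f n)"
  by (simp add: to_complex_eq cf_lmap)

lemma supp_to_complex [simp]: "supp (to_complex f) = supp f"
  by (auto simp: in_keys_iff cf_to_complex)

lemma to_complex_eq_iff [simp]: "to_complex f = to_complex g \<longleftrightarrow> f = g"
  by (auto simp: poly_mapping_eq_iff fun_eq_iff cf_to_complex)

lemma ring_map_rescale:
  assumes "\<And>i. z i \<noteq> 0"
  shows "ring_map (rescale z)"
proof -
  have r: "rescale z = map_terms (\<lambda>n. n) (\<lambda>n c. c * (\<Prod>i\<in>UNIV. z i powi (n $ i)))"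
    by (intro ext laurent_eqI) (simp add: lookup_rescale cf_map_terms)
  show ?thesis
    unfolding ring_map_def r using assms
    by (auto simp: map_terms_add ring_distribs map_terms_sg power_int_add prod.distrib algebra_simps
        simp flip: single_one intro!: map_terms_mult)
qed

lemma rescale_rescale: "rescale z (rescale w f) = rescale (\<lambda>i. z i * w i) f"
  by (rule laurent_eqI) (simp add: lookup_rescale power_int_mult_distrib prod.distrib mult_ac)

lemma rescale_one [simp]: "rescale (\<lambda>i. 1) f = f"
  by (rule laurent_eqI) (simp add: lookup_rescale)

lemma supp_rescale: "(\<And>i. z i \<noteq> 0) \<Longrightarrow> supp (rescale z f) = supp f"
  by (auto simp: in_keys_iff lookup_rescale)

section \<open>Leading terms and zero divisors\<close>

definition dp :: "int ^ 'd::finite \<Rightarrow> int ^ 'd \<Rightarrow> int" where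
  "dp v n = (\<Sum>i\<in>UNIV. v $ i * n $ i)"

lemma dp_simps:
  "dp v (n + m) = dp v n + dp v m" "dp v (n - m) = dp v n - dp v m" "dp v (- n) = - dp v n"
  "dp (v + w) n = dp v n + dp w n" "dp (- v) n = - dp v n" "dp v 0 = 0" "dp 0 n = 0"
  by (simp_all add: dp_def algebra_simps sum.distrib sum_subtractf sum_negf)

lemma dp_scale: "dp (k *s v) n = k * dp v n" "dp v (k *s n) = k * dp v n"
  by (simp_all add: dp_def sum_distrib_left mult_ac)

lemma dp_self: "n \<noteq> 0 \<Longrightarrow> dp n n > 0"
proof -
  assume "n \<noteq> 0"
  then obtain i where "n $ i \<noteq> 0" by (auto simp: vec_eq_iff)
  then have "0 < n $ i * n $ i" by (simp add: zero_less_mult_iff; linarith)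
  also have "\<dots> \<le> dp n n"
    unfolding dp_def by (rule member_le_sum) auto
  finally show ?thesis .
qed

lemma dp_axis: "dp (axis i 1) n = n $ i"
proof -
  have "dp (axis i 1) n = (\<Sum>j\<in>UNIV. if j = i then n $ i else 0)"
    unfolding dp_def by (rule sum.cong) (auto simp: axis_def)
  then show ?thesis by simp
qed

text \<open>
Finitely many nonzero vectors lie off a common hyperplane: given a functional \<open>w\<close> that is good for
all vectors but \<open>n\<close>, the functional \<open>K w + n\<close> is good for \<open>n\<close> as well if \<open>K\<close> is large.
\<close>

lemma generic_functional:
  assumes "finite (D :: (int ^ 'd::finite) set)" "0 \<notin> D"
  shows "\<exists>u. \<forall>n\<in>D. dp u n \<noteq> 0"
  using assms
proof (induction D rule: finite_induct)
  case empty
  then show ?case by blast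
next
  case (insert n D)
  then obtain w where w: "\<And>m. m \<in> D \<Longrightarrow> dp w m \<noteq> 0" by auto
  show ?case
  proof (cases "dp w n = 0")
    case False
    then show ?thesis using w by blast
  next
    case True
    define K where "K = 1 + (\<Sum>m\<in>D. \<bar>dp n m\<bar>)"
    have "dp (K *s w + n) m \<noteq> 0" if "m \<in> insert n D" for m
    proof (cases "m = n")
      case True
      then show ?thesis
        using \<open>dp w n = 0\<close> dp_self[of n] insert.prems by (auto simp: dp_simps dp_scale)
    next
      case False
      then have m: "m \<in> D" using that by simp
      have "\<bar>dp n m\<bar> \<le> (\<Sum>m\<in>D. \<bar>dp n m\<bar>)"
        using m insert.hyps by (intro member_le_sum) auto
      then have "\<bar>dp n m\<bar> < K" by (simp add: K_def)
      moreover have "K * 1 \<le> K * \<bar>dp w m\<bar>"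
        using w[OF m] \<open>\<bar>dp n m\<bar> < K\<close> by (intro mult_left_mono) auto
      then have "K \<le> \<bar>K * dp w m\<bar>"
        using \<open>\<bar>dp n m\<bar> < K\<close> by (simp add: abs_mult)
      ultimately have "K * dp w m + dp n m \<noteq> 0" by linarith
      then show ?thesis
        by (simp add: dp_simps dp_scale)
    qed
    then show ?thesis by blast
  qed
qed

text \<open>
A large multiple of \<open>v\<close> is perturbed by a generic functional, which separates the vectors that \<open>v\<close>
does not see.
\<close>

lemma generic_functional_refines:
  assumes "finite (D :: (int ^ 'd::finite) set)" "0 \<notin> D"
  shows "\<exists>w. \<forall>n\<in>D. dp w n \<noteq> 0 \<and> (dp v n > 0 \<longrightarrow> dp w n > 0)"
proof -
  obtain u where u: "\<And>m. m \<in> D \<Longrightarrow> dp u m \<noteq> 0"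
    using generic_functional[OF assms] by blast
  define K where "K = 1 + (\<Sum>m\<in>D. \<bar>dp u m\<bar>)"
  have "dp (K *s v + u) m \<noteq> 0 \<and> (dp v m > 0 \<longrightarrow> dp (K *s v + u) m > 0)" if m: "m \<in> D" for m
  proof -
    have "\<bar>dp u m\<bar> \<le> (\<Sum>m\<in>D. \<bar>dp u m\<bar>)"
      using m assms(1) by (intro member_le_sum) auto
    then have *: "\<bar>dp u m\<bar> < K" by (simp add: K_def)
    consider "dp v m = 0" | "dp v m \<ge> 1" | "dp v m \<le> -1" by linarith
    then show ?thesis
    proof cases
      case 1
      then show ?thesis using u[OF m] by (simp add: dp_simps dp_scale)
    next
      case 2
      then have "K * 1 \<le> K * dp v m" using * by (intro mult_left_mono) auto
      then have "0 < dp (K *s v + u) m" using * unfolding dp_simps dp_scale by linarith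
      then show ?thesis by simp
    next
      case 3
      then have "K * dp v m \<le> K * (-1)" using * by (intro mult_left_mono) auto
      then have "dp (K *s v + u) m < 0" using * unfolding dp_simps dp_scale by linarith
      then show ?thesis using 3 by simp
    qed
  qed
  then show ?thesis by blast
qed

text \<open>The exponent \<open>n\<close> is the vertex of the Newton polytope at which \<open>w\<close> attains its strict maximum.\<close>

definition lead :: "int ^ 'd::finite \<Rightarrow> ('d, 'a::zero) laurent \<Rightarrow> int ^ 'd \<Rightarrow> bool" where
  "lead w f n \<longleftrightarrow> n \<in> supp f \<and> (\<forall>m\<in>supp f. m \<noteq> n \<longrightarrow> dp w m < dp w n)"

text \<open>
Refining \<open>v\<close> allows maxima of \<open>v\<close> on the Newton polytopes of finitely many polynomials
to be attained at vertices, where products can be controlled.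
\<close>

lemma lead_exists_refines:
  assumes "finite \<F>" "0 \<notin> \<F>"
  shows "\<exists>w. \<forall>f\<in>\<F>. \<exists>a. lead w f a \<and> (\<forall>m\<in>supp f. dp v m \<le> dp v a)"
proof -
  \<comment> \<open>a functional that does not vanish on the differences of exponents is injective on each support\<close>
  define D where "D = (\<Union>f\<in>\<F>. (\<lambda>(a, b). a - b) ` (supp f \<times> supp f)) - {0}"
  have "finite D" "0 \<notin> D"
    using assms by (auto simp: D_def)
  then obtain w where w: "\<And>n. n \<in> D \<Longrightarrow> dp w n \<noteq> 0 \<and> (dp v n > 0 \<longrightarrow> dp w n > 0)"
    using generic_functional_refines[of D v] by blast
  have "\<exists>a. lead w f a \<and> (\<forall>m\<in>supp f. dp v m \<le> dp v a)" if f: "f \<in> \<F>" for f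
  proof -
    have "supp f \<noteq> {}" using f assms(2) by auto
    then have "Max (dp w ` supp f) \<in> dp w ` supp f" by (intro Max_in) auto
    then obtain a where a0: "a \<in> supp f" "dp w a = Max (dp w ` supp f)" by auto
    then have a: "a \<in> supp f" "\<And>m. m \<in> supp f \<Longrightarrow> dp w m \<le> dp w a" by auto
    have diff: "m - a \<in> D" "a - m \<in> D" if "m \<in> supp f" "m \<noteq> a" for m
      using that a(1) f by (force simp: D_def)+
    have "dp w m < dp w a" if "m \<in> supp f" "m \<noteq> a" for m
      using w[OF diff(1)[OF that]] a(2)[OF that(1)] by (simp add: dp_simps)
    moreover have "dp v m \<le> dp v a" if "m \<in> supp f" for m
      using w[OF diff(1)[OF that]] a(2)[OF that] by (cases "m = a") (auto simp: dp_simps)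
    ultimately show ?thesis using a(1) by (auto simp: lead_def)
  qed
  then show ?thesis by blast
qed

lemma lead_mult:
  fixes f g :: "('d::finite, 'a::idom) laurent"
  assumes "lead w f a" "lead w g b"
  shows "lead w (f * g) (a + b)" "cf (f * g) (a + b) = cf f a * cf g b"
proof -
  have *: "dp w (a' + b') < dp w (a + b)" if "a' \<in> supp f" "b' \<in> supp g" "(a', b') \<noteq> (a, b)" for a' b'
    using assms that unfolding lead_def dp_simps by (smt (verit) prod.inject)
  have "cf (f * g) (a + b) = (\<Sum>a'\<in>supp f. if a' = a then cf f a * cf g b else 0)"
    unfolding cf_mult
  proof (rule sum.cong)
    fix a' assume a': "a' \<in> supp f"
    show "cf f a' * cf g (a + b - a') = (if a' = a then cf f a * cf g b else 0)"
    proof (cases "a' = a")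
      case False
      then have "a + b - a' \<notin> supp g"
        using *[OF a', of "a + b - a'"] by auto
      then show ?thesis using False by (simp add: in_keys_iff)
    qed auto
  qed simp
  also have "\<dots> = cf f a * cf g b"
    using assms by (simp add: lead_def sum.delta)
  finally show cf: "cf (f * g) (a + b) = cf f a * cf g b" .
  have "a + b \<in> supp (f * g)"
    using assms by (simp add: in_keys_iff cf lead_def)
  moreover have "dp w m < dp w (a + b)" if "m \<in> supp (f * g)" "m \<noteq> a + b" for m
    using that(1) by (rule supp_multE) (use * that(2) in auto)
  ultimately show "lead w (f * g) (a + b)" by (auto simp: lead_def)
qed

lemma lead_unique: "lead w f a \<Longrightarrow> lead w f b \<Longrightarrow> a = b"
  unfolding lead_def by (metis less_asym)

text \<open>For a functional that has strict maxima on both supports, the leading terms multiply.\<close>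

lemma laurent_mult_eq_0_iff [simp]:
  fixes f g :: "('d::finite, 'a::idom) laurent"
  shows "f * g = 0 \<longleftrightarrow> f = 0 \<or> g = 0"
proof -
  have "f * g \<noteq> 0" if nz: "f \<noteq> 0" "g \<noteq> 0"
  proof -
    have "finite {f, g}" "0 \<notin> {f, g}" using nz by auto
    from lead_exists_refines[OF this, of 0] obtain w
      where "\<forall>h\<in>{f, g}. \<exists>a. lead w h a \<and> (\<forall>m\<in>supp h. dp 0 m \<le> dp 0 a)" ..
    then obtain a b where "lead w f a" "lead w g b" by blast
    then show ?thesis using lead_mult(1)[of w f a g b] by (auto simp: lead_def)
  qed
  then show ?thesis by auto
qed

lemma laurent_mult_cancel:
  fixes f g h :: "('d::finite, 'a::idom) laurent"
  assumes "f \<noteq> 0"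
  shows "f * g = f * h \<longleftrightarrow> g = h"
proof
  assume "f * g = f * h"
  then have "f * (g - h) = 0" by (simp add: algebra_simps)
  then show "g = h" using assms by simp
qed auto

lemma laurent_power_eq_0_iff [simp]:
  fixes f :: "('d::finite, 'a::idom) laurent"
  shows "f ^ k = 0 \<longleftrightarrow> f = 0 \<and> k > 0"
  by (induction k) auto

lemma laurent_prod_eq_0_iff:
  fixes F :: "'b \<Rightarrow> ('d::finite, 'a::idom) laurent"
  shows "finite A \<Longrightarrow> prod F A = 0 \<longleftrightarrow> (\<exists>x\<in>A. F x = 0)"
  by (induction A rule: finite_induct) auto

lemma laurent_dvd_mult_cancel:
  fixes f g h :: "('d::finite, 'a::idom) laurent"
  assumes "f \<noteq> 0"
  shows "f * g dvd f * h \<longleftrightarrow> g dvd h"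
  using assms by (auto simp: dvd_def mult.assoc laurent_mult_cancel)

section \<open>Degrees and widths\<close>

text \<open>The support function of the Newton polytope; it is additive on products, like a degree.\<close>

definition hi :: "int ^ 'd::finite \<Rightarrow> ('d, 'a::zero) laurent \<Rightarrow> int" where
  "hi v f = Max (dp v ` supp f)"

lemma hi_ge: "n \<in> supp f \<Longrightarrow> dp v n \<le> hi v f"
  by (simp add: hi_def)

lemma hi_attained:
  assumes "f \<noteq> 0"
  obtains n where "n \<in> supp f" "dp v n = hi v f"
proof -
  have "hi v f \<in> dp v ` supp f"
    unfolding hi_def using assms by (intro Max_in) auto
  then show ?thesis using that by auto
qed

lemma hi_le: "f \<noteq> 0 \<Longrightarrow> (\<And>n. n \<in> supp f \<Longrightarrow> dp v n \<le> k) \<Longrightarrow> hi v f \<le> k"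
  by (metis hi_attained)

lemma hi_eqI: "n \<in> supp f \<Longrightarrow> (\<And>m. m \<in> supp f \<Longrightarrow> dp v m \<le> dp v n) \<Longrightarrow> hi v f = dp v n"
  unfolding hi_def by (rule Max_eqI) auto

text \<open>The maximum of \<open>v\<close> need not be attained at a single exponent; a refinement of \<open>v\<close> singles one out.\<close>

lemma hi_mult:
  fixes f g :: "('d::finite, 'a::idom) laurent"
  assumes "f \<noteq> 0" "g \<noteq> 0"
  shows "hi v (f * g) = hi v f + hi v g"
proof -
  have "finite {f, g}" "0 \<notin> {f, g}" using assms by auto
  from lead_exists_refines[OF this, of v] obtain w
    where w: "\<forall>h\<in>{f, g}. \<exists>a. lead w h a \<and> (\<forall>m\<in>supp h. dp v m \<le> dp v a)" ..
  then obtain a b where a: "lead w f a" "\<And>m. m \<in> supp f \<Longrightarrow> dp v m \<le> dp v a"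
    and b: "lead w g b" "\<And>m. m \<in> supp g \<Longrightarrow> dp v m \<le> dp v b" by blast
  have "hi v (f * g) = dp v (a + b)"
    using a b lead_mult(1)[OF a(1) b(1)]
    by (intro hi_eqI) (auto simp: lead_def dp_simps elim!: supp_multE intro!: add_mono)
  moreover have "hi v f = dp v a" "hi v g = dp v b"
    using a b by (auto intro!: hi_eqI simp: lead_def)
  ultimately show ?thesis by (simp add: dp_simps)
qed

text \<open>
Unlike a degree, the width does not change under multiplication by monomials, which are units; it is
therefore the right measure of size for divisibility.
\<close>

definition width :: "int ^ 'd::finite \<Rightarrow> ('d, 'a::zero) laurent \<Rightarrow> nat" where
  "width v f = (if f = 0 then 0 else nat (hi v f + hi (- v) f))"

lemma hi_uminus: "n \<in> supp f \<Longrightarrow> - hi (- v) f \<le> dp v n"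
  using hi_ge[of n f "- v"] by (simp add: dp_simps)

lemma width_int: "f \<noteq> 0 \<Longrightarrow> int (width v f) = hi v f + hi (- v) f"
proof -
  assume f: "f \<noteq> 0"
  then obtain n where "n \<in> supp f" by (meson hi_attained)
  from hi_ge[OF this, of v] hi_uminus[OF this, of v] have "0 \<le> hi v f + hi (- v) f" by linarith
  then show ?thesis using f by (simp add: width_def)
qed

lemma width_mult:
  fixes f g :: "('d::finite, 'a::idom) laurent"
  assumes "f \<noteq> 0" "g \<noteq> 0"
  shows "width v (f * g) = width v f + width v g"
proof -
  have "int (width v (f * g)) = int (width v f + width v g)"
    using assms by (simp add: width_int hi_mult)
  then show ?thesis by linarith
qed

lemma width_dvd:
  fixes f g :: "('d::finite, 'a::idom) laurent"
  assumes "f dvd g" "g \<noteq> 0"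
  shows "width v f \<le> width v g"
  using assms by (auto simp: dvd_def width_mult)

lemma width_eq_0_iff:
  "width v f = 0 \<longleftrightarrow> (\<forall>n\<in>supp f. \<forall>m\<in>supp f. dp v n = dp v m)"
proof (cases "f = 0")
  case False
  have "width v f = 0 \<longleftrightarrow> hi v f + hi (- v) f = 0"
    using width_int[OF False, of v] by linarith
  also have "\<dots> \<longleftrightarrow> (\<forall>n\<in>supp f. \<forall>m\<in>supp f. dp v n = dp v m)"
  proof
    assume "hi v f + hi (- v) f = 0"
    then have "- hi (- v) f = hi v f" by simp
    then show "\<forall>n\<in>supp f. \<forall>m\<in>supp f. dp v n = dp v m"
      by (metis add.inverse_unique hi_ge hi_uminus minus_minus order_antisym)
  next
    assume *: "\<forall>n\<in>supp f. \<forall>m\<in>supp f. dp v n = dp v m"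
    obtain n where n: "n \<in> supp f" "dp v n = hi v f" using hi_attained[OF False] by blast
    obtain m where m: "m \<in> supp f" "dp (-v) m = hi (-v) f" using hi_attained[OF False] by blast
    have "dp v n = dp v m" using * n(1) m(1) by blast
    then show "hi v f + hi (- v) f = 0" using n(2) m(2) by (simp add: dp_simps)
  qed
  finally show ?thesis .
qed (simp add: width_def)

lemma width_one [simp]: "width v (1 :: ('d::finite, 'a::{comm_monoid_add, zero_neq_one}) laurent) = 0"
  by (simp add: width_eq_0_iff)

lemma width_le_diff:
  assumes "n \<in> supp f" "m \<in> supp f"
  shows "\<bar>dp v n - dp v m\<bar> \<le> int (width v f)"
proof -
  have "f \<noteq> 0" using assms by auto
  then show ?thesis
    using width_int[of f v] hi_ge[OF assms(1), of v] hi_ge[OF assms(2), of v]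
      hi_uminus[OF assms(1), of v] hi_uminus[OF assms(2), of v] by linarith
qed

lemma width_supp_cong: "supp f = supp g \<Longrightarrow> width v f = width v g"
  by (auto simp: width_def hi_def simp flip: keys_eq_empty)

abbreviation cwidth :: "'d \<Rightarrow> ('d::finite, 'a::zero) laurent \<Rightarrow> nat" where
  "cwidth i \<equiv> width (axis i 1)"

lemma cwidth_eq_0_iff: "cwidth i f = 0 \<longleftrightarrow> (\<forall>n\<in>supp f. \<forall>m\<in>supp f. n $ i = m $ i)"
  by (simp add: width_eq_0_iff dp_axis)

lemma monomial_if_cwidth:
  fixes f :: "('d::finite, 'a::comm_monoid_add) laurent"
  assumes "f \<noteq> 0" "\<And>i. cwidth i f = 0"
  shows "\<exists>n c. c \<noteq> 0 \<and> f = sg n c"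
proof -
  have eq: "n = m" if "n \<in> supp f" "m \<in> supp f" for n m
  proof -
    have "n $ i = m $ i" for i
      using assms(2)[of i] that unfolding cwidth_eq_0_iff by blast
    then show ?thesis by (simp add: vec_eq_iff)
  qed
  obtain n where n: "n \<in> supp f" using assms(1) by (meson hi_attained)
  have "f = (\<Sum>n\<in>{n}. sg n (cf f n))"
    using n eq by (intro laurent_sum_on) auto
  then have "f = sg n (cf f n)" by simp
  moreover have "cf f n \<noteq> 0" using n by (simp add: in_keys_iff)
  ultimately show ?thesis by blast
qed

lemma cwidth_sg [simp]: "cwidth i (sg n c) = 0"
  by (simp add: cwidth_eq_0_iff)

lemma sg_unit: "c dvd 1 \<Longrightarrow> sg n c dvd (1 :: ('d::finite, 'a::comm_ring_1) laurent)"
proof -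
  assume "c dvd 1"
  then obtain e where "1 = c * e" by (rule dvdE)
  then have "c * e = 1" by (rule sym)
  then have "sg n c * sg (- n) e = 1" by (simp add: sg_mult_sg)
  then show ?thesis by (metis dvd_triv_left)
qed

text \<open>Widths are additive, so those of a unit are \<open>0\<close>.\<close>

lemma unit_iff_monomial:
  fixes f :: "('d::finite, 'a::idom) laurent"
  shows "f dvd 1 \<longleftrightarrow> (\<exists>n c. c dvd 1 \<and> f = sg n c)"
proof
  assume "f dvd 1"
  then obtain g where "1 = f * g" by (rule dvdE)
  then have g: "f * g = 1" by (rule sym)
  then have nz: "f \<noteq> 0" "g \<noteq> 0" by auto
  have "cwidth i f = 0" "cwidth i g = 0" for i
    using width_mult[OF nz, of "axis i 1"] by (simp_all add: g)
  then obtain n c where f: "f = sg n c"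
    using monomial_if_cwidth[OF nz(1)] by blast
  from \<open>\<And>i. cwidth i g = 0\<close> obtain m e where "g = sg m e"
    using monomial_if_cwidth[OF nz(2)] by blast
  then have "sg (n + m) (c * e) = sg 0 1"
    using g f by (simp add: sg_mult_sg)
  then have "c * e = 1"
    using cf_sg[of "n + m" "c * e" 0] cf_sg[of 0 "1 :: 'a" 0] by (auto split: if_splits)
  then show "\<exists>n c. c dvd 1 \<and> f = sg n c" using f by (metis dvd_triv_left)
qed (auto simp: sg_unit)

section \<open>Division with remainder in one variable\<close>

lemma axis_add: "axis i (a + b) = axis i a + (axis i b :: int ^ 'd::finite)"
  by (simp add: axis_def vec_eq_iff)

lemma sg_eq_0_iff: "sg n c = 0 \<longleftrightarrow> c = 0"
  by (metis cf_sg lookup_zero single_zero)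

text \<open>
Polynomials in the variables \<open>x_i\<close>, \<open>i\<close> in \<open>I\<close>.  Letting \<open>I\<close> grow from the empty set to the full set is
the way to do induction on the number of variables while the dimension is fixed by a type.
\<close>

definition over :: "'d set \<Rightarrow> ('d::finite, 'a::zero) laurent \<Rightarrow> bool" where
  "over I f \<longleftrightarrow> (\<forall>n\<in>supp f. \<forall>j. j \<notin> I \<longrightarrow> n $ j = 0)"

text \<open>The terms with \<open>x_i^k\<close>, including that power: the coefficient of \<open>x_i^k\<close> is a shift of it.\<close>

definition slice :: "'d \<Rightarrow> int \<Rightarrow> ('d::finite, 'a::comm_monoid_add) laurent \<Rightarrow> ('d, 'a) laurent" where
  "slice i k = map_terms (\<lambda>n. n) (\<lambda>n c. if n $ i = k then c else 0)"

lemma cf_slice: "cf (slice i k f) n = (if n $ i = k then cf f n else 0)"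
  by (simp add: slice_def cf_map_terms)

lemma supp_slice: "supp (slice i k f) = {n \<in> supp f. n $ i = k}"
  by (auto simp: in_keys_iff cf_slice split: if_splits)

abbreviation tdeg :: "'d \<Rightarrow> ('d::finite, 'a::zero) laurent \<Rightarrow> int" where
  "tdeg i \<equiv> hi (axis i 1)"

lemma top_ge: "n \<in> supp f \<Longrightarrow> n $ i \<le> tdeg i f"
  using hi_ge[of n f "axis i 1"] by (simp add: dp_axis)

lemma bot_le: "n \<in> supp f \<Longrightarrow> - hi (- axis i 1) f \<le> n $ i"
  using hi_uminus[of n f "axis i 1"] by (simp add: dp_axis)

lemma slice_top_nonzero: "f \<noteq> 0 \<Longrightarrow> slice i (tdeg i f) f \<noteq> 0"
  by (metis (mono_tags, lifting) dp_axis empty_iff hi_attained keys_zero mem_Collect_eq supp_slice)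

lemma slice_mult_over:
  fixes c f :: "('d::finite, 'a::comm_ring_1) laurent"
  assumes "over (- {i}) c"
  shows "slice i k (c * f) = c * slice i k f"
  using assms by (intro laurent_eqI) (auto simp: cf_slice cf_mult over_def intro!: sum.neutral sum.cong)

lemma slice_shift:
  fixes f :: "('d::finite, 'a::comm_ring_1) laurent"
  shows "slice i (k + l) (sg (axis i l) 1 * f) = sg (axis i l) 1 * slice i k f"
  by (rule laurent_eqI) (auto simp: cf_slice cf_sg_mult axis_def)

lemma slice_top_mult:
  fixes f g :: "('d::finite, 'a::idom) laurent"
  shows "slice i (tdeg i f + tdeg i g) (f * g) = slice i (tdeg i f) f * slice i (tdeg i g) g"
proof (rule laurent_eqI)
  fix n
  have "cf (slice i (tdeg i f) f * slice i (tdeg i g) g) n =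
      (\<Sum>a\<in>supp f. cf (slice i (tdeg i f) f) a * cf (slice i (tdeg i g) g) (n - a))"
    by (rule cf_mult_on) (auto simp: supp_slice)
  also have "\<dots> = (if n $ i = tdeg i f + tdeg i g then cf (f * g) n else 0)"
  proof (cases "n $ i = tdeg i f + tdeg i g")
    case True
    have "cf (slice i (tdeg i f) f) a * cf (slice i (tdeg i g) g) (n - a) = cf f a * cf g (n - a)"
      if "a \<in> supp f" for a
    proof (cases "n - a \<in> supp g")
      case b: True
      from top_ge[OF that, of i] top_ge[OF b, of i] True
      have "a $ i = tdeg i f" "(n - a) $ i = tdeg i g" by auto
      then show ?thesis by (simp add: cf_slice)
    next
      case False
      then show ?thesis by (simp add: in_keys_iff cf_slice)
    qed
    then show ?thesis using True by (simp add: cf_mult)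
  next
    case False
    have "cf (slice i (tdeg i f) f) a * cf (slice i (tdeg i g) g) (n - a) = 0" for a
      using False by (auto simp: cf_slice)
    then have "(\<Sum>a\<in>supp f. cf (slice i (tdeg i f) f) a * cf (slice i (tdeg i g) g) (n - a)) = 0"
      by (intro sum.neutral) blast
    then show ?thesis using False by simp
  qed
  finally show "cf (slice i (tdeg i f + tdeg i g) (f * g)) n
      = cf (slice i (tdeg i f) f * slice i (tdeg i g) g) n"
    by (simp add: cf_slice)
qed

lemma over_add: "over I f \<Longrightarrow> over I g \<Longrightarrow> over I (f + g :: ('d::finite, 'a::ab_group_add) laurent)"
  using supp_add[of f g] by (auto simp: over_def)

lemma over_diff: "over I f \<Longrightarrow> over I g \<Longrightarrow> over I (f - g :: ('d::finite, 'a::ab_group_add) laurent)"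
  using supp_diff[of f g] by (auto simp: over_def)

lemma over_mult: "over I f \<Longrightarrow> over I g \<Longrightarrow> over I (f * g :: ('d::finite, 'a::comm_ring_1) laurent)"
  by (auto simp: over_def elim!: supp_multE)

lemma over_slice: "over I f \<Longrightarrow> over I (slice i k f)"
  by (auto simp: over_def supp_slice)

lemma over_shift: "i \<in> I \<Longrightarrow> over I (sg (axis i k) c)"
  by (auto simp: over_def axis_def)

lemma over_one [simp]: "over I (1 :: ('d::finite, 'a::{comm_monoid_add, zero_neq_one}) laurent)"
  by (auto simp: over_def)

lemma over_UNIV [simp]: "over UNIV f"
  by (auto simp: over_def)

lemma over_mono: "over I f \<Longrightarrow> I \<subseteq> J \<Longrightarrow> over J f"
  by (auto simp: over_def)

lemma over_imp_cwidth: "over I f \<Longrightarrow> i \<notin> I \<Longrightarrow> cwidth i f = 0"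
  by (auto simp: over_def cwidth_eq_0_iff)

text \<open>
Division with remainder in \<open>x_i\<close> uses only the coefficients with respect to \<open>x_i\<close>.  It is needed
in three rings: the polynomials over a set of variables (for unique factorization), the full ring
(for Bezout relations), and the polynomials over \<open>Z[z]\<close> for a root of unity \<open>z\<close>, where the results
must be compatible with conjugation.
\<close>

locale slice_ring =
  fixes S :: "('d::finite, 'a::idom) laurent set" and i :: 'd
  assumes one: "1 \<in> S"
    and add: "f \<in> S \<Longrightarrow> g \<in> S \<Longrightarrow> f + g \<in> S"
    and diff: "f \<in> S \<Longrightarrow> g \<in> S \<Longrightarrow> f - g \<in> S"
    and mult: "f \<in> S \<Longrightarrow> g \<in> S \<Longrightarrow> f * g \<in> S"
    and slice: "f \<in> S \<Longrightarrow> slice i k f \<in> S"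
    and shift: "sg (axis i k) 1 \<in> S"
begin

lemma zero: "0 \<in> S"
  using diff[OF one one] by simp

text \<open>
The top coefficient of \<open>g\<close> is cancelled after multiplication by that of \<open>r\<close>.  The size that
decreases is the width in \<open>x_i\<close>, so the bottom degree must not drop either.
\<close>

lemma pseudo_division:
  assumes r: "r \<in> S" "r \<noteq> 0" and g: "g \<in> S"
  shows "\<exists>c s g'. c \<in> S \<and> s \<in> S \<and> g' \<in> S \<and> over (- {i}) c \<and> c \<noteq> 0 \<and> c * g = s * r + g' \<and>
    (g' = 0 \<or> cwidth i g' < cwidth i r)"
  using g
proof (induction "cwidth i g" arbitrary: g rule: less_induct)
  case less
  show ?case
  proof (cases "g = 0 \<or> cwidth i g < cwidth i r")
    case True
    then show ?thesis
      using less.prems one zero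
      by (intro exI[of _ 1] exI[of _ 0] exI[of _ g]) auto
  next
    case False
    then have g0: "g \<noteq> 0" and w: "cwidth i r \<le> cwidth i g" by auto
    \<comment> \<open>the top coefficients of \<open>r\<close> and \<open>g\<close>, shifted to be free of \<open>x_i\<close>\<close>
    define lr where "lr = sg (axis i (- tdeg i r)) 1 * slice i (tdeg i r) r"
    define lg where "lg = sg (axis i (- tdeg i g)) 1 * slice i (tdeg i g) g"
    define sh where "sh = (sg (axis i (tdeg i g - tdeg i r)) 1 :: ('d, 'a) laurent)"
    define g1 where "g1 = lr * g - sh * (lg * r)"
    have S: "lr \<in> S" "lg \<in> S" "sh \<in> S"
      using r less.prems by (auto simp: lr_def lg_def sh_def intro!: mult slice shift)
    then have g1S: "g1 \<in> S"
      unfolding g1_def using r less.prems by (intro diff mult)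
    have lr0: "lr \<noteq> 0"
      using slice_top_nonzero[OF r(2), of i] by (simp add: lr_def sg_eq_0_iff)
    have over: "over (- {i}) lr" "over (- {i}) lg"
      by (auto simp: over_def lr_def lg_def supp_sg_mult supp_slice axis_def)
    have top: "slice i (tdeg i g) g1 = 0"
    proof -
      have "slice i (tdeg i g) (lr * g) = lr * slice i (tdeg i g) g"
        by (rule slice_mult_over[OF over(1)])
      moreover have "slice i (tdeg i g) (sh * (lg * r)) = sh * slice i (tdeg i r) (lg * r)"
        using slice_shift[of i "tdeg i r" "tdeg i g - tdeg i r" "lg * r"] by (simp add: sh_def)
      moreover have "slice i (tdeg i r) (lg * r) = lg * slice i (tdeg i r) r"
        by (rule slice_mult_over[OF over(2)])
      moreover have "sg (axis i (- tdeg i r)) 1 = sh * sg (axis i (- tdeg i g)) 1"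
        by (simp add: sh_def sg_mult_sg flip: axis_add)
      moreover have "slice i k (f - g) = slice i k f - slice i k g" for k and f g :: "('d, 'a) laurent"
        by (rule laurent_eqI) (simp add: cf_slice lookup_minus)
      ultimately show ?thesis
        by (simp add: g1_def lr_def lg_def mult_ac)
    qed
    have supp1: "n $ i < tdeg i g \<and> - hi (- axis i 1) g \<le> n $ i" if n: "n \<in> supp g1" for n
    proof -
      have "n $ i \<noteq> tdeg i g"
        using arg_cong[OF top, of "\<lambda>f. cf f n"] n by (auto simp: cf_slice in_keys_iff)
      moreover have "n $ i \<le> tdeg i g \<and> - hi (- axis i 1) g \<le> n $ i"
      proof -
        have "n \<in> supp (lr * g) \<or> n \<in> supp (sh * (lg * r))"
          using n supp_diff[of "lr * g" "sh * (lg * r)"] by (auto simp: g1_def)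
        then show ?thesis
        proof
          assume "n \<in> supp (lr * g)"
          then obtain a b where ab: "a \<in> supp lr" "b \<in> supp g" "n = a + b" by (rule supp_multE)
          then have "a $ i = 0" using over(1) by (auto simp: over_def)
          then show ?thesis using ab top_ge[of b g i] bot_le[of b g i] by simp
        next
          assume "n \<in> supp (sh * (lg * r))"
          then have "n - axis i (tdeg i g - tdeg i r) \<in> supp (lg * r)"
            by (simp add: sh_def supp_sg_mult)
          then obtain a b where ab: "a \<in> supp lg" "b \<in> supp r"
            "n - axis i (tdeg i g - tdeg i r) = a + b" by (rule supp_multE)
          then have "a $ i = 0" using over(2) by (auto simp: over_def)
          moreover have "n $ i = tdeg i g - tdeg i r + (a $ i + b $ i)"
            using arg_cong[OF ab(3), of "\<lambda>v. v $ i"] by (simp add: axis_def)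
          moreover have "tdeg i r + hi (- axis i 1) r \<le> tdeg i g + hi (- axis i 1) g"
            using w width_int[OF r(2), of "axis i 1"] width_int[OF g0, of "axis i 1"] by linarith
          ultimately show ?thesis
            using top_ge[OF ab(2), of i] bot_le[OF ab(2), of i] by linarith
        qed
      qed
      ultimately show ?thesis by auto
    qed
    have "\<exists>c s g'. c \<in> S \<and> s \<in> S \<and> g' \<in> S \<and> over (- {i}) c \<and> c \<noteq> 0 \<and> c * g1 = s * r + g' \<and>
        (g' = 0 \<or> cwidth i g' < cwidth i r)"
    proof (cases "g1 = 0")
      case True
      then show ?thesis
        using one zero by (intro exI[of _ 1] exI[of _ 0]) auto
    next
      case False
      have "tdeg i g1 \<le> tdeg i g - 1"
        using False by (rule hi_le) (use supp1 in \<open>force simp: dp_axis\<close>)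
      moreover have "hi (- axis i 1) g1 \<le> hi (- axis i 1) g"
        using False by (rule hi_le) (use supp1 in \<open>force simp: dp_axis dp_simps\<close>)
      ultimately have "cwidth i g1 < cwidth i g"
        using width_int[OF False, of "axis i 1"] width_int[OF g0, of "axis i 1"] by linarith
      then show ?thesis using less.hyps g1S by blast
    qed
    then obtain c s g' where c: "c \<in> S" "s \<in> S" "g' \<in> S" "over (- {i}) c" "c \<noteq> 0"
      "c * g1 = s * r + g'" "g' = 0 \<or> cwidth i g' < cwidth i r" by blast
    have "(c * lr) * g = (s + c * (sh * lg)) * r + g'"
      using c(6) by (simp add: g1_def algebra_simps)
    then show ?thesis
      using c S lr0 over(1)
      by (intro exI[of _ "c * lr"] exI[of _ "s + c * (sh * lg)"] exI[of _ g'])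
        (auto intro!: mult add over_mult)
  qed
qed

text \<open>
A combination \<open>r\<close> of \<open>f\<close> and \<open>g\<close> of minimal width is a greatest common divisor over the field of
fractions of the polynomials free of \<open>x_i\<close>; \<open>c1\<close> and \<open>c2\<close> clear the denominators.
\<close>

lemma euclid:
  assumes "f \<in> S" "g \<in> S" "f \<noteq> 0"
  obtains r A B c1 c2 s1 s2 where
    "r \<noteq> 0" "r \<in> S" "A \<in> S" "B \<in> S" "c1 \<in> S" "c2 \<in> S" "s1 \<in> S" "s2 \<in> S"
    "r = A * f + B * g" "over (- {i}) c1" "c1 \<noteq> 0" "c1 * f = s1 * r"
    "over (- {i}) c2" "c2 \<noteq> 0" "c2 * g = s2 * r"
proof -
  define J where "J r \<longleftrightarrow> r \<noteq> 0 \<and> (\<exists>A\<in>S. \<exists>B\<in>S. r = A * f + B * g)" for r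
  have "f = 1 * f + 0 * g" by simp
  then have "J f" unfolding J_def using assms one zero by blast
  then obtain r where r: "J r" "\<And>r'. J r' \<Longrightarrow> cwidth i r \<le> cwidth i r'"
    using ex_has_least_nat[of J f "cwidth i"] by blast
  from r(1) obtain A B where AB: "A \<in> S" "B \<in> S" "r = A * f + B * g" "r \<noteq> 0"
    by (auto simp: J_def)
  have rS: "r \<in> S" using AB assms by (auto intro!: add mult)
  have *: "\<exists>c s. c \<in> S \<and> s \<in> S \<and> over (- {i}) c \<and> c \<noteq> 0 \<and> c * h = s * r"
    if h: "h \<in> S" "\<exists>A'\<in>S. \<exists>B'\<in>S. h = A' * f + B' * g" for h
  proof -
    obtain c s g' where c: "c \<in> S" "s \<in> S" "g' \<in> S" "over (- {i}) c" "c \<noteq> 0"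
      "c * h = s * r + g'" "g' = 0 \<or> cwidth i g' < cwidth i r"
      using pseudo_division[OF rS AB(4) h(1)] by blast
    obtain A' B' where AB': "A' \<in> S" "B' \<in> S" "h = A' * f + B' * g" using h(2) by blast
    have "g' = c * h - s * r" using c(6) by simp
    also have "\<dots> = (c * A' - s * A) * f + (c * B' - s * B) * g"
      unfolding AB(3) AB'(3) by (simp add: algebra_simps)
    finally have "J g'" if "g' \<noteq> 0"
      unfolding J_def using that c AB AB' by (blast intro: mult diff)
    then have "g' = 0" using c(7) r(2) by fastforce
    then show ?thesis using c by auto
  qed
  obtain c1 s1 where "c1 \<in> S" "s1 \<in> S" "over (- {i}) c1" "c1 \<noteq> 0" "c1 * f = s1 * r"
    using *[OF assms(1)] one zero by (metis add.right_neutral mult_1 mult_zero_left)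
  moreover obtain c2 s2 where "c2 \<in> S" "s2 \<in> S" "over (- {i}) c2" "c2 \<noteq> 0" "c2 * g = s2 * r"
    using *[OF assms(2)] one zero by (metis add.left_neutral mult_1 mult_zero_left)
  ultimately show ?thesis using that AB rS by blast
qed

end

lemma slice_ring_over: "i \<in> I \<Longrightarrow> slice_ring {f :: ('d::finite, 'a::idom) laurent. over I f} i"
  by standard (auto simp: over_add over_diff over_mult over_slice over_shift)

section \<open>Unique factorization\<close>

lemma over_iff_hi:
  assumes "f \<noteq> 0"
  shows "over I f \<longleftrightarrow> (\<forall>j. j \<notin> I \<longrightarrow> hi (axis j 1) f = 0 \<and> hi (- axis j 1) f = 0)"
proof
  assume *: "over I f"
  show "\<forall>j. j \<notin> I \<longrightarrow> hi (axis j 1) f = 0 \<and> hi (- axis j 1) f = 0"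
  proof (intro allI impI)
    fix j assume "j \<notin> I"
    then have "dp (axis j 1) n = 0 \<and> dp (- axis j 1) n = 0" if "n \<in> supp f" for n
      using * that by (auto simp: over_def dp_axis dp_simps)
    then show "hi (axis j 1) f = 0 \<and> hi (- axis j 1) f = 0"
      by (metis assms hi_attained)
  qed
next
  assume *: "\<forall>j. j \<notin> I \<longrightarrow> hi (axis j 1) f = 0 \<and> hi (- axis j 1) f = 0"
  show "over I f"
    unfolding over_def
  proof (intro ballI allI impI)
    fix n j assume "n \<in> supp f" "j \<notin> I"
    then show "n $ j = 0"
      using * top_ge[of n f j] bot_le[of n f j] by force
  qed
qed

lemma over_quotient:
  fixes g h :: "('d::finite, 'a::idom) laurent"
  assumes "over I (g * h)" "over I g" "g * h \<noteq> 0"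
  shows "over I h"
proof -
  have nz: "g \<noteq> 0" "h \<noteq> 0" using assms(3) by auto
  show ?thesis
    using assms(1,2) nz by (simp add: over_iff_hi hi_mult)
qed

text \<open>
A factor of a polynomial over \<open>I\<close> has width \<open>0\<close> in the other variables, so it is itself over \<open>I\<close> up to a
monomial.
\<close>

lemma over_shifted_factor:
  fixes q c :: "('d::finite, 'a::idom) laurent"
  assumes "q dvd c" "over I c" "c \<noteq> 0"
  obtains n where "over I (sg n 1 * q)"
proof -
  have q: "q \<noteq> 0" using assms by auto
  then obtain m where m: "m \<in> supp q" by (meson hi_attained)
  have "over I (sg (- m) 1 * q)"
    unfolding over_def
  proof (intro ballI allI impI)
    fix n j assume n: "n \<in> supp (sg (- m) 1 * q)" and j: "j \<notin> I"
    have "cwidth j q \<le> cwidth j c" using assms by (intro width_dvd)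
    then have "cwidth j q = 0" using over_imp_cwidth[OF assms(2) j] by simp
    moreover have "n + m \<in> supp q" using n by (simp add: supp_sg_mult)
    ultimately have "(n + m) $ j = m $ j" using m unfolding cwidth_eq_0_iff by blast
    then show "n $ j = 0" by simp
  qed
  then show ?thesis by (rule that)
qed

lemma shift_cancel:
  "sg (axis i k) 1 * (sg (axis i (- k)) 1 * f) = (f :: ('d::finite, 'a::comm_ring_1) laurent)"
proof -
  have "axis i (0 :: int) = 0" by (simp add: vec_eq_iff axis_def)
  then have "axis i k + axis i (- k) = 0" by (metis axis_add add.right_inverse)
  then show ?thesis by (simp add: sg_mult_sg flip: mult.assoc)
qed

lemma over_shift_slice:
  fixes f :: "('d::finite, 'a::idom) laurent"
  assumes "over (insert i I) f"
  shows "over I (sg (axis i (- k)) 1 * slice i k f)"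
  unfolding over_def
proof (intro ballI allI impI)
  fix n j assume "n \<in> supp (sg (axis i (- k)) 1 * slice i k f)" and j: "j \<notin> I"
  then have n: "n - axis i (- k) \<in> supp f" "(n - axis i (- k)) $ i = k"
    by (simp_all add: supp_sg_mult supp_slice)
  show "n $ j = 0"
  proof (cases "j = i")
    case True
    then show ?thesis using n(2) by (simp add: axis_def)
  next
    case False
    then have "(n - axis i (- k)) $ j = 0" using n(1) j assms unfolding over_def by blast
    then show ?thesis using False by (simp add: axis_def)
  qed
qed

lemma card_supp_remove_slice:
  assumes "f \<noteq> 0"
  shows "card (supp (f - slice i (tdeg i f) f)) < card (supp (f :: ('d::finite, 'a::ab_group_add) laurent))"
proof -
  have "slice i (tdeg i f) f \<noteq> 0" using assms by (rule slice_top_nonzero)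
  then obtain n where "n \<in> supp (slice i (tdeg i f) f)" by (meson hi_attained)
  then have "n \<in> supp f" "n \<notin> supp (f - slice i (tdeg i f) f)"
    by (auto simp: supp_slice in_keys_iff lookup_minus cf_slice)
  moreover have "supp (f - slice i (tdeg i f) f) \<subseteq> supp f"
    using supp_diff[of f "slice i (tdeg i f) f"] by (auto simp: supp_slice)
  ultimately have "supp (f - slice i (tdeg i f) f) \<subset> supp f" by blast
  then show ?thesis by (simp add: psubset_card_mono)
qed

text \<open>
Together with the widths this measures the length of a factorization: a factor without width is a
monomial, and then its coefficient is split off from every coefficient.
\<close>

definition coeff_length :: "('d::finite, 'a::factorial_semiring) laurent \<Rightarrow> nat" where
  "coeff_length f = Min ((\<lambda>n. size (prime_factorization (cf f n))) ` supp f)"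

definition total_width :: "('d::finite, 'a::zero) laurent \<Rightarrow> nat" where
  "total_width f = (\<Sum>i\<in>UNIV. cwidth i f)"

lemma total_width_mult:
  fixes f g :: "('d::finite, 'a::idom) laurent"
  shows "f \<noteq> 0 \<Longrightarrow> g \<noteq> 0 \<Longrightarrow> total_width (f * g) = total_width f + total_width g"
  by (simp add: total_width_def width_mult sum.distrib)

lemma total_width_eq_0: "total_width f = 0 \<longleftrightarrow> (\<forall>i. cwidth i f = 0)"
  by (simp add: total_width_def)

lemma proper_divisor_decreases:
  fixes g h :: "('d::finite, 'a::{idom, factorial_semiring}) laurent"
  assumes "g * h \<noteq> 0" "\<not> h dvd 1"
  shows "(g, g * h) \<in> measures [total_width, coeff_length]"
proof -
  have nz: "g \<noteq> 0" "h \<noteq> 0" using assms(1) by auto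
  show ?thesis
  proof (cases "total_width h = 0")
    case False
    then show ?thesis using nz by (simp add: total_width_mult)
  next
    case True
    then have w0: "cwidth i h = 0" for i unfolding total_width_eq_0 by blast
    obtain m c where c: "c \<noteq> 0" "h = sg m c"
      using monomial_if_cwidth[OF nz(2) w0] by (elim exE conjE)
    have nu: "\<not> c dvd 1" using assms(2) sg_unit[of c m] unfolding c(2) by (rule contrapos_nn)
    have cf: "cf (g * h) n = c * cf g (n - m)" for n
      using cf_sg_mult[of m c g n] by (simp add: c mult.commute)
    have "coeff_length (g * h) \<in> (\<lambda>n. size (prime_factorization (cf (g * h) n))) ` supp (g * h)"
      unfolding coeff_length_def using assms(1) by (intro Min_in) auto
    then obtain n where n: "n \<in> supp (g * h)"
      "coeff_length (g * h) = size (prime_factorization (cf (g * h) n))" by auto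
    have cn: "cf g (n - m) \<noteq> 0" using n(1) by (auto simp: in_keys_iff cf)
    then have "coeff_length g \<le> size (prime_factorization (cf g (n - m)))"
      unfolding coeff_length_def by (intro Min_le) (auto simp: in_keys_iff)
    also have "\<dots> < size (prime_factorization (cf (g * h) n))"
      using cn c(1) nu
      by (simp add: cf prime_factorization_mult prime_factorization_empty_iff flip: nonempty_has_size)
    finally show ?thesis using True n(2) nz by (simp add: total_width_mult)
  qed
qed

lemma irreducible_factor_exists:
  fixes f :: "('d::finite, 'a::{idom, factorial_semiring}) laurent"
  assumes "f \<noteq> 0" "\<not> f dvd 1"
  shows "\<exists>q. irreducible q \<and> q dvd f"
  using assms
proof (induction f rule: wf_induct_rule[OF wf_measures[of "[total_width, coeff_length]"]])
  case (1 f)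
  show ?case
  proof (cases "irreducible f")
    case False
    then obtain g h where gh: "f = g * h" "\<not> g dvd 1" "\<not> h dvd 1"
      using 1(2,3) by (auto simp: irreducible_def)
    then have "(g, f) \<in> measures [total_width, coeff_length]"
      using proper_divisor_decreases[of g h] 1(2) by auto
    then obtain q where "irreducible q" "q dvd g"
      using 1(1)[of g] 1(2) gh by auto
    then show ?thesis using gh by (meson dvd_mult2)
  qed auto
qed

lemma irreducible_unit_mult:
  fixes q u :: "('d::finite, 'a::idom) laurent"
  assumes "irreducible q" "u dvd 1"
  shows "irreducible (u * q)"
proof -
  obtain v where v: "1 = u * v" using assms(2) by (rule dvdE)
  have "irreducible q" by fact
  then have q: "q \<noteq> 0" "\<not> q dvd 1" "\<And>a b. q = a * b \<Longrightarrow> a dvd 1 \<or> b dvd 1"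
    by (auto simp: irreducible_def)
  show ?thesis
  proof (rule irreducibleI)
    show "u * q \<noteq> 0" using q(1) assms(2) by auto
    show "\<not> u * q dvd 1" using q(2) by (meson dvd_mult_right)
  next
    fix a b assume ab: "u * q = a * b"
    have "q = (u * v) * q" by (simp flip: v)
    also have "\<dots> = v * (u * q)" by (simp only: mult_ac)
    also have "\<dots> = (v * a) * b" by (simp only: ab mult.assoc)
    finally have "v * a dvd 1 \<or> b dvd 1" by (rule q(3))
    then show "a dvd 1 \<or> b dvd 1" by (blast dest: dvd_mult_right)
  qed
qed

text \<open>Induction over a factorization into irreducibles, all of them over \<open>I\<close>.\<close>

lemma over_factor_induct [consumes 2, case_names unit mult]:
  fixes c :: "('d::finite, 'a::{idom, factorial_semiring}) laurent"
  assumes "over I c" "c \<noteq> 0"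
    and unit: "\<And>u. u dvd 1 \<Longrightarrow> over I u \<Longrightarrow> P u"
    and mult: "\<And>q c. irreducible q \<Longrightarrow> over I q \<Longrightarrow> over I c \<Longrightarrow> c \<noteq> 0 \<Longrightarrow> P c \<Longrightarrow> P (q * c)"
  shows "P c"
  using assms(1,2)
proof (induction c rule: wf_induct_rule[OF wf_measures[of "[total_width, coeff_length]"]])
  case (1 c)
  show ?case
  proof (cases "c dvd 1")
    case False
    then obtain q where q: "irreducible q" "q dvd c"
      using irreducible_factor_exists 1 by blast
    obtain n where n: "over I (sg n 1 * q)"
      using over_shifted_factor[OF q(2)] 1 by blast
    define q' where "q' = sg n 1 * q"
    have q': "irreducible q'" "over I q'"
      using irreducible_unit_mult[OF q(1)] n by (auto simp: q'_def sg_unit)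
    obtain d where d: "c = q * d" using q(2) by (rule dvdE)
    have "c = q' * (sg (- n) 1 * d)"
      using d by (simp add: q'_def sg_mult_sg mult_ac flip: mult.assoc)
    then obtain c' where c': "c = q' * c'" by blast
    then have "c' \<noteq> 0" "over I c'"
      using 1 q' over_quotient by auto
    moreover have "(c', c) \<in> measures [total_width, coeff_length]"
      using proper_divisor_decreases[of c' q'] 1(3) q' c'
      by (simp add: mult.commute irreducible_def)
    ultimately show ?thesis using 1 mult q' c' by blast
  qed (use 1 unit in auto)
qed

lemmas factor_induct = over_factor_induct[of UNIV, simplified, consumes 1, case_names unit mult]

definition prime_over :: "'d set \<Rightarrow> ('d::finite, 'a::comm_ring_1) laurent \<Rightarrow> bool" where
  "prime_over I p \<longleftrightarrow> (\<forall>g h. over I g \<longrightarrow> over I h \<longrightarrow> p dvd g * h \<longrightarrow> p dvd g \<or> p dvd h)"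

lemma sg0_dvd_iff:
  "(sg 0 c :: ('d::finite, 'a::comm_ring_1) laurent) dvd sg 0 e \<longleftrightarrow> c dvd e"
proof
  assume "(sg 0 c :: ('d, 'a) laurent) dvd sg 0 e"
  then obtain h :: "('d, 'a) laurent" where h: "sg 0 e = sg 0 c * h" by (rule dvdE)
  have "e = c * cf h 0"
    using arg_cong[OF h, of "\<lambda>f. cf f 0"] by (simp add: cf_sg_mult)
  then show "c dvd e" by simp
next
  assume "c dvd e"
  then obtain k where "e = c * k" by (rule dvdE)
  then have "sg 0 e = (sg 0 c :: ('d, 'a) laurent) * sg 0 k" by (simp add: sg_mult_sg)
  then show "(sg 0 c :: ('d, 'a) laurent) dvd sg 0 e" by simp
qed

lemma over_empty: "over {} f \<Longrightarrow> f = sg 0 (cf f 0)"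
proof (rule laurent_eqI)
  fix n assume "over {} f"
  then have "n = 0" if "n \<in> supp f" using that by (auto simp: over_def vec_eq_iff)
  then show "cf f n = cf (sg 0 (cf f 0)) n" by (auto simp: cf_sg in_keys_iff)
qed

lemma prime_over_empty:
  fixes p :: "('d::finite, 'a::{idom, factorial_semiring}) laurent"
  assumes "over {} p" "irreducible p"
  shows "prime_over {} p"
proof -
  define c where "c = cf p 0"
  have p: "p = sg 0 c" using over_empty[OF assms(1)] by (simp add: c_def)
  have "irreducible c"
  proof (rule irreducibleI)
    show "c \<noteq> 0" using assms(2) p by auto
    show "\<not> c dvd 1"
      using assms(2) sg_unit[of c 0] unfolding p irreducible_def by blast
    fix a b assume "c = a * b"
    then have "p = sg 0 a * sg 0 b" by (simp add: p sg_mult_sg)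
    then have "sg 0 a dvd (1 :: ('d, 'a) laurent) \<or> sg 0 b dvd (1 :: ('d, 'a) laurent)"
      using assms(2) by (auto simp: irreducible_def)
    then show "a dvd 1 \<or> b dvd 1"
      by (metis sg0_dvd_iff single_one)
  qed
  then have c: "prime_elem c" by (rule irreducible_imp_prime_elem)
  show ?thesis
    unfolding prime_over_def
  proof (intro allI impI)
    fix g h :: "('d, 'a) laurent"
    assume gh: "over {} g" "over {} h" "p dvd g * h"
    obtain a b where ab: "g = sg 0 a" "h = sg 0 b" using gh over_empty by metis
    then have "c dvd a * b" using gh(3) by (simp add: p sg_mult_sg sg0_dvd_iff)
    then have "c dvd a \<or> c dvd b" using c by (simp add: prime_elem_dvd_mult_iff)
    then show "p dvd g \<or> p dvd h" by (simp add: p ab sg0_dvd_iff)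
  qed
qed

lemma unit_mult_dvd_cancel:
  fixes u p h :: "'a::comm_ring_1"
  assumes "u dvd 1"
  shows "p dvd u * h \<longleftrightarrow> p dvd h"
proof
  assume *: "p dvd u * h"
  obtain v where v: "1 = u * v" using assms by (rule dvdE)
  have "h = (u * v) * h" by (simp flip: v)
  then have "h = v * (u * h)" by (simp add: mult_ac)
  then show "p dvd h" using * by (metis dvd_mult)
qed auto

text \<open>
Gauss's lemma for a prime \<open>q\<close> free of the new variable \<open>x_i\<close>: if \<open>q\<close> divides \<open>g h\<close>, it divides the product
of the top slices, hence one of them, and this slice can be removed.
\<close>

lemma prime_over_insert:
  fixes q :: "('d::finite, 'a::idom) laurent"
  assumes q: "over I q" "prime_over I q" and i: "i \<notin> I"
  shows "prime_over (insert i I) q"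
  unfolding prime_over_def
proof (intro allI impI)
  fix g h :: "('d, 'a) laurent"
  assume "over (insert i I) g" "over (insert i I) h" "q dvd g * h"
  then show "q dvd g \<or> q dvd h"
  proof (induction "card (supp g) + card (supp h)" arbitrary: g h rule: less_induct)
    case less
    show ?case
    proof (cases "g = 0 \<or> h = 0")
      case False
      \<comment> \<open>the induction is on the number of terms, which decreases when a top slice is removed\<close>
      have qi: "over (- {i}) q" using q(1) i by (auto simp: over_def)
      define lg where "lg = slice i (tdeg i g) g"
      define lh where "lh = slice i (tdeg i h) h"
      define sg' where "sg' = (sg (axis i (- tdeg i g)) 1 :: ('d, 'a) laurent)"
      define sh' where "sh' = (sg (axis i (- tdeg i h)) 1 :: ('d, 'a) laurent)"
      have u: "sg' dvd 1" "sh' dvd 1" by (auto simp: sg'_def sh'_def sg_unit)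
      obtain t where "g * h = q * t" using less.prems(3) by (rule dvdE)
      then have "lg * lh = q * slice i (tdeg i g + tdeg i h) t"
        using slice_top_mult[of i g h] slice_mult_over[OF qi] by (simp add: lg_def lh_def)
      then have "q dvd sg' * (sh' * (lg * lh))" by simp
      then have d: "q dvd (sg' * lg) * (sh' * lh)" by (simp add: mult_ac)
      have "over I (sg' * lg)" "over I (sh' * lh)"
        unfolding sg'_def sh'_def lg_def lh_def using less.prems(1,2) by (simp_all add: over_shift_slice)
      then have "q dvd sg' * lg \<or> q dvd sh' * lh"
        using q(2) d unfolding prime_over_def by blast
      then have "q dvd lg \<or> q dvd lh" using u by (simp add: unit_mult_dvd_cancel)
      then show ?thesis
      proof
        assume l: "q dvd lg"
        have "card (supp (g - lg)) < card (supp g)"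
          unfolding lg_def using False by (intro card_supp_remove_slice) auto
        moreover have "over (insert i I) (g - lg)"
          using less.prems(1) by (auto simp: lg_def intro!: over_diff over_slice)
        moreover have "q dvd (g - lg) * h"
          using l less.prems(3) by (simp add: left_diff_distrib)
        ultimately have "q dvd g - lg \<or> q dvd h"
          using less.hyps less.prems(2) by (meson add_less_cancel_right)
        then show ?thesis using l by (metis diff_add_cancel dvd_add)
      next
        assume l: "q dvd lh"
        have "card (supp (h - lh)) < card (supp h)"
          unfolding lh_def using False by (intro card_supp_remove_slice) auto
        moreover have "over (insert i I) (h - lh)"
          using less.prems(2) by (auto simp: lh_def intro!: over_diff over_slice)
        moreover have "q dvd g * (h - lh)"
          using l less.prems(3) by (simp add: right_diff_distrib)
        ultimately have "q dvd g \<or> q dvd h - lh"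
          using less.hyps less.prems(1) by (meson add_less_cancel_left)
        then show ?thesis using l by (metis diff_add_cancel dvd_add)
      qed
    qed auto
  qed
qed

text \<open>
The induction step of unique factorization: irreducibles over \<open>I\<close> are known to be prime.  The
parameter \<open>ty\<close> fixes the type of coefficients.
\<close>

locale adjoin_variable =
  fixes I :: "'d::finite set" and i :: 'd and ty :: "'a::{idom, factorial_semiring} itself"
  assumes i: "i \<notin> I"
    and primes: "\<And>q :: ('d, 'a) laurent. over I q \<Longrightarrow> irreducible q \<Longrightarrow> prime_over (insert i I) q"
begin

text \<open>
Gauss's lemma, first form: a factor \<open>c\<close> free of \<open>x_i\<close> can be cancelled modulo \<open>p\<close>, one prime of \<open>c\<close> at
a time, because none of these primes divides \<open>p\<close>.
\<close>

lemma strip_constant: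
  fixes p h c :: "('d, 'a) laurent"
  assumes "over I c" "c \<noteq> 0"
    and p: "irreducible p" "cwidth i p > 0" "over (insert i I) p" and h: "over (insert i I) h"
    and "p dvd c * h"
  shows "p dvd h"
  using assms(1,2,7)
proof (induction rule: over_factor_induct)
  case (unit u)
  then show ?case by (simp add: unit_mult_dvd_cancel)
next
  case (mult q c)
  show ?case
  proof (cases "h = 0")
    case False
    obtain t where t: "q * c * h = p * t" using mult.prems by (rule dvdE)
    have q0: "q \<noteq> 0" "\<not> q dvd 1" using mult.hyps(1) by (auto simp: irreducible_def)
    have "over (insert i I) (q * c * h)"
      using mult.hyps h by (meson over_mono over_mult subset_insertI)
    moreover have "q * c * h \<noteq> 0" using q0 mult.hyps False by auto
    ultimately have "over (insert i I) t" using t p(3) over_quotient by metis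
    moreover have "q dvd p * t" using t by (metis dvd_triv_left mult.assoc)
    ultimately have "q dvd p \<or> q dvd t"
      using primes[OF mult.hyps(2,1)] p(3) unfolding prime_over_def by blast
    then show ?thesis
    proof
      assume "q dvd p"
      then obtain s where s: "p = q * s" by (rule dvdE)
      then have "s dvd 1" using p(1) q0 by (auto simp: irreducible_def)
      then obtain n e where "s = sg n e" by (auto simp: unit_iff_monomial)
      moreover have "cwidth i q = 0" using mult.hyps(2) i by (rule over_imp_cwidth)
      moreover have "s \<noteq> 0" using p(1) s by auto
      ultimately have "cwidth i p = 0" using s q0 by (simp add: width_mult)
      then show ?thesis using p(2) by simp
    next
      assume "q dvd t"
      then obtain t' where "t = q * t'" by (rule dvdE)
      then have "q * (c * h) = q * (p * t')" using t by (simp add: mult_ac)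
      then have "c * h = p * t'" using q0 by (simp add: laurent_mult_cancel)
      then show ?thesis using mult.IH by simp
    qed
  qed auto
qed

text \<open>
Gauss's lemma, second form: a factorization of \<open>p\<close> with denominator \<open>c\<close> gives one without, because
each prime of \<open>c\<close> divides one of the two factors.
\<close>

lemma strip_constant_factorization:
  fixes p s r c :: "('d, 'a) laurent"
  assumes "over I c" "c \<noteq> 0" and "p \<noteq> 0" and "over (insert i I) s" "over (insert i I) r"
    and "c * p = s * r"
  shows "\<exists>c1 s' r'. over I c1 \<and> p = s' * r' \<and> r = c1 * r'"
  using assms(1,2,4,5,6)
proof (induction arbitrary: s r rule: over_factor_induct)
  case (unit u)
  obtain v where v: "1 = u * v" using unit(1) by (rule dvdE)
  have "p = (u * v) * p" by (simp flip: v)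
  also have "\<dots> = v * (u * p)" by (simp only: mult_ac)
  also have "\<dots> = v * s * r" by (simp only: unit(5) mult.assoc)
  finally show ?case by (intro exI[of _ 1] exI[of _ "v * s"] exI[of _ r]) auto
next
  case (mult q c)
  have q0: "q \<noteq> 0" using mult.hyps(1) by auto
  have nz: "s \<noteq> 0" "r \<noteq> 0" using mult.prems(3) mult.hyps q0 assms(3) by auto
  have qI: "over (insert i I) q" using mult.hyps(2) by (meson over_mono subset_insertI)
  have "q dvd s * r" using mult.prems(3) by (metis dvd_triv_left mult.assoc)
  then have "q dvd s \<or> q dvd r"
    using primes[OF mult.hyps(2,1)] mult.prems(1,2) unfolding prime_over_def by blast
  then show ?case
  proof
    assume "q dvd s"
    then obtain s1 where s1: "s = q * s1" by (rule dvdE)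
    then have "over (insert i I) s1" using mult.prems(1) qI nz over_quotient by metis
    moreover have "q * (c * p) = q * (s1 * r)" using mult.prems(3) s1 by (simp add: mult_ac)
    then have "c * p = s1 * r" using q0 by (simp add: laurent_mult_cancel)
    ultimately show ?thesis using mult.IH mult.prems(2) by blast
  next
    assume "q dvd r"
    then obtain r1 where r1: "r = q * r1" by (rule dvdE)
    then have "over (insert i I) r1" using mult.prems(2) qI nz over_quotient by metis
    moreover have "q * (c * p) = q * (s * r1)" using mult.prems(3) r1 by (simp add: mult_ac)
    then have "c * p = s * r1" using q0 by (simp add: laurent_mult_cancel)
    ultimately obtain c1 s' r' where "over I c1" "p = s' * r'" "r1 = c1 * r'"
      using mult.IH mult.prems(1) by blast
    then show ?thesis
      using mult.hyps(2) r1 by (intro exI[of _ "q * c1"] exI[of _ s'] exI[of _ r'])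
        (auto simp: over_mult mult_ac)
  qed
qed

text \<open>
If \<open>x_i\<close> does not occur in \<open>p\<close> up to a shift, then \<open>p\<close> is prime already over \<open>I\<close>.  Otherwise let \<open>r\<close> be a
greatest common divisor of \<open>p\<close> and \<open>g\<close> in the sense of \<open>euclid\<close>.  Up to factors free of \<open>x_i\<close> it is a unit
or an associate of \<open>p\<close>; in the first case \<open>p\<close> divides \<open>h\<close>, in the second \<open>p\<close> divides \<open>g\<close>.
\<close>

lemma irreducible_imp_prime_over:
  fixes p :: "('d, 'a) laurent"
  assumes p: "over (insert i I) p" "irreducible p"
  shows "prime_over (insert i I) p"
proof (cases "cwidth i p = 0")
  case True
  have p0: "p \<noteq> 0" using p(2) by auto
  obtain m where m: "m \<in> supp p" using p0 by (meson hi_attained)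
  define q where "q = sg (axis i (- (m $ i))) 1 * p"
  have "over I q"
    unfolding over_def
  proof (intro ballI allI impI)
    fix n j assume "n \<in> supp q" and j: "j \<notin> I"
    then have n: "n - axis i (- (m $ i)) \<in> supp p" by (simp add: q_def supp_sg_mult)
    show "n $ j = 0"
    proof (cases "j = i")
      case j: True
      have "(n - axis i (- (m $ i))) $ i = m $ i"
        using True n m unfolding cwidth_eq_0_iff by blast
      then show ?thesis by (simp add: j axis_def)
    next
      case False
      then have "(n - axis i (- (m $ i))) $ j = 0" using n j p(1) by (auto simp: over_def)
      then show ?thesis using False by (simp add: axis_def)
    qed
  qed
  moreover have "irreducible q"
    using irreducible_unit_mult[OF p(2)] by (simp add: q_def sg_unit)
  ultimately have "prime_over (insert i I) q" by (rule primes)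
  moreover have "q dvd x \<longleftrightarrow> p dvd x" for x
  proof
    assume "p dvd x"
    then obtain y where "x = p * y" by (rule dvdE)
    then have "x = q * (sg (axis i (m $ i)) 1 * y)"
      using shift_cancel[of i "m $ i" "p * y"] by (simp add: q_def mult_ac)
    then show "q dvd x" by simp
  qed (auto simp: q_def dest: dvd_mult_right)
  ultimately show ?thesis unfolding prime_over_def by blast
next
  case False
  then have w: "cwidth i p > 0" by simp
  have p0: "p \<noteq> 0" using p(2) by auto
  interpret slice_ring "{f :: ('d, 'a) laurent. over (insert i I) f}" i
    by (rule slice_ring_over) simp
  have reduce: "over I c" if "over (insert i I) c" "over (- {i}) c" for c :: "('d, 'a) laurent"
    unfolding over_def
  proof (intro ballI allI impI)
    fix n j assume "n \<in> supp c" "j \<notin> I"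
    then show "n $ j = 0" using that by (cases "j = i") (auto simp: over_def)
  qed
  show ?thesis
    unfolding prime_over_def
  proof (intro allI impI)
    fix g h :: "('d, 'a) laurent"
    assume g: "over (insert i I) g" and h: "over (insert i I) h" and "p dvd g * h"
    show "p dvd g \<or> p dvd h"
    proof (rule disjCI)
      assume "\<not> p dvd h"
      obtain r A B c1 c2 s1 s2 where r: "r \<noteq> 0" "over (insert i I) r" and "over (insert i I) A"
        "over (insert i I) B" and c1S: "over (insert i I) c1" and c2S: "over (insert i I) c2"
        and s1: "over (insert i I) s1" and "over (insert i I) s2" and rAB: "r = A * p + B * g"
        and c1: "over (- {i}) c1" "c1 \<noteq> 0" "c1 * p = s1 * r"
        and c2: "over (- {i}) c2" "c2 \<noteq> 0" "c2 * g = s2 * r"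
        by (rule euclid[of p g, unfolded mem_Collect_eq, OF p(1) g p0])
      have c12: "over I c1" "over I c2" using reduce c1S c1(1) c2S c2(1) by auto
      obtain c s' r' where c: "over I c" "p = s' * r'" "r = c * r'"
        using strip_constant_factorization[OF c12(1) c1(2) p0 s1 r(2) c1(3)] by (elim exE conjE)
      have c0: "c \<noteq> 0" using c(3) r(1) by auto
      have "r * h = p * (A * h) + B * (g * h)"
        by (simp add: rAB algebra_simps)
      then have ph: "p dvd r * h" using \<open>p dvd g * h\<close> by simp
      from c(2) consider "r' dvd 1" | "s' dvd 1" using p(2) unfolding irreducible_def by blast
      then show "p dvd g"
      proof cases
        case 1
        have "r * h = r' * (c * h)" unfolding c(3) by (simp only: mult_ac)
        then have "p dvd c * h" using ph unit_mult_dvd_cancel[OF 1, of p "c * h"] by simp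
        then have "p dvd h" by (rule strip_constant[OF c(1) c0 p(2) w p(1) h])
        then show ?thesis using \<open>\<not> p dvd h\<close> by blast
      next
        case 2
        have "p dvd s' * r'" unfolding c(2)[symmetric] by simp
        then have "p dvd r'" using unit_mult_dvd_cancel[OF 2] by simp
        then have "p dvd s2 * (c * r')" by (simp add: dvd_mult)
        then have "p dvd c2 * g" by (simp only: c2(3) c(3))
        then show ?thesis by (rule strip_constant[OF c12(2) c2(2) p(2) w p(1) g])
      qed
    qed
  qed
qed

end

lemma irreducible_imp_prime_over:
  fixes p :: "('d::finite, 'a::{idom, factorial_semiring}) laurent"
  assumes "finite I" "over I p" "irreducible p"
  shows "prime_over I p"
  using assms
proof (induction I arbitrary: p rule: finite_induct)
  case empty
  then show ?case by (rule prime_over_empty)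
next
  case (insert i I)
  interpret adjoin_variable I i "TYPE('a)"
    using insert prime_over_insert by unfold_locales blast+
  show ?case using insert.prems by (rule irreducible_imp_prime_over)
qed

text \<open>Together with \<open>factor_induct\<close> this is unique factorization, with all variables adjoined.\<close>

theorem laurent_irreducible_dvd_mult:
  fixes p :: "('d::finite, 'a::{idom, factorial_semiring}) laurent"
  assumes "irreducible p" "p dvd g * h"
  shows "p dvd g \<or> p dvd h"
  using irreducible_imp_prime_over[of UNIV p] assms by (simp add: prime_over_def)

section \<open>Conjugate roots of unity\<close>

lemma ring_map_map_poly:
  assumes "ring_map \<phi>"
  shows "ring_map (map_poly \<phi>)"
  unfolding ring_map_def
proof (intro conjI allI)
  note [simp] = ring_mapD[OF assms]
  show "map_poly \<phi> 1 = 1"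
    by (simp add: map_poly_1)
  show "map_poly \<phi> (a + b) = map_poly \<phi> a + map_poly \<phi> b" for a b
    by (rule poly_eqI) (simp add: coeff_map_poly)
  show "map_poly \<phi> (a * b) = map_poly \<phi> a * map_poly \<phi> b" for a b
    by (rule poly_eqI) (simp add: coeff_map_poly coeff_mult)
qed

text \<open>
Evaluation at \<open>z\<close> of a polynomial whose coefficients are sent to \<open>C\<close> by \<open>\<phi>\<close>; integer and rational
coefficients both occur.
\<close>

definition peval :: "('a::comm_ring_1 \<Rightarrow> complex) \<Rightarrow> complex \<Rightarrow> 'a poly \<Rightarrow> complex" where
  "peval \<phi> z p = poly (map_poly \<phi> p) z"

lemma ring_map_peval: "ring_map \<phi> \<Longrightarrow> ring_map (peval \<phi> z)"
  using ring_map_map_poly[of \<phi>] unfolding ring_map_def peval_def by simp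

lemma peval_const: "ring_map \<phi> \<Longrightarrow> peval \<phi> z [:c:] = \<phi> c"
  by (simp add: peval_def ring_mapD map_poly_pCons)

lemma peval_monom: "ring_map \<phi> \<Longrightarrow> peval \<phi> z (monom c k) = \<phi> c * z ^ k"
  by (simp add: peval_def ring_mapD map_poly_monom poly_monom)

lemma peval_smult: "ring_map \<phi> \<Longrightarrow> peval \<phi> z (smult c p) = \<phi> c * peval \<phi> z p"
  using ring_mapD(4)[OF ring_map_peval, of \<phi> z "[:c:]" p] by (simp add: peval_const)

lemma peval_pCons: "ring_map \<phi> \<Longrightarrow> peval \<phi> z (pCons c p) = \<phi> c + z * peval \<phi> z p"
  by (simp add: peval_def ring_mapD map_poly_pCons)

lemma peval_pcompose_monom:
  assumes "ring_map \<phi>"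
  shows "peval \<phi> z (pcompose p (monom 1 q)) = peval \<phi> (z ^ q) p"
proof (induction p)
  case 0
  then show ?case by (simp add: ring_mapD[OF ring_map_peval[OF assms]])
next
  case (pCons c p)
  then show ?case
    by (simp add: pcompose_pCons ring_mapD[OF ring_map_peval[OF assms]] peval_monom[OF assms]
        peval_const[OF assms] peval_pCons[OF assms] ring_mapD[OF assms])
qed

abbreviation evi :: "complex \<Rightarrow> int poly \<Rightarrow> complex" where
  "evi \<equiv> peval of_int"

lemma evi_hom:
  "evi z 1 = 1" "evi z 0 = 0" "evi z (a + b) = evi z a + evi z b" "evi z (a * b) = evi z a * evi z b"
    "evi z (- a) = - evi z a" "evi z (a - b) = evi z a - evi z b" "evi z (a ^ k) = evi z a ^ k"
    "evi z [:c:] = of_int c" "evi z (monom c k) = of_int c * z ^ k" "evi z (smult c a) = of_int c * evi z a"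
  by (simp_all add: ring_mapD[OF ring_map_peval[OF ring_map_of_int]] peval_const[OF ring_map_of_int]
      peval_monom[OF ring_map_of_int] peval_smult[OF ring_map_of_int])

text \<open>
An irreducible integer polynomial is, up to a constant, the minimal polynomial of each of its roots; by
Gauss's lemma the constant does not matter for divisibility over the integers.
\<close>

lemma irreducible_int_poly_dvd:
  fixes \<psi> R :: "int poly"
  assumes \<psi>: "irreducible \<psi>" "evi z \<psi> = 0" and R: "evi z R = 0"
  shows "\<psi> dvd R"
proof -
  have prime: "prime_elem \<psi>" using \<psi>(1) by (rule irreducible_imp_prime_elem)
  define V where "V m \<longleftrightarrow> m \<noteq> 0 \<and> evi z m = 0" for m
  have "V \<psi>" using \<psi> by (auto simp: V_def)
  then obtain m where m: "V m" "\<And>m'. V m' \<Longrightarrow> degree m \<le> degree m'"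
    using ex_has_least_nat[of V \<psi> degree] by blast
  have m0: "m \<noteq> 0" "evi z m = 0" using m(1) by (auto simp: V_def)
  have deg: "degree p \<noteq> 0" if "p \<noteq> 0" "evi z p = 0" for p
  proof
    assume "degree p = 0"
    then obtain c where "p = [:c:]" by (rule degree_eq_zeroE)
    then show False using that by (simp add: evi_hom)
  qed
  have div: "\<exists>c q. c \<noteq> 0 \<and> smult c p = m * q" if p: "evi z p = 0" for p
  proof -
    obtain q r where qr: "pseudo_divmod p m = (q, r)" by fastforce
    define c where "c = coeff m (degree m) ^ (Suc (degree p) - degree m)"
    have eq: "smult c p = m * q + r" and r: "r = 0 \<or> degree r < degree m"
      using pseudo_divmod[OF m0(1) qr] by (auto simp: c_def)
    have "r = smult c p - m * q" using eq by simp
    then have "evi z r = 0" using p m0(2) by (simp add: evi_hom)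
    then have "r = 0" using r m(2)[of r] unfolding V_def by linarith
    moreover have "c \<noteq> 0" using m0 by (simp add: c_def)
    ultimately show ?thesis using eq by auto
  qed
  have not_const: "\<not> \<psi> dvd [:c:]" if "c \<noteq> 0" for c
  proof
    assume "\<psi> dvd [:c:]"
    then have "degree \<psi> \<le> degree [:c:]" using that by (intro dvd_imp_degree_le) auto
    moreover have "\<psi> \<noteq> 0" using \<psi>(1) by (simp add: irreducible_def)
    ultimately show False using deg[of \<psi>] \<psi>(2) by simp
  qed
  obtain c q where c: "c \<noteq> 0" "smult c \<psi> = m * q" using div[OF \<psi>(2)] by blast
  have "\<psi> dvd m * q" using c(2) by (metis dvd_smult dvd_refl)
  then have "\<psi> dvd m \<or> \<psi> dvd q" using prime by (simp add: prime_elem_dvd_mult_iff)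
  moreover have "\<not> \<psi> dvd q"
  proof
    assume "\<psi> dvd q"
    then obtain t where "q = \<psi> * t" by (rule dvdE)
    then have "\<psi> * [:c:] = \<psi> * (m * t)" using c(2) by (simp add: mult_ac)
    then have "[:c:] = m * t" using \<psi>(1) by (metis irreducible_def mult_left_cancel)
    then have "degree m \<le> degree [:c:]" using c(1) by (intro dvd_imp_degree_le) auto
    then show False using deg[OF m0] by simp
  qed
  ultimately have "\<psi> dvd m" by blast
  obtain c' q' where c': "c' \<noteq> 0" "smult c' R = m * q'" using div[OF R] by blast
  then have "\<psi> dvd [:c':] * R" using \<open>\<psi> dvd m\<close> by simp
  then show ?thesis using not_const[OF c'(1)] prime by (simp add: prime_elem_dvd_mult_iff del: mult_pCons_left)
qed

lemma unity_poly_degree: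
  assumes "N \<ge> 1"
  shows "degree (monom 1 N - 1 :: int poly) = N" "lead_coeff (monom 1 N - 1 :: int poly) = 1"
proof -
  have "degree (monom 1 N + (- 1) :: int poly) = degree (monom 1 N :: int poly)"
    using assms by (intro degree_add_eq_left) (auto simp: degree_monom_eq)
  then show d: "degree (monom 1 N - 1 :: int poly) = N" by (simp add: degree_monom_eq)
  show "lead_coeff (monom 1 N - 1 :: int poly) = 1"
    unfolding d using assms by simp
qed

lemma unity_factor_exists:
  assumes "z ^ N = 1" "N \<ge> 1"
  obtains \<psi> \<kappa> :: "int poly" where "irreducible \<psi>" "evi z \<psi> = 0" "monom 1 N - 1 = \<psi> * \<kappa>"
proof -
  define X where "X = (monom 1 N - 1 :: int poly)"
  have "coeff X N = 1" using assms(2) by (simp add: X_def)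
  then have "X \<noteq> 0" by auto
  then obtain A where A: "\<And>x. x \<in># A \<Longrightarrow> prime_elem x" "normalize (prod_mset A) = normalize X"
    using prime_factorization_exists by blast
  have "X dvd prod_mset A" using A(2) by (metis associatedD2 dvd_refl)
  moreover have "evi z X = 0" using assms(1) by (simp add: X_def evi_hom)
  ultimately have "evi z (prod_mset A) = 0" by (auto simp: evi_hom elim!: dvdE)
  then have "\<exists>x\<in>#A. evi z x = 0" by (induction A) (auto simp: evi_hom)
  then obtain \<psi> where \<psi>: "\<psi> \<in># A" "evi z \<psi> = 0" by blast
  have "\<psi> dvd prod_mset A" using \<psi>(1) by (rule dvd_prod_mset)
  also have "prod_mset A dvd X" using A(2) by (metis associatedD1)
  finally obtain \<kappa> where "X = \<psi> * \<kappa>" by (rule dvdE)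
  then show ?thesis
    using that \<psi> A(1) prime_elem_imp_irreducible unfolding X_def by blast
qed

lemma freshman_dvd:
  fixes a b :: "'a::comm_ring_1"
  assumes "prime q"
  shows "of_nat q dvd (a + b) ^ q - (a ^ q + b ^ q)"
proof -
  have q: "q \<ge> 2" using assms by (rule prime_ge_2_nat)
  have "{..q} = insert 0 (insert q {1..<q})" using q by auto
  then have "(a + b) ^ q = b ^ q + a ^ q + (\<Sum>k\<in>{1..<q}. of_nat (q choose k) * a ^ k * b ^ (q - k))"
    using q by (simp add: binomial_ring)
  moreover have "of_nat q dvd (\<Sum>k\<in>{1..<q}. of_nat (q choose k) * a ^ k * b ^ (q - k))"
  proof (rule dvd_sum)
    fix k assume k: "k \<in> {1..<q}"
    then have "q dvd q choose k" using assms by (intro dvd_choose_prime) auto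
    then obtain m where "q choose k = q * m" by (rule dvdE)
    then show "(of_nat q :: 'a) dvd of_nat (q choose k) * a ^ k * b ^ (q - k)"
      by (simp add: mult.assoc)
  qed
  ultimately show ?thesis by (simp add: add.commute)
qed

lemma fermat_int: "prime q \<Longrightarrow> int q dvd a ^ q - a"
proof (induction a rule: int_induct[of _ 0])
  case base
  then show ?case using prime_gt_0_nat[of q] by (simp add: zero_power)
next
  case (step1 a)
  have "int q dvd ((a + 1) ^ q - (a ^ q + 1 ^ q)) + (a ^ q - a)"
    using freshman_dvd[OF step1.prems, of a 1] step1 by (intro dvd_add) auto
  then show ?case by (simp add: algebra_simps)
next
  case (step2 a)
  have "int q dvd (a ^ q - a) - ((a - 1 + 1) ^ q - ((a - 1) ^ q + 1 ^ q))"
  proof (rule dvd_diff)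
    show "int q dvd (a - 1 + 1) ^ q - ((a - 1) ^ q + 1 ^ q)"
      using freshman_dvd[OF step2.prems, of "a - 1" 1] by simp
  qed (use step2 in auto)
  then show ?case by (simp add: algebra_simps)
qed

lemma frobenius_int_poly:
  fixes p :: "int poly"
  assumes "prime q"
  shows "of_nat q dvd pcompose p (monom 1 q) - p ^ q"
proof (induction p)
  case 0
  then show ?case using prime_gt_0_nat[OF assms] by (simp add: zero_power)
next
  case (pCons c p)
  have eq: "pCons c p = [:c:] + monom 1 1 * p" by (simp add: monom_altdef)
  have f: "of_nat q dvd ([:c:] + monom 1 1 * p) ^ q - ([:c:] ^ q + (monom 1 1 * p) ^ q)"
    by (rule freshman_dvd[OF assms])
  obtain k where "c ^ q - c = int q * k" using fermat_int[OF assms, of c] by (rule dvdE)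
  then have "[:c:] ^ q - [:c:] = of_nat q * [:k:]"
    by (simp add: of_nat_poly poly_const_pow)
  then have c: "of_nat q dvd [:c:] ^ q - [:c:]" by (metis dvd_triv_left)
  have "pcompose (pCons c p) (monom 1 q) = [:c:] + monom 1 q * pcompose p (monom 1 q)"
    by (simp add: pcompose_pCons)
  then have "pcompose (pCons c p) (monom 1 q) - pCons c p ^ q =
      monom 1 q * (pcompose p (monom 1 q) - p ^ q) - ([:c:] ^ q - [:c:])
      - (([:c:] + monom 1 1 * p) ^ q - ([:c:] ^ q + (monom 1 1 * p) ^ q))"
    unfolding eq by (simp add: power_mult_distrib monom_power algebra_simps)
  then show ?case using pCons f c by (metis dvd_diff dvd_mult)
qed

text \<open>
Dedekind's argument for the irreducibility of cyclotomic polynomials.  Let \<open>\<psi>\<close> be the irreducible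
factor of \<open>t^N - 1 = \<psi> \<kappa>\<close> that vanishes at \<open>z\<close>.  If \<open>\<psi>(z^q)\<close> were nonzero, then \<open>\<kappa>(z^q) = 0\<close>, so
\<open>\<kappa>(z)^q\<close> is divisible by \<open>q\<close> in \<open>Z[z]\<close>.  Then so is \<open>N^q\<close>, because \<open>\<psi>'(z) \<kappa>(z) = N z^(N-1)\<close>; but \<open>\<psi>\<close> has leading
coefficient a unit, and so \<open>q\<close> would divide the integer \<open>N^q\<close>.
\<close>

lemma conjugate_root_prime:
  assumes z: "z ^ N = 1" "N \<ge> 1" and q: "prime q" "\<not> q dvd N" and R: "evi z R = 0"
  shows "evi (z ^ q) R = 0"
proof -
  obtain \<psi> \<kappa> where \<psi>: "irreducible \<psi>" "evi z \<psi> = 0" and X: "monom 1 N - 1 = \<psi> * \<kappa>"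
    using unity_factor_exists[OF z] by blast
  have "evi (z ^ q) \<psi> = 0"
  proof (rule ccontr)
    assume nz: "evi (z ^ q) \<psi> \<noteq> 0"
    have "(z ^ q) ^ N = 1" using z(1) by (metis power_commutes power_mult power_one mult.commute)
    then have "evi (z ^ q) (\<psi> * \<kappa>) = 0" by (simp add: evi_hom flip: X)
    then have "evi z (pcompose \<kappa> (monom 1 q)) = 0"
      using nz by (simp add: evi_hom peval_pcompose_monom ring_map_of_int)
    moreover obtain w where w: "pcompose \<kappa> (monom 1 q) - \<kappa> ^ q = of_nat q * w"
      using frobenius_int_poly[OF q(1)] by (rule dvdE)
    have "of_nat q * w = smult (int q) w" by (simp add: of_nat_poly)
    then have "evi z (pcompose \<kappa> (monom 1 q)) = evi z \<kappa> ^ q + of_nat q * evi z w"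
      using arg_cong[OF w, of "evi z"] by (simp add: evi_hom algebra_simps)
    ultimately have k: "evi z \<kappa> ^ q = - (of_nat q * evi z w)" by (simp add: eq_neg_iff_add_eq_0)
    have "pderiv (\<psi> * \<kappa>) = monom (int N) (N - 1)"
      by (simp add: pderiv_diff pderiv_monom flip: X)
    then have "evi z (pderiv \<psi> * \<kappa> + \<psi> * pderiv \<kappa>) = of_nat N * z ^ (N - 1)"
      by (simp add: pderiv_mult evi_hom add.commute mult.commute)
    then have "evi z (pderiv \<psi>) * evi z \<kappa> * z = of_nat N"
      using z by (simp add: evi_hom \<psi>(2) flip: power_Suc2)
    then have "of_nat N ^ q = evi z (pderiv \<psi>) ^ q * evi z \<kappa> ^ q * z ^ q"
      by (metis power_mult_distrib)
    then have "of_nat N ^ q = - (of_nat q * (evi z (pderiv \<psi>) ^ q * evi z w * z ^ q))"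
      by (simp add: k algebra_simps)
    then have "evi z ([:int N ^ q:] + smult (int q) (pderiv \<psi> ^ q * w * monom 1 q)) = 0"
      by (simp add: evi_hom)
    then obtain s where s: "[:int N ^ q:] + smult (int q) (pderiv \<psi> ^ q * w * monom 1 q) = \<psi> * s"
      using irreducible_int_poly_dvd[OF \<psi>] by (metis dvdE)
    have lc: "lead_coeff \<psi> dvd 1"
      using unity_poly_degree(2)[OF z(2)] by (metis X dvd_triv_left lead_coeff_mult)
    have deg: "degree \<psi> > 0"
    proof (rule ccontr)
      assume "\<not> degree \<psi> > 0"
      then obtain c where "\<psi> = [:c:]" by (meson degree_eq_zeroE gr0I)
      then show False using \<psi> by (auto simp: evi_hom)
    qed
    \<comment> \<open>the coefficients of \<open>\<psi> s\<close> of positive degree are divisible by \<open>q\<close>\<close>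
    have high: "int q dvd coeff (\<psi> * s) j" if "j > 0" for j
      using that by (cases j) (simp_all flip: s)
    have qN: "\<not> int q dvd int N ^ q"
      using q by (metis int_dvd_int_iff of_nat_power prime_dvd_power)
    have "\<exists>j. \<not> int q dvd coeff s j"
    proof (rule ccontr)
      assume "\<nexists>j. \<not> int q dvd coeff s j"
      then have "int q dvd coeff (\<psi> * s) 0" by (simp add: coeff_mult)
      then show False using qN by (simp add: dvd_add_left_iff flip: s)
    qed
    then obtain j0 where j0: "\<not> int q dvd coeff s j0" by blast
    have bound: "j \<le> degree s" if "\<not> int q dvd coeff s j" for j
      using that by (metis dvd_0_right le_degree)
    \<comment> \<open>the last coefficient of \<open>s\<close> that is not divisible by \<open>q\<close> would produce such a coefficient of \<open>\<psi> s\<close>\<close>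
    define j where "j = (GREATEST j. \<not> int q dvd coeff s j)"
    have j: "\<not> int q dvd coeff s j"
      unfolding j_def using j0 bound by (rule GreatestI_nat[where P = "\<lambda>j. \<not> int q dvd coeff s j"])
    have j': "int q dvd coeff s k" if "k > j" for k
      using Greatest_le_nat[of "\<lambda>j. \<not> int q dvd coeff s j" k "degree s"] bound that
      unfolding j_def by (meson not_le)
    have "coeff (\<psi> * s) (degree \<psi> + j) =
        lead_coeff \<psi> * coeff s j + (\<Sum>i\<in>{..degree \<psi> + j} - {degree \<psi>}. coeff \<psi> i * coeff s (degree \<psi> + j - i))"
      unfolding coeff_mult by (subst sum.remove[of _ "degree \<psi>"]) auto
    moreover have "int q dvd (\<Sum>i\<in>{..degree \<psi> + j} - {degree \<psi>}. coeff \<psi> i * coeff s (degree \<psi> + j - i))"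
    proof (rule dvd_sum)
      fix i assume "i \<in> {..degree \<psi> + j} - {degree \<psi>}"
      then consider "i < degree \<psi>" | "i > degree \<psi>" by fastforce
      then show "int q dvd coeff \<psi> i * coeff s (degree \<psi> + j - i)"
      proof cases
        case 1
        then have "int q dvd coeff s (degree \<psi> + j - i)" by (intro j') auto
        then show ?thesis by simp
      qed (simp add: coeff_eq_0)
    qed
    moreover have "int q dvd coeff (\<psi> * s) (degree \<psi> + j)" using deg by (intro high) auto
    ultimately have "int q dvd lead_coeff \<psi> * coeff s j" by (simp add: dvd_add_left_iff)
    then have "int q dvd coeff s j" using lc by (metis dvd_mult_unit_iff' is_unit_mult_iff dvd_mult_unit_iff mult.commute)
    then show False using j by blast
  qed
  moreover have "\<psi> dvd R" by (rule irreducible_int_poly_dvd[OF \<psi> R])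
  ultimately show ?thesis by (auto simp: evi_hom elim!: dvdE)
qed

lemma conjugate_root:
  assumes "z ^ N = 1" "N \<ge> 1" "coprime a N" "a > 0" "evi z R = 0"
  shows "evi (z ^ a) R = 0"
  using assms
proof (induction a arbitrary: z rule: prime_divisors_induct)
  case (unit a)
  then show ?case by simp
next
  case (factor q a)
  have q: "\<not> q dvd N" "coprime a N"
    using factor.prems(3) factor.hyps
    by (auto simp: coprime_mult_left_iff dest: coprime_common_divisor_nat[of q N q])
  have "evi (z ^ q) R = 0"
    using conjugate_root_prime factor q by blast
  moreover have "(z ^ q) ^ N = 1" using factor.prems(1) by (metis mult.commute power_mult power_one)
  ultimately have "evi ((z ^ q) ^ a) R = 0"
    using factor q by (intro factor.IH) auto
  then show ?case by (simp add: power_mult)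
qed auto

lemma inverse_exponent:
  assumes "coprime a N" "N \<ge> 1"
  obtains b :: nat where "b > 0" "coprime b N" "\<And>z :: complex. z ^ N = 1 \<Longrightarrow> (z ^ a) ^ b = z"
proof -
  obtain b0 where b0: "[a * b0 = 1] (mod N)" using cong_solve_coprime_nat[OF assms(1)] by auto
  \<comment> \<open>adding \<open>N\<close> makes the exponent positive\<close>
  define b where "b = b0 + N"
  have b: "[a * b = 1] (mod N)"
    using b0 by (simp add: b_def cong_def distrib_left)
  then have "coprime (a * b) N" by (metis cong_imp_coprime cong_sym coprime_1_left)
  then have "coprime b N" by simp
  moreover have "(z ^ a) ^ b = z" if "z ^ N = 1" for z :: complex
  proof -
    have red: "z ^ k = z ^ (k mod N)" for k
      by (metis div_mult_mod_eq mult.commute mult_1 power_add power_mult power_one that)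
    have "z ^ (a * b) = z ^ 1" using b red[of "a * b"] red[of 1] by (simp add: cong_def)
    then show ?thesis by (simp add: power_mult)
  qed
  ultimately show ?thesis using assms(2) that[of b] by (simp add: b_def)
qed

text \<open>
This replaces the Galois group of the cyclotomic field: an identity between polynomials in \<open>z\<close> remains
true for \<open>z^a\<close>.
\<close>

lemma conjugate_root_iff:
  assumes "z ^ N = 1" "N \<ge> 1" "coprime a N" "a > 0"
  shows "evi (z ^ a) R = 0 \<longleftrightarrow> evi z R = 0"
proof
  assume *: "evi (z ^ a) R = 0"
  obtain b where "b > 0" "coprime b N" "(z ^ a) ^ b = z"
    using inverse_exponent[OF assms(3,2)] assms(1) by metis
  moreover have "(z ^ a) ^ N = 1" using assms(1) by (metis mult.commute power_mult power_one)
  ultimately show "evi z R = 0" using conjugate_root[of "z ^ a" N b R] * assms(2) by simp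
qed (use assms conjugate_root in blast)

definition primitive :: "nat \<Rightarrow> complex \<Rightarrow> bool" where
  "primitive N z \<longleftrightarrow> N \<ge> 1 \<and> z ^ N = 1 \<and> inj_on (\<lambda>k. z ^ k) {..<N}"

abbreviation roots1 :: "nat \<Rightarrow> complex set" where
  "roots1 N \<equiv> {w. w ^ N = 1}"

lemma primitive_bij: "primitive N z \<Longrightarrow> bij_betw (\<lambda>k. z ^ k) {..<N} (roots1 N)"
proof -
  assume p: "primitive N z"
  have sub: "(\<lambda>k. z ^ k) ` {..<N} \<subseteq> roots1 N"
    using p by (auto simp: primitive_def) (metis mult.commute power_mult power_one)
  moreover have "card ((\<lambda>k. z ^ k) ` {..<N}) = N"
    using p by (simp add: primitive_def card_image)
  moreover have "card (roots1 N) = N" "finite (roots1 N)"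
    using p card_roots_unity_eq[of N] finite_roots_unity[of N] by (auto simp: primitive_def)
  ultimately show ?thesis
    using p by (simp add: primitive_def bij_betw_def card_subset_eq)
qed

lemma primitive_pow_eq_1: "primitive N z \<Longrightarrow> z ^ k = 1 \<longleftrightarrow> N dvd k"
proof
  assume p: "primitive N z" and k: "z ^ k = 1"
  have "z ^ k = z ^ (k mod N)"
    using p by (metis primitive_def div_mult_mod_eq mult.commute mult_1 power_add power_mult power_one)
  then have "z ^ (k mod N) = z ^ 0" using k by simp
  moreover have "k mod N < N" "0 < N" using p by (auto simp: primitive_def)
  ultimately have "k mod N = 0"
    using p unfolding primitive_def inj_on_def by blast
  then show "N dvd k" by auto
next
  assume "primitive N z" "N dvd k"
  then show "z ^ k = 1" by (auto simp: primitive_def power_mult)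
qed

lemma primitive_pow_coprime:
  assumes p: "primitive N z" and a: "coprime a N"
  shows "primitive N (z ^ a)"
  unfolding primitive_def
proof (intro conjI inj_onI)
  show "N \<ge> 1" using p by (simp add: primitive_def)
  show "(z ^ a) ^ N = 1" using p by (metis primitive_def mult.commute power_mult power_one)
  obtain b where b: "(w ^ a) ^ b = w" if "w ^ N = 1" for w :: complex
    using inverse_exponent[OF a] p unfolding primitive_def by metis
  fix k l assume kl: "k \<in> {..<N}" "l \<in> {..<N}" "(z ^ a) ^ k = (z ^ a) ^ l"
  have "z ^ k = z ^ l"
    using kl(3) b[of "z ^ k"] b[of "z ^ l"] p
    by (metis primitive_def mult.commute power_mult power_one)
  then show "k = l" using p kl(1,2) by (auto simp: primitive_def inj_on_def)
qed

lemma primitive_exp: "N \<ge> 1 \<Longrightarrow> primitive N (exp (2 * of_real pi * \<i> / of_nat N))"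
proof -
  assume N: "N \<ge> 1"
  have eq: "exp (2 * of_real pi * \<i> / of_nat N) ^ k = cis (2 * pi * real k / real N)" for k
    by (simp add: cis_conv_exp mult_ac flip: exp_of_nat_mult)
  have "bij_betw (\<lambda>k. cis (2 * pi * real k / real N)) {..<N} (roots1 N)"
    using Complex.bij_betw_roots_unity[of N] N by simp
  then have "inj_on (\<lambda>k. exp (2 * of_real pi * \<i> / of_nat N) ^ k) {..<N}"
    unfolding eq by (rule bij_betw_imp_inj_on)
  moreover have "exp (2 * of_real pi * \<i> / of_nat N) ^ N = 1"
    using N by (simp add: eq)
  ultimately show ?thesis using N by (simp add: primitive_def)
qed

text \<open>
Let \<open>\<psi>\<close> be the irreducible factor of \<open>t^N - 1\<close> vanishing at \<open>z\<close>.  All its roots are powers of \<open>z\<close> prime to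
\<open>N\<close>, so the remainder of \<open>R\<close> modulo \<open>\<psi>\<close> takes the same value at all of them.  The roots of \<open>t^N - 1\<close>
being simple, \<open>\<psi>\<close> has as many roots as its degree; hence the remainder is a constant, which is an integer.
\<close>

lemma galois_invariant_integral:
  assumes p: "primitive N z" and inv: "\<And>a. coprime a N \<Longrightarrow> a > 0 \<Longrightarrow> evi (z ^ a) R = y"
  shows "\<exists>c::int. y = of_int c"
proof -
  have z: "z ^ N = 1" "N \<ge> 1" using p by (auto simp: primitive_def)
  obtain \<psi> \<kappa> where \<psi>: "irreducible \<psi>" "evi z \<psi> = 0" and X: "monom 1 N - 1 = \<psi> * \<kappa>"
    using unity_factor_exists[OF z] by blast
  have X1: "evi w \<psi> * evi w \<kappa> = w ^ N - 1" for w
    using arg_cong[OF X, of "evi w"] by (simp add: evi_hom)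
  note dX = unity_poly_degree[OF z(2)]
  have lc: "lead_coeff \<psi> dvd 1"
    using dX(2) by (metis X dvd_triv_left lead_coeff_mult)
  have nz: "\<psi> \<noteq> 0" "\<kappa> \<noteq> 0" using X dX(2) by auto
  then have degs: "degree \<psi> + degree \<kappa> = N" using dX(1) by (simp add: X degree_mult_eq)
  have conj: "evi w R = y" if w: "evi w \<psi> = 0" for w
  proof -
    have "w ^ N = 1" using X1[of w] w by simp
    then obtain a0 where a0: "w = z ^ a0" using primitive_bij[OF p] by (auto simp: bij_betw_def)
    define a where "a = a0 + N"
    have a: "w = z ^ a" "a > 0" using a0 z by (auto simp: a_def power_add)
    have "coprime a N"
    proof (rule ccontr)
      assume "\<not> coprime a N"
      then have d: "gcd a N > 1" using a(2) by (metis coprime_iff_gcd_eq_1 gcd_pos_nat less_one linorder_neqE_nat not_gr_zero)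
      \<comment> \<open>otherwise \<open>w\<close> has a smaller order \<open>m\<close>, and so has its conjugate \<open>z\<close>\<close>
      define m where "m = N div gcd a N"
      have m: "0 < m" "m < N" "N dvd a * m"
        using d z(2) by (auto simp: m_def div_greater_zero_iff gcd_le2_nat)
          (metis div_mult_swap dvd_def dvd_div_mult gcd_dvd1 gcd_dvd2 mult.commute)
      have "w ^ m = 1" using a(1) m(3) primitive_pow_eq_1[OF p, of "a * m"] by (simp add: power_mult)
      then have "evi w (monom 1 m - 1) = 0" by (simp add: evi_hom)
      then have "\<psi> dvd monom 1 m - 1" by (rule irreducible_int_poly_dvd[OF \<psi>(1) w])
      then obtain s where "monom 1 m - 1 = \<psi> * s" by (rule dvdE)
      then have "evi z (monom 1 m - 1) = 0" using \<psi>(2) by (simp add: evi_hom(4))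
      then have "z ^ m = 1" by (simp add: evi_hom)
      then show False using primitive_pow_eq_1[OF p, of m] m by (auto dest: dvd_imp_le)
    qed
    then show ?thesis using inv a by simp
  qed
  obtain q r where qr: "pseudo_divmod R \<psi> = (q, r)" by fastforce
  define c where "c = coeff \<psi> (degree \<psi>) ^ (Suc (degree R) - degree \<psi>)"
  have eq: "smult c R = \<psi> * q + r" and r: "r = 0 \<or> degree r < degree \<psi>"
    using pseudo_divmod[OF nz(1) qr] by (auto simp: c_def)
  have c: "c dvd 1" unfolding c_def using lc by (rule is_unit_power_iff[THEN iffD2, OF disjI1])
  have rw: "evi w r = of_int c * y" if "evi w \<psi> = 0" for w
    using arg_cong[OF eq, of "evi w"] that conj[OF that] by (simp add: evi_hom)
  \<comment> \<open>the remainder minus its supposed constant value has too many roots\<close>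
  define D where "D = map_poly of_int r - [:of_int c * y:]"
  have "D = 0"
  proof (rule ccontr)
    assume D: "D \<noteq> 0"
    have degmap: "degree (map_poly (of_int :: int \<Rightarrow> complex) p) = degree p" for p
      by (rule degree_map_poly) auto
    have dp: "degree \<psi> > 0"
    proof (rule ccontr)
      assume "\<not> degree \<psi> > 0"
      then obtain c where "\<psi> = [:c:]" by (meson degree_eq_zeroE gr0I)
      then show False using \<psi> by (auto simp: evi_hom)
    qed
    have "degree D < degree \<psi>"
      using r dp by (auto simp: D_def degmap intro!: degree_diff_less)
    moreover have "{w. evi w \<psi> = 0} \<subseteq> {w. poly D w = 0}"
      using rw by (auto simp: D_def peval_def)
    ultimately have "card {w. evi w \<psi> = 0} < degree \<psi>"
      using card_mono[OF poly_roots_finite[OF D]] card_poly_roots_bound[OF D] by (meson le_less_trans)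
    moreover have fin: "finite {w. evi w p = 0}" "card {w. evi w p = 0} \<le> degree p" if "p \<noteq> 0" for p
    proof -
      have "map_poly complex_of_int p \<noteq> 0" using that by (auto simp: poly_eq_iff coeff_map_poly)
      then show "finite {w. evi w p = 0}" "card {w. evi w p = 0} \<le> degree p"
        using poly_roots_finite[of "map_poly complex_of_int p"]
          card_poly_roots_bound[of "map_poly complex_of_int p"] by (auto simp: peval_def degmap)
    qed
    moreover have "roots1 N \<subseteq> {w. evi w \<psi> = 0} \<union> {w. evi w \<kappa> = 0}"
      using X1 by auto (metis mult_eq_0_iff right_minus_eq)
    then have "card (roots1 N) \<le> card {w. evi w \<psi> = 0} + card {w. evi w \<kappa> = 0}"
      using fin nz by (meson card_Un_le card_mono finite_UnI order_trans)
    moreover have "card (roots1 N) = N" using z by (simp add: card_roots_unity_eq)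
    ultimately show False using degs nz fin(2)[OF nz(2)] by linarith
  qed
  then have "map_poly of_int r = [:of_int c * y:]" by (simp add: D_def)
  then have "of_int (coeff r 0) = of_int c * y"
    by (metis coeff_map_poly coeff_pCons_0 of_int_0)
  moreover obtain e where "1 = c * e" using c by (rule dvdE)
  then have "of_int (c * e) = (1 :: complex)" by simp
  ultimately have "y = of_int (e * coeff r 0)" by (simp add: mult_ac)
  then show ?thesis by blast
qed

section \<open>The decimation is integral\<close>

text \<open>
A natural number congruent to \<open>m\<close> modulo \<open>N\<close>: it makes powers of a root of unity into polynomials in
this root, and it is given by a formula that is easily seen to be computable.
\<close>

definition expo :: "nat \<Rightarrow> int \<Rightarrow> nat" where
  "expo N m = nat m + (N - 1) * nat (- m)"

lemma int_expo: "N \<ge> 1 \<Longrightarrow> int (expo N m) = m + int N * int (nat (- m))"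
  by (cases "m \<ge> 0") (auto simp: expo_def algebra_simps of_nat_diff)

lemma power_expo:
  assumes "z ^ N = 1" "N \<ge> 1"
  shows "(z :: complex) ^ expo N m = z powi m"
proof (cases "m \<ge> 0")
  case True
  then show ?thesis by (simp add: expo_def power_int_def)
next
  case False
  have "z * z ^ (N - 1) = 1" using assms by (simp flip: power_Suc)
  then have "inverse z = z ^ (N - 1)" by (rule inverse_unique)
  then show ?thesis using False by (simp add: expo_def power_int_def power_mult)
qed

text \<open>
The rotation of \<open>x_i\<close> by \<open>t^k\<close>, where the variable \<open>t\<close> of the coefficients stands for an \<open>N\<close>th root of
unity.
\<close>

definition twist :: "nat \<Rightarrow> 'd \<Rightarrow> nat \<Rightarrow> ('d::finite, 'a::comm_ring_1 poly) laurent \<Rightarrow> ('d, 'a poly) laurent" where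
  "twist N i k = map_terms (\<lambda>n. n) (\<lambda>n c. monom 1 (k * expo N (n $ i)) * c)"

definition var_norm :: "nat \<Rightarrow> 'd \<Rightarrow> ('d::finite, 'a::comm_ring_1 poly) laurent \<Rightarrow> ('d, 'a poly) laurent" where
  "var_norm N i H = (\<Prod>k<N. twist N i k H)"

text \<open>The coefficients are polynomials in \<open>t\<close>, and \<open>t\<close> is replaced by \<open>z\<close>.\<close>

abbreviation ev :: "('a::comm_ring_1 \<Rightarrow> complex) \<Rightarrow> complex \<Rightarrow> ('d::finite, 'a poly) laurent \<Rightarrow> ('d, complex) laurent" where
  "ev \<phi> z \<equiv> lmap (peval \<phi> z)"

lemma ring_map_ev: "ring_map \<phi> \<Longrightarrow> ring_map (ev \<phi> z :: ('d::finite, _) laurent \<Rightarrow> _)"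
  by (intro ring_map_lmap ring_map_peval)

lemma cf_ev: "ring_map \<phi> \<Longrightarrow> cf (ev \<phi> z H) n = peval \<phi> z (cf H n)"
  by (simp add: cf_lmap ring_mapD ring_map_peval)

lemma prod_upd_powi: "(\<Prod>j\<in>UNIV. ((\<lambda>_. 1)(i := w)) j powi (n $ j)) = (w :: complex) powi (n $ i)"
proof -
  have "(\<Prod>j\<in>UNIV. ((\<lambda>_. 1)(i := w)) j powi (n $ j)) = (\<Prod>j\<in>UNIV. if j = i then w powi (n $ i) else 1)"
    by (rule prod.cong) auto
  then show ?thesis by simp
qed

lemma ev_twist:
  assumes "ring_map \<phi>" "z ^ N = 1" "N \<ge> 1"
  shows "ev \<phi> z (twist N i k H) = rescale ((\<lambda>_. 1)(i := z ^ k)) (ev \<phi> z H)"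
proof (rule laurent_eqI)
  fix n
  have "(z ^ k) ^ N = 1" using assms(2) by (metis mult.commute power_mult power_one)
  from power_expo[OF this assms(3), of "n $ i"]
  have "z ^ (k * expo N (n $ i)) = (z ^ k) powi (n $ i)" by (simp add: power_mult)
  then show "cf (ev \<phi> z (twist N i k H)) n = cf (rescale ((\<lambda>_. 1)(i := z ^ k)) (ev \<phi> z H)) n"
    by (simp add: cf_ev assms(1) lookup_rescale prod_upd_powi twist_def cf_map_terms
        ring_mapD[OF ring_map_peval[OF assms(1)]] peval_monom ring_mapD[OF assms(1)] del: fun_upd_apply)
qed

lemma ev_var_norm:
  assumes "ring_map \<phi>" "primitive N z"
  shows "ev \<phi> z (var_norm N i H) = (\<Prod>w\<in>roots1 N. rescale ((\<lambda>_. 1)(i := w)) (ev \<phi> z H))"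
proof -
  have "ev \<phi> z (var_norm N i H) = (\<Prod>k<N. rescale ((\<lambda>_. 1)(i := z ^ k)) (ev \<phi> z H))"
    using assms by (simp add: var_norm_def ring_mapD[OF ring_map_ev[OF assms(1)]] ev_twist primitive_def)
  also have "\<dots> = (\<Prod>w\<in>roots1 N. rescale ((\<lambda>_. 1)(i := w)) (ev \<phi> z H))"
    by (rule prod.reindex_bij_betw[OF primitive_bij[OF assms(2)]])
  finally show ?thesis .
qed

text \<open>The rotations by \<open>N\<close>th roots of unity in the variables from \<open>J\<close>.\<close>

definition Omega :: "nat \<Rightarrow> 'd set \<Rightarrow> ('d::finite \<Rightarrow> complex) set" where
  "Omega N J = {\<rho>. (\<forall>i\<in>J. \<rho> i ^ N = 1) \<and> (\<forall>i. i \<notin> J \<longrightarrow> \<rho> i = 1)}"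

lemma finite_Omega:
  fixes J :: "'d::finite set"
  assumes "N \<ge> 1"
  shows "finite (Omega N J)"
proof -
  have "finite (PiE UNIV (\<lambda>_ :: 'd. roots1 N))"
    using finite_roots_unity[of N] assms by (intro finite_PiE) auto
  moreover have "Omega N J \<subseteq> PiE UNIV (\<lambda>_. roots1 N)"
    by (auto simp: Omega_def)
  ultimately show ?thesis by (rule finite_subset[rotated])
qed

lemma Omega_nonzero: "\<rho> \<in> Omega N J \<Longrightarrow> N \<ge> 1 \<Longrightarrow> \<rho> i \<noteq> 0"
  by (cases "i \<in> J") (auto simp: Omega_def power_0_left)

lemma Omega_empty: "Omega N {} = {\<lambda>_. 1}"
  by (auto simp: Omega_def)

lemma one_in_Omega: "(\<lambda>_. 1) \<in> Omega N J"
  by (simp add: Omega_def)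

lemma Omega_insert_bij:
  assumes "i \<notin> J"
  shows "bij_betw (\<lambda>(w, \<rho>). \<rho>(i := w)) (roots1 N \<times> Omega N J) (Omega N (insert i J))"
  unfolding bij_betw_def
proof
  show "inj_on (\<lambda>(w, \<rho>). \<rho>(i := w)) (roots1 N \<times> Omega N J)"
  proof (rule inj_onI, clarify)
    fix w v \<rho> \<nu> assume *: "\<rho> \<in> Omega N J" "\<nu> \<in> Omega N J" "\<rho>(i := w) = \<nu>(i := v)"
    then have "w = v" by (metis fun_upd_same)
    moreover have "\<rho> j = \<nu> j" for j
      using *(1,2) assms fun_cong[OF *(3), of j] by (cases "j = i") (auto simp: Omega_def)
    ultimately show "w = v \<and> \<rho> = \<nu>" by auto
  qed
  have "\<rho> \<in> (\<lambda>(w, \<rho>). \<rho>(i := w)) ` (roots1 N \<times> Omega N J)" if "\<rho> \<in> Omega N (insert i J)" for \<rho>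
    using that assms by (intro image_eqI[of _ _ "(\<rho> i, \<rho>(i := 1))"]) (auto simp: Omega_def)
  then show "(\<lambda>(w, \<rho>). \<rho>(i := w)) ` (roots1 N \<times> Omega N J) = Omega N (insert i J)"
    by (auto simp: Omega_def)
qed

text \<open>
The decimation can be taken one variable at a time, and with polynomials in \<open>t\<close> in place of complex
coefficients; the value does not depend on the primitive root that replaces \<open>t\<close>.
\<close>

lemma ev_norms:
  assumes \<phi>: "ring_map \<phi>" and p: "primitive N z" and "distinct is"
  shows "ev \<phi> z (foldr (var_norm N) is H) = (\<Prod>\<rho>\<in>Omega N (set is). rescale \<rho> (ev \<phi> z H))"
  using assms(3)
proof (induction "is")
  case Nil
  then show ?case by (simp add: Omega_empty)
next
  case (Cons i js)
  have N: "N \<ge> 1" using p by (simp add: primitive_def)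
  have i: "i \<notin> set js" using Cons.prems by simp
  define G where "G = ev \<phi> z H"
  have "ev \<phi> z (foldr (var_norm N) (i # js) H)
      = (\<Prod>w\<in>roots1 N. rescale ((\<lambda>_. 1)(i := w)) (\<Prod>\<rho>\<in>Omega N (set js). rescale \<rho> G))"
    using Cons by (simp add: ev_var_norm[OF \<phi> p] G_def)
  also have "\<dots> = (\<Prod>w\<in>roots1 N. \<Prod>\<rho>\<in>Omega N (set js). rescale (\<rho>(i := w)) G)"
  proof (intro prod.cong refl)
    fix w assume "w \<in> roots1 N"
    then have "w \<noteq> 0" using N by (auto simp: power_0_left)
    then have "ring_map (rescale ((\<lambda>_. 1)(i := w)))" by (intro ring_map_rescale) auto
    then have "rescale ((\<lambda>_. 1)(i := w)) (\<Prod>\<rho>\<in>Omega N (set js). rescale \<rho> G)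
        = (\<Prod>\<rho>\<in>Omega N (set js). rescale (\<lambda>j. ((\<lambda>_. 1)(i := w)) j * \<rho> j) G)"
      by (simp add: ring_mapD rescale_rescale)
    also have "\<dots> = (\<Prod>\<rho>\<in>Omega N (set js). rescale (\<rho>(i := w)) G)"
      using i by (intro prod.cong refl arg_cong[of _ _ "\<lambda>\<rho>. rescale \<rho> G"]) (auto simp: Omega_def)
    finally show "rescale ((\<lambda>_. 1)(i := w)) (\<Prod>\<rho>\<in>Omega N (set js). rescale \<rho> G)
        = (\<Prod>\<rho>\<in>Omega N (set js). rescale (\<rho>(i := w)) G)" .
  qed
  also have "\<dots> = (\<Prod>(w, \<rho>)\<in>roots1 N \<times> Omega N (set js). rescale (\<rho>(i := w)) G)"
    by (rule prod.cartesian_product)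
  also have "\<dots> = (\<Prod>\<rho>\<in>Omega N (insert i (set js)). rescale \<rho> G)"
    using prod.reindex_bij_betw[OF Omega_insert_bij[OF i, of N], of "\<lambda>\<rho>. rescale \<rho> G"]
    by (simp add: case_prod_unfold)
  finally show ?case by (simp add: G_def)
qed

definition dec :: "nat \<Rightarrow> ('d::finite, complex) laurent \<Rightarrow> ('d, complex) laurent" where
  "dec N G = (\<Prod>\<rho>\<in>Omega N UNIV. rescale \<rho> G)"

lemma decimation_eq_dec:
  fixes f :: "('d::finite, int) laurent"
  assumes "N \<ge> 1"
  shows "decimation N f = dec N (to_complex f)"
proof -
  define z where "z = exp (2 * of_real pi * \<i> / of_nat N)"
  have p: "primitive N z" unfolding z_def by (rule primitive_exp[OF assms])
  have exp: "exp (2 * of_real pi * \<i> * of_nat k / of_nat N) = z ^ k" for k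
    by (simp add: z_def mult_ac flip: exp_of_nat_mult)
  note b = primitive_bij[OF p]
  have "bij_betw (\<lambda>k i. z ^ k i) {k :: 'd \<Rightarrow> nat. \<forall>i. k i < N} (Omega N UNIV)"
    unfolding bij_betw_def
  proof
    show "inj_on (\<lambda>k i. z ^ k i) {k :: 'd \<Rightarrow> nat. \<forall>i. k i < N}"
      using b by (intro inj_onI ext) (auto simp: bij_betw_def inj_on_def fun_eq_iff)
    have "\<rho> \<in> (\<lambda>k i. z ^ k i) ` {k :: 'd \<Rightarrow> nat. \<forall>i. k i < N}" if "\<rho> \<in> Omega N UNIV" for \<rho>
    proof -
      have "\<forall>i. \<exists>k<N. \<rho> i = z ^ k"
        using that b by (auto simp: Omega_def bij_betw_def image_iff set_eq_iff)
      then obtain k where "\<And>i. k i < N" "\<And>i. \<rho> i = z ^ k i" by metis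
      then show ?thesis by (intro image_eqI[of _ _ k]) auto
    qed
    moreover have "(z ^ k) ^ N = 1" for k
      using p by (metis primitive_def mult.commute power_mult power_one)
    ultimately show "(\<lambda>k i. z ^ k i) ` {k :: 'd \<Rightarrow> nat. \<forall>i. k i < N} = Omega N UNIV"
      by (auto simp: Omega_def)
  qed
  from prod.reindex_bij_betw[OF this, of "\<lambda>\<rho>. rescale \<rho> (to_complex f)"]
  show ?thesis by (simp add: decimation_def dec_def exp)
qed

lemma galois_invariant_laurent_integral:
  assumes p: "primitive N z" and inv: "\<And>a. coprime a N \<Longrightarrow> a > 0 \<Longrightarrow> ev of_int (z ^ a) H = G"
  shows "\<exists>F. G = to_complex F"
proof -
  have "\<exists>c::int. cf G n = of_int c" for n
  proof (rule galois_invariant_integral[OF p])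
    fix a assume "coprime a N" "a > 0"
    then show "evi (z ^ a) (cf H n) = cf G n"
      using inv by (metis cf_ev ring_map_of_int)
  qed
  then obtain c where c: "\<And>n. cf G n = of_int (c n)" by metis
  define F where "F = (\<Sum>n\<in>supp G. sg n (c n))"
  have "cf F n = c n" for n
  proof -
    have "cf F n = (\<Sum>m\<in>supp G. if m = n then c n else 0)"
      unfolding F_def lookup_sum by (intro sum.cong) (auto simp: cf_sg)
    also have "\<dots> = c n" using c[of n] by (auto simp: sum.delta in_keys_iff)
    finally show ?thesis .
  qed
  then have "G = to_complex F" by (intro laurent_eqI) (simp add: cf_to_complex c)
  then show ?thesis by blast
qed

definition const_poly :: "('d::finite, 'a::comm_ring_1) laurent \<Rightarrow> ('d, 'a poly) laurent" where
  "const_poly = lmap (\<lambda>c. [:c:])"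

lemma ring_map_pCons0: "ring_map (\<lambda>c :: 'a::comm_ring_1. [:c:])"
  by (simp add: ring_map_def one_pCons)

lemma ring_map_const_poly: "ring_map (const_poly :: ('d::finite, 'a::comm_ring_1) laurent \<Rightarrow> _)"
  by (simp add: const_poly_def ring_map_lmap ring_map_pCons0)

lemma ev_const_poly: "ring_map \<phi> \<Longrightarrow> ev \<phi> z (const_poly f) = lmap \<phi> f"
  by (rule laurent_eqI) (simp add: const_poly_def cf_lmap ring_mapD ring_map_peval peval_const)

lemma twist_0: "twist N i 0 H = H"
  by (rule laurent_eqI) (simp add: twist_def cf_map_terms monom_eq_1)

lemma dvd_norms: "N \<ge> 1 \<Longrightarrow> H dvd foldr (var_norm N) is H"
proof (induction "is")
  case (Cons i js)
  have "twist N i 0 H' dvd var_norm N i H'" for H' :: "('a, 'b poly) laurent"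
    unfolding var_norm_def using Cons.prems by (intro dvd_prodI) auto
  then show ?case using Cons by (simp add: twist_0) (meson dvd_trans)
qed auto

text \<open>
Over \<open>Z[t]\<close> the product of rotations is a multiple \<open>f H1\<close> of \<open>f\<close>.  Its value at every primitive root is the
decimation, so the values of \<open>H1\<close> agree too, and both are integral.
\<close>

lemma decimation_integral_multiple:
  assumes N: "N \<ge> 1"
  shows "\<exists>F. decimation N f = to_complex F \<and> f dvd F"
proof (cases "f = 0")
  case True
  have "rescale \<rho> (to_complex 0 :: ('a, complex) laurent) = 0" for \<rho>
    by (rule laurent_eqI) (simp add: lookup_rescale cf_to_complex)
  then have "decimation N f = 0"
    unfolding decimation_eq_dec[OF N] dec_def True using one_in_Omega[of N UNIV] finite_Omega[OF N, of UNIV]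
    by (intro prod_zero) auto
  then show ?thesis
    using True by (intro exI[of _ 0]) (simp add: ring_mapD[OF ring_map_to_complex])
next
  case False
  obtain z where p: "primitive N z" using primitive_exp[OF N] by blast
  obtain ds :: "'a list" where ds: "set ds = UNIV" "distinct ds"
    using finite_distinct_list[of "UNIV :: 'a set"] by auto
  define H where "H = foldr (var_norm N) ds (const_poly f)"
  have tc: "ev of_int z (const_poly f) = to_complex f" for z
    by (simp add: ev_const_poly ring_map_of_int to_complex_eq)
  obtain H1 where H1: "H = const_poly f * H1" using dvd_norms[OF N] unfolding H_def by (metis dvdE)
  have *: "to_complex f * ev of_int z' H1 = decimation N f" if "primitive N z'" for z'
  proof -
    have "ev of_int z' H = decimation N f"
      unfolding H_def ev_norms[OF ring_map_of_int that ds(2)] ds(1) tc decimation_eq_dec[OF N] dec_def ..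
    then show ?thesis
      by (simp add: H1 ring_mapD[OF ring_map_ev[OF ring_map_of_int]] tc)
  qed
  have nz: "to_complex f \<noteq> 0"
    using False to_complex_eq_iff[of f 0] by (simp add: ring_mapD[OF ring_map_to_complex])
  have "ev of_int (z ^ a) H1 = ev of_int z H1" if "coprime a N" for a
    using *[OF primitive_pow_coprime[OF p that]] *[OF p] laurent_mult_cancel[OF nz] by metis
  then obtain Q where Q: "ev of_int z H1 = to_complex Q"
    using galois_invariant_laurent_integral[OF p] by metis
  have "decimation N f = to_complex (f * Q)"
    using *[OF p] by (simp add: Q ring_mapD[OF ring_map_to_complex])
  then show ?thesis by auto
qed

lemma dec_mult:
  assumes "N \<ge> 1"
  shows "dec N (F * G) = dec N F * dec N G"
proof -
  have "rescale \<rho> (F * G) = rescale \<rho> F * rescale \<rho> G" if "\<rho> \<in> Omega N UNIV" for \<rho>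
    using that assms by (intro ring_mapD(4) ring_map_rescale Omega_nonzero)
  then show ?thesis by (simp add: dec_def flip: prod.distrib)
qed

text \<open>A rotation permutes the factors.\<close>

lemma dec_invariant:
  assumes "w ^ N = 1" "N \<ge> 1"
  shows "rescale ((\<lambda>_. 1)(i := w)) (dec N G) = dec N G"
proof -
  define t where "t \<rho> = (\<lambda>j. ((\<lambda>_. 1)(i := w)) j * \<rho> j)" for \<rho> :: "'a \<Rightarrow> complex"
  have w: "w \<noteq> 0" using assms by (auto simp: power_0_left)
  have "inj_on t (Omega N UNIV)"
  proof (rule inj_onI, rule ext)
    fix \<rho> \<nu> j assume "t \<rho> = t \<nu>"
    then have "t \<rho> j = t \<nu> j" by simp
    then show "\<rho> j = \<nu> j" using w unfolding t_def by (auto split: if_splits)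
  qed
  moreover have "t ` Omega N UNIV \<subseteq> Omega N UNIV"
    using assms by (auto simp: t_def Omega_def power_mult_distrib)
  ultimately have b: "bij_betw t (Omega N UNIV) (Omega N UNIV)"
    using finite_Omega[OF assms(2), of "UNIV :: 'a set"] endo_inj_surj unfolding bij_betw_def by blast
  have "rescale ((\<lambda>_. 1)(i := w)) (dec N G) = (\<Prod>\<rho>\<in>Omega N UNIV. rescale (t \<rho>) G)"
  proof -
    have "ring_map (rescale ((\<lambda>_. 1)(i := w)))" by (rule ring_map_rescale) (use w in auto)
    then show ?thesis by (simp add: dec_def rescale_rescale t_def ring_mapD(9) del: fun_upd_apply)
  qed
  also have "\<dots> = dec N G"
    unfolding dec_def by (rule prod.reindex_bij_betw[OF b])
  finally show ?thesis .
qed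

lemma supp_dec:
  assumes N: "N \<ge> 1" and n: "n \<in> supp (dec N G)"
  shows "int N dvd n $ i"
proof -
  obtain z where p: "primitive N z" using primitive_exp[OF N] by blast
  then have z: "z ^ N = 1" by (simp add: primitive_def)
  have "cf (dec N G) n * z powi (n $ i) = cf (dec N G) n"
    using arg_cong[OF dec_invariant[OF z N, of i G], of "\<lambda>f. cf f n"]
    by (simp add: lookup_rescale prod_upd_powi del: fun_upd_apply)
  then have "z ^ expo N (n $ i) = 1" using n by (simp add: in_keys_iff power_expo[OF z N])
  then have "int N dvd int (expo N (n $ i))" using primitive_pow_eq_1[OF p] by simp
  then show ?thesis by (simp add: int_expo[OF N] dvd_add_left_iff)
qed

lemma rescale_sublattice:
  assumes "h \<in> sublattice_ring N" "\<rho> \<in> Omega N UNIV"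
  shows "rescale \<rho> (to_complex h) = to_complex h"
proof (rule laurent_eqI)
  fix n
  show "cf (rescale \<rho> (to_complex h)) n = cf (to_complex h) n"
  proof (cases "n \<in> supp h")
    case True
    have "\<rho> i powi (n $ i) = 1" for i
    proof -
      have "int N dvd n $ i" using assms(1) True by (auto simp: sublattice_ring_def)
      then obtain k where "n $ i = int N * k" by (rule dvdE)
      moreover have "\<rho> i ^ N = 1" using assms(2) by (simp add: Omega_def)
      ultimately show ?thesis by (simp add: power_int_mult)
    qed
    then show ?thesis by (simp add: lookup_rescale)
  next
    case False
    then show ?thesis by (simp add: lookup_rescale cf_to_complex in_keys_iff)
  qed
qed

lemma dec_sublattice:
  "h \<in> sublattice_ring N \<Longrightarrow> dec N (to_complex h) = to_complex h ^ card (Omega N (UNIV :: 'd set))"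
  for h :: "('d::finite, int) laurent"
  unfolding dec_def by (simp add: rescale_sublattice)

section \<open>The subring of decimated exponents\<close>

text \<open>
This is an isomorphism from the Laurent polynomial ring to its subring \<open>Z[N Z^d]\<close>, whose elements are
henceforth written as dilations.
\<close>

definition dilate :: "nat \<Rightarrow> ('d::finite, 'a::comm_ring_1) laurent \<Rightarrow> ('d, 'a) laurent" where
  "dilate N = map_terms (\<lambda>n. int N *s n) (\<lambda>_ c. c)"

lemma scale_add: "int N *s (n + m) = int N *s n + int N *s (m :: int ^ 'd::finite)"
  by (simp add: vec_eq_iff algebra_simps)

lemma inj_scale: "N \<ge> 1 \<Longrightarrow> inj (\<lambda>n :: int ^ 'd::finite. int N *s n)"
  by (rule injI) (simp add: vec_eq_iff)

lemma ring_map_dilate: "ring_map (dilate N :: ('d::finite, 'a::comm_ring_1) laurent \<Rightarrow> _)"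
proof -
  have "int N *s (0 :: int ^ 'd) = 0" by (simp add: vec_eq_iff)
  then show ?thesis
    by (subst ring_map_def)
      (auto simp: dilate_def map_terms_add map_terms_mult map_terms_sg scale_add simp flip: single_one)
qed

lemma dilate_sg: "dilate N (sg n c) = sg (int N *s n) c"
  by (simp add: dilate_def map_terms_sg)

lemma cf_dilate: "N \<ge> 1 \<Longrightarrow> cf (dilate N f) (int N *s n) = cf f n"
  unfolding dilate_def by (rule cf_map_terms_inj[OF inj_scale]) auto

lemma supp_dilate: "N \<ge> 1 \<Longrightarrow> supp (dilate N f) = (\<lambda>n. int N *s n) ` supp f"
proof
  have "supp (dilate N f) \<subseteq> (\<Union>n\<in>supp f. supp (sg (int N *s n) (cf f n)))"
    unfolding dilate_def map_terms_def by (rule keys_sum)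
  also have "\<dots> \<subseteq> (\<lambda>n. int N *s n) ` supp f" by (auto split: if_splits)
  finally show "supp (dilate N f) \<subseteq> (\<lambda>n. int N *s n) ` supp f" .
qed (auto simp: in_keys_iff cf_dilate)

lemma dilate_eq_iff: "N \<ge> 1 \<Longrightarrow> dilate N f = dilate N g \<longleftrightarrow> f = g"
  by (metis cf_dilate laurent_eqI)

lemma dilate_in_sublattice: "N \<ge> 1 \<Longrightarrow> dilate N f \<in> sublattice_ring N"
  by (auto simp: sublattice_ring_def supp_dilate)

lemma sublattice_imp_dilate:
  assumes "h \<in> sublattice_ring N"
  shows "\<exists>h0. h = dilate N h0"
proof
  define q where "q n = (\<chi> i. n $ i div int N)" for n :: "int ^ 'a"
  have "int N *s q n = n" if "n \<in> supp h" for n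
    using assms that by (auto simp: q_def sublattice_ring_def vec_eq_iff)
  then have "dilate N (\<Sum>n\<in>supp h. sg (q n) (cf h n)) = (\<Sum>n\<in>supp h. sg n (cf h n))"
    by (simp add: ring_mapD(8)[OF ring_map_dilate] dilate_sg)
  then show "h = dilate N (\<Sum>n\<in>supp h. sg (q n) (cf h n))" using laurent_sum[of h] by simp
qed

lemma unit_in_sublattice_dilate:
  fixes u :: "('d::finite, int) laurent"
  assumes "N \<ge> 1"
  shows "unit_in (sublattice_ring N) (dilate N u) \<longleftrightarrow> u dvd 1"
proof
  assume "unit_in (sublattice_ring N) (dilate N u)"
  then obtain b where b: "b \<in> sublattice_ring N" "dilate N u * b = 1" by (auto simp: unit_in_def)
  then obtain b0 where "b = dilate N b0" using sublattice_imp_dilate by blast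
  then have "dilate N (u * b0) = dilate N 1" using b by (simp add: ring_mapD[OF ring_map_dilate])
  then have "u * b0 = 1" using dilate_eq_iff[OF assms] by blast
  then show "u dvd 1" by (metis dvd_triv_left)
next
  assume "u dvd 1"
  then obtain v where "1 = u * v" by (rule dvdE)
  then have "dilate N u * dilate N v = 1"
    by (metis ring_mapD(1)[OF ring_map_dilate] ring_mapD(4)[OF ring_map_dilate])
  then show "unit_in (sublattice_ring N) (dilate N u)"
    unfolding unit_in_def using dilate_in_sublattice[OF assms] by blast
qed

lemma irreducible_in_sublattice_dilate:
  fixes p :: "('d::finite, int) laurent"
  assumes N: "N \<ge> 1" and p: "irreducible p"
  shows "irreducible_in (sublattice_ring N) (dilate N p)"
  unfolding irreducible_in_def
proof (intro conjI ballI impI)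
  show "dilate N p \<in> sublattice_ring N" by (rule dilate_in_sublattice[OF N])
  show "dilate N p \<noteq> 0"
    using dilate_eq_iff[OF N, of p 0] p by (simp add: ring_mapD[OF ring_map_dilate] irreducible_def)
  show "\<not> unit_in (sublattice_ring N) (dilate N p)"
    using p unfolding unit_in_sublattice_dilate[OF N] irreducible_def by blast
  fix a b :: "('d, int) laurent"
  assume ab: "a \<in> sublattice_ring N" "b \<in> sublattice_ring N" "dilate N p = a * b"
  obtain a0 where a0: "a = dilate N a0" using sublattice_imp_dilate[OF ab(1)] by blast
  obtain b0 where b0: "b = dilate N b0" using sublattice_imp_dilate[OF ab(2)] by blast
  have "dilate N p = dilate N (a0 * b0)" using ab(3) by (simp add: a0 b0 ring_mapD[OF ring_map_dilate])
  then have "p = a0 * b0" using dilate_eq_iff[OF N] by blast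
  then have "a0 dvd 1 \<or> b0 dvd 1" using p unfolding irreducible_def by blast
  then show "unit_in (sublattice_ring N) a \<or> unit_in (sublattice_ring N) b"
    unfolding a0 b0 unit_in_sublattice_dilate[OF N] .
qed

section \<open>The contraction of a principal prime ideal\<close>

lemma irreducible_dvd_power:
  fixes p :: "('d::finite, 'a::{idom, factorial_semiring}) laurent"
  assumes "irreducible p" "p dvd h ^ k"
  shows "p dvd h"
  using assms(2)
proof (induction k)
  case 0
  then show ?case using assms(1) by (simp add: irreducible_def)
next
  case (Suc k)
  then show ?case using laurent_irreducible_dvd_mult[OF assms(1), of h "h ^ k"] by auto
qed

lemma irreducible_power_dvd_mult:
  fixes p :: "('d::finite, 'a::{idom, factorial_semiring}) laurent"
  assumes p: "irreducible p" and q: "\<not> p dvd q" and "p ^ k dvd q * h"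
  shows "p ^ k dvd h"
  using assms(3)
proof (induction k arbitrary: h)
  case (Suc k)
  have "p dvd q * h" using Suc.prems by (auto dest: dvd_mult_left)
  then have "p dvd h" using laurent_irreducible_dvd_mult[OF p] q by blast
  then obtain h' where h': "h = p * h'" by (rule dvdE)
  have p0: "p \<noteq> 0" using p by (simp add: irreducible_def)
  have "p * p ^ k dvd p * (q * h')" using Suc.prems by (simp add: h' mult_ac)
  then have "p ^ k dvd q * h'" using p0 by (simp add: laurent_dvd_mult_cancel)
  then have "p ^ k dvd h'" by (rule Suc.IH)
  then show ?case by (simp add: h' mult_dvd_mono)
qed auto

lemma irreducible_dvd_irreducible:
  fixes p q :: "('d::finite, 'a::comm_ring_1) laurent"
  assumes "irreducible p" "irreducible q" "q dvd p"
  obtains v where "v dvd 1" "p = v * q"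
proof -
  obtain v where v: "p = q * v" using assms(3) by (rule dvdE)
  then have "v dvd 1" using assms(1,2) unfolding irreducible_def by blast
  then show ?thesis using that v by (simp add: mult.commute)
qed

text \<open>The hypothesis says that \<open>p\<close> is the only prime factor of \<open>G\<close> up to units.\<close>

lemma power_of_only_prime:
  fixes p G :: "('d::finite, 'a::{idom, factorial_semiring}) laurent"
  assumes p: "irreducible p" and "G \<noteq> 0" and "\<And>q. irreducible q \<Longrightarrow> q dvd G \<Longrightarrow> q dvd p"
  shows "\<exists>u e. u dvd 1 \<and> G = u * p ^ e"
  using assms(2,3)
proof (induction rule: factor_induct)
  case (unit u)
  then show ?case by (intro exI[of _ u] exI[of _ 0]) simp
next
  case (mult q c)
  have "\<exists>u e. u dvd 1 \<and> c = u * p ^ e" using mult by (meson dvd_mult)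
  then obtain u e where u: "u dvd 1" "c = u * p ^ e" by (elim exE conjE)
  have "q dvd p" using mult by simp
  then obtain v where v: "v dvd 1" "p = v * q"
    using irreducible_dvd_irreducible[OF p mult.hyps(1)] by blast
  obtain v' where v': "1 = v * v'" using v(1) by (rule dvdE)
  have "q = (v * v') * q" by (simp flip: v')
  then have "q = v' * p" unfolding v(2) by (simp only: mult_ac)
  then have "q * c = (v' * u) * p ^ Suc e" using u(2) by (simp add: mult_ac)
  moreover have "v' dvd 1" using v' by (metis dvd_triv_right)
  then have "v' * u dvd 1" using u(1) by (metis mult_dvd_mono mult_1)
  ultimately show ?case by blast
qed

lemma supp_rescale_Omega: "\<rho> \<in> Omega N J \<Longrightarrow> N \<ge> 1 \<Longrightarrow> supp (rescale \<rho> F) = supp F"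
  by (intro supp_rescale Omega_nonzero)

lemma decimation_nonzero:
  fixes f :: "('d::finite, int) laurent"
  assumes "N \<ge> 1" "f \<noteq> 0"
  shows "decimation N f \<noteq> 0"
proof -
  have "rescale \<rho> (to_complex f) \<noteq> 0" if "\<rho> \<in> Omega N UNIV" for \<rho>
    using supp_rescale_Omega[OF that assms(1), of "to_complex f"] assms(2)
    by (metis keys_eq_empty supp_to_complex)
  then show ?thesis
    using laurent_prod_eq_0_iff[OF finite_Omega[OF assms(1)], of "\<lambda>\<rho>. rescale \<rho> (to_complex f)" UNIV]
    unfolding decimation_eq_dec[OF assms(1)] dec_def by blast
qed

lemma decimation_as_dilate:
  fixes f :: "('d::finite, int) laurent"
  assumes "N \<ge> 1"
  shows "\<exists>G. decimation N f = to_complex (dilate N G) \<and> f dvd dilate N G"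
proof -
  obtain F where F: "decimation N f = to_complex F" "f dvd F"
    using decimation_integral_multiple[OF assms] by blast
  have "F \<in> sublattice_ring N"
    using supp_dec[OF assms, of _ "to_complex f"] supp_to_complex[of F]
    by (auto simp: sublattice_ring_def decimation_eq_dec[OF assms] F(1)[symmetric])
  then show ?thesis using F sublattice_imp_dilate by blast
qed

text \<open>
One of the prime factors \<open>p\<close> of the decimation lies in the ideal of \<open>f\<close>, because \<open>f\<close> is prime.  Taking
decimations in \<open>h = f t\<close> shows that every prime factor of the decimation divides every element
\<open>h\<close> of the contraction, in particular \<open>p\<close>.  So \<open>p\<close> generates the contraction and is the only prime factor.
\<close>

lemma contraction_principal:
  fixes f :: "('d::finite, int) laurent"
  assumes N: "N \<ge> 1" and f: "irreducible f"
  shows "\<exists>p u e. irreducible p \<and> u dvd 1 \<and> e \<ge> 1 \<and> f dvd dilate N p \<and>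
    decimation N f = to_complex (dilate N (u * p ^ e)) \<and> (\<forall>h. f dvd dilate N h \<longrightarrow> p dvd h)"
proof -
  note dilate_hom = ring_mapD[OF ring_map_dilate[where N = N and 'a = int and 'd = 'd]]
  note tc_hom = ring_mapD[OF ring_map_to_complex[where 'd = 'd]]
  obtain G where G: "decimation N f = to_complex (dilate N G)" "f dvd dilate N G"
    using decimation_as_dilate[OF N] by blast
  have f0: "f \<noteq> 0" "\<not> f dvd 1" using f by (auto simp: irreducible_def)
  have "G \<noteq> 0"
  proof
    assume "G = 0"
    then have "decimation N f = 0" unfolding G(1) by (simp only: dilate_hom(2) tc_hom(2))
    then show False using decimation_nonzero[OF N f0(1)] by blast
  qed
  have ex: "\<exists>p. irreducible p \<and> p dvd G \<and> f dvd dilate N p"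
    using \<open>G \<noteq> 0\<close> G(2)
  proof (induction rule: factor_induct)
    case (unit u)
    have "dilate N u dvd dilate N 1" by (rule ring_map_dvd[OF ring_map_dilate unit(1)])
    then have "f dvd 1" using unit.prems unfolding dilate_hom(1) by (rule dvd_trans[rotated])
    then show ?case using f0 by blast
  next
    case (mult q c)
    then have "f dvd dilate N q \<or> f dvd dilate N c"
      using laurent_irreducible_dvd_mult[OF f] mult.prems unfolding dilate_hom(4) by blast
    then show ?case using mult.IH mult.hyps(1) by (meson dvd_mult dvd_triv_left)
  qed
  have div: "q dvd h" if q: "irreducible q" "q dvd G" and h: "f dvd dilate N h" for q h
  proof -
    obtain t where t: "dilate N h = f * t" using h by (rule dvdE)
    obtain T where T: "decimation N t = to_complex (dilate N T)" using decimation_as_dilate[OF N] by blast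
    \<comment> \<open>rotations fix \<open>h\<close>, so its decimation is a power\<close>
    define M where "M = card (Omega N (UNIV :: 'd set))"
    have "dec N (to_complex (dilate N h)) = to_complex (dilate N h) ^ M"
      unfolding M_def by (rule dec_sublattice[OF dilate_in_sublattice[OF N]])
    then have "to_complex (dilate N h) ^ M = dec N (to_complex (f * t))" by (simp only: t)
    also have "\<dots> = decimation N f * decimation N t"
      by (simp add: tc_hom dec_mult[OF N] decimation_eq_dec[OF N])
    also have "\<dots> = to_complex (dilate N (G * T))" by (simp add: G T dilate_hom tc_hom)
    finally have "to_complex (dilate N (h ^ M)) = to_complex (dilate N (G * T))" by (simp add: dilate_hom tc_hom)
    then have "h ^ M = G * T" by (simp add: dilate_eq_iff[OF N])
    then have "q dvd h ^ M" using q(2) by simp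
    then show ?thesis by (rule irreducible_dvd_power[OF q(1)])
  qed
  obtain p where p: "irreducible p" "p dvd G" "f dvd dilate N p" using ex by blast
  have qp: "q dvd p" if "irreducible q" "q dvd G" for q using div that p(3) by blast
  have "\<exists>u e. u dvd 1 \<and> G = u * p ^ e"
    by (rule power_of_only_prime[OF p(1) \<open>G \<noteq> 0\<close>]) (rule qp)
  then obtain u e where u: "u dvd 1" "G = u * p ^ e" by (elim exE conjE)
  have "e \<noteq> 0"
  proof
    assume "e = 0"
    then have "p dvd 1" using p(2) u by (simp add: dvd_trans[OF _ u(1)])
    then show False using p(1) by (simp add: irreducible_def)
  qed
  moreover have "\<forall>h. f dvd dilate N h \<longrightarrow> p dvd h" using div p by blast
  ultimately show ?thesis using p u G(1)
    by (intro exI[of _ p] exI[of _ u] exI[of _ e]) auto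
qed

text \<open>A real functional is replaced by an integral one: the error does not grow with the scale \<open>K\<close>.\<close>

lemma sum_floor_bound:
  fixes a :: "real ^ 'd::finite" and n :: "int ^ 'd"
  shows "real_of_int (dp (\<chi> i. \<lfloor>K * a $ i\<rfloor>) n) \<le> K * (a \<bullet> (\<chi> i. real_of_int (n $ i))) + (\<Sum>i\<in>UNIV. \<bar>real_of_int (n $ i)\<bar>)"
proof -
  have "real_of_int \<lfloor>K * a $ i\<rfloor> * real_of_int (n $ i) \<le> K * (a $ i * real_of_int (n $ i)) + \<bar>real_of_int (n $ i)\<bar>" for i
  proof -
    have "(real_of_int \<lfloor>K * a $ i\<rfloor> - K * a $ i) * real_of_int (n $ i)
        \<le> \<bar>real_of_int \<lfloor>K * a $ i\<rfloor> - K * a $ i\<bar> * \<bar>real_of_int (n $ i)\<bar>"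
      by (metis abs_ge_self abs_mult)
    also have "\<dots> \<le> 1 * \<bar>real_of_int (n $ i)\<bar>" by (intro mult_right_mono) linarith+
    finally show ?thesis by (simp add: algebra_simps)
  qed
  then have "(\<Sum>i\<in>UNIV. real_of_int \<lfloor>K * a $ i\<rfloor> * real_of_int (n $ i))
      \<le> (\<Sum>i\<in>UNIV. K * (a $ i * real_of_int (n $ i)) + \<bar>real_of_int (n $ i)\<bar>)" by (intro sum_mono)
  then show ?thesis by (simp add: dp_def inner_vec_def sum.distrib sum_distrib_left)
qed

text \<open>
A vertex of a polytope is exposed by a real functional, and finitely many strict inequalities survive
scaling and rounding.
\<close>

lemma adjusted_functional:
  fixes f :: "('d::finite, 'a::zero) laurent"
  assumes "adjusted f" "cf f 0 \<noteq> 0"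
  shows "\<exists>v. lead v f 0"
proof -
  define r where "r n = (\<chi> i. real_of_int (n $ i))" for n :: "int ^ 'd"
  have poly: "polytope (newton_polytope f)" unfolding newton_polytope_def by (intro polytope_convex_hull) simp
  have "{0} face_of newton_polytope f"
    using assms(1) unfolding adjusted_def by (simp add: face_of_singleton)
  then have "{0} exposed_face_of newton_polytope f"
    using exposed_face_of_polyhedron[OF polytope_imp_polyhedron[OF poly]] by blast
  then obtain a b where ab: "newton_polytope f \<subseteq> {x. a \<bullet> x \<le> b}" "{0} = newton_polytope f \<inter> {x. a \<bullet> x = b}"
    unfolding exposed_face_of_def by (elim exE conjE)
  have "(0 :: real ^ 'd) \<in> newton_polytope f \<inter> {x. a \<bullet> x = b}" unfolding ab(2)[symmetric] by simp
  then have b: "b = 0" by simp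
  have r: "r n \<in> newton_polytope f" if "n \<in> supp f" for n
    unfolding newton_polytope_def r_def using that by (intro hull_inc) auto
  have neg: "a \<bullet> r n < 0" if "n \<in> supp f" "n \<noteq> 0" for n
  proof -
    have "r n \<noteq> 0" using that(2) by (simp add: r_def vec_eq_iff)
    then have "r n \<notin> newton_polytope f \<inter> {x. a \<bullet> x = b}" unfolding ab(2)[symmetric] by simp
    moreover have "a \<bullet> r n \<le> b" using ab(1) r[OF that(1)] by blast
    ultimately show ?thesis using r[OF that(1)] b by simp
  qed
  define s where "s n = (\<Sum>i\<in>UNIV. \<bar>real_of_int (n $ i)\<bar>)" for n :: "int ^ 'd"
  \<comment> \<open>at this scale the rounding error \<open>s n\<close> is less than the distance from \<open>0\<close>\<close>
  define K where "K = 1 + (\<Sum>n\<in>supp f - {0}. s n / - (a \<bullet> r n))"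
  have s0: "s n \<ge> 0" for n by (simp add: s_def sum_nonneg)
  have "dp (\<chi> i. \<lfloor>K * a $ i\<rfloor>) n < 0" if n: "n \<in> supp f" "n \<noteq> 0" for n
  proof -
    have "s n / - (a \<bullet> r n) \<le> (\<Sum>n\<in>supp f - {0}. s n / - (a \<bullet> r n))"
      using n neg s0 by (intro member_le_sum) (auto intro!: divide_nonneg_neg simp: divide_nonneg_neg)
    then have "s n / - (a \<bullet> r n) < K" by (simp add: K_def)
    moreover have "0 < - (a \<bullet> r n)" using neg[OF n] by simp
    ultimately have "s n < K * - (a \<bullet> r n)" by (simp only: pos_divide_less_eq)
    then have "real_of_int (dp (\<chi> i. \<lfloor>K * a $ i\<rfloor>) n) < 0"
      using sum_floor_bound[of K a n] by (simp add: s_def r_def)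
    then show ?thesis by simp
  qed
  then show ?thesis using assms(2) by (auto simp: lead_def in_keys_iff dp_simps)
qed

lemma lead_power:
  fixes f :: "('d::finite, 'a::idom) laurent"
  assumes "lead w f a"
  shows "lead w (f ^ k) (int k *s a) \<and> cf (f ^ k) (int k *s a) = cf f a ^ k"
proof (induction k)
  case 0
  have "int 0 *s a = 0" by (simp add: vec_eq_iff)
  then show ?case by (simp add: lead_def)
next
  case (Suc k)
  have "int (Suc k) *s a = a + int k *s a" by (simp add: vec_eq_iff algebra_simps)
  then show ?case using lead_mult[OF assms, of "f ^ k" "int k *s a"] Suc by simp
qed

lemma lead_prod:
  fixes F :: "'b \<Rightarrow> ('d::finite, 'a::idom) laurent"
  assumes "finite A" "\<And>x. x \<in> A \<Longrightarrow> lead w (F x) 0"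
  shows "lead w (prod F A) 0 \<and> cf (prod F A) 0 = (\<Prod>x\<in>A. cf (F x) 0)"
  using assms
proof (induction A rule: finite_induct)
  case empty
  then show ?case by (simp add: lead_def)
next
  case (insert x A)
  then show ?case using lead_mult[of w "F x" 0 "prod F A" 0] by simp
qed

lemma lead_supp_cong: "supp f = supp g \<Longrightarrow> lead w f a \<longleftrightarrow> lead w g a"
  by (simp add: lead_def)

lemma lead_dilate: "N \<ge> 1 \<Longrightarrow> lead w f a \<Longrightarrow> lead w (dilate N f) (int N *s a)"
  by (auto simp: lead_def supp_dilate dp_scale)

lemma lead_sg_mult:
  fixes f :: "('d::finite, 'a::idom) laurent"
  assumes "lead w f a" "c \<noteq> 0"
  shows "lead w (sg m c * f) (m + a)" "cf (sg m c * f) (m + a) = c * cf f a"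
  using lead_mult[of w "sg m c" m f a] assms by (auto simp: lead_def split: if_splits)

text \<open>
Leading terms are compared for a functional that has its maximum over the support of \<open>f\<close> only at \<open>0\<close> and a unique
maximum over that of \<open>p\<close>, say at \<open>n\<close>.  The leading exponent of the decimation is \<open>0\<close>, so the monomial in
the unit is cancelled if \<open>p\<close> is divided by \<open>x^n\<close>; the sign is cancelled if the leading coefficient of \<open>p\<close> is
made positive, because that of the decimation is a power of the constant term of \<open>f\<close>.
\<close>

lemma normalized_contraction:
  fixes f :: "('d::finite, int) laurent"
  assumes N: "N \<ge> 1" and f: "irreducible f" "adjusted f" "cf f 0 > 0"
  shows "\<exists>p e. irreducible p \<and> e \<ge> 1 \<and> 0 \<in> supp p \<and> f dvd dilate N p \<and>
    decimation N f = to_complex (dilate N (p ^ e)) \<and> (\<forall>h. f dvd dilate N h \<longrightarrow> p dvd h)"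
proof -
  obtain p u e where p: "irreducible p" and u: "u dvd 1" and e: "e \<ge> 1" and fp: "f dvd dilate N p"
    and de: "decimation N f = to_complex (dilate N (u * p ^ e))" and ph: "\<forall>h. f dvd dilate N h \<longrightarrow> p dvd h"
    using contraction_principal[OF N f(1)] by (elim exE conjE)
  obtain v where v: "lead v f 0" using adjusted_functional[OF f(2)] f(3) by auto
  have "finite {f, p}" "0 \<notin> {f, p}" using f(1) p by (auto simp: irreducible_def)
  from lead_exists_refines[OF this, of v] obtain w
    where w: "\<forall>h\<in>{f, p}. \<exists>a. lead w h a \<and> (\<forall>m\<in>supp h. dp v m \<le> dp v a)" ..
  obtain a where a: "lead w f a" "\<forall>m\<in>supp f. dp v m \<le> dp v a" using w by auto
  have "a = 0"
  proof (rule ccontr)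
    assume "a \<noteq> 0"
    then have "dp v a < dp v 0" using v a(1) unfolding lead_def by blast
    moreover have "dp v 0 \<le> dp v a" using v a(2) unfolding lead_def by blast
    ultimately show False by simp
  qed
  then have lf: "lead w f 0" using a(1) by simp
  obtain n where n: "lead w p n" using w by auto
  obtain m c where m: "c dvd 1" "u = sg m c" using u unfolding unit_iff_monomial by blast
  have c0: "c \<noteq> 0" using m(1) by auto
  \<comment> \<open>the sign of the leading coefficient of \<open>p\<close>\<close>
  define s where "s = sgn (cf p n)"
  have pn: "cf p n \<noteq> 0" using n by (simp add: lead_def in_keys_iff)
  have s: "s * s = 1" "s * cf p n > 0" using pn by (auto simp: s_def sgn_if)
  have lp: "lead w (u * p ^ e) (m + int e *s n)" "cf (u * p ^ e) (m + int e *s n) = c * cf p n ^ e"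
    using lead_sg_mult[OF conjunct1[OF lead_power[OF n, of e]] c0, of m] lead_power[OF n, of e]
    by (simp_all add: m(2))
  have "lead w (dec N (to_complex f)) 0 \<and> cf (dec N (to_complex f)) 0 = (\<Prod>\<rho>\<in>Omega N UNIV. cf (rescale \<rho> (to_complex f)) 0)"
    unfolding dec_def
  proof (rule lead_prod[OF finite_Omega[OF N]])
    fix \<rho> assume "\<rho> \<in> Omega N (UNIV :: 'd set)"
    then have "supp (rescale \<rho> (to_complex f)) = supp f"
      by (simp add: supp_rescale_Omega[OF _ N])
    then show "lead w (rescale \<rho> (to_complex f)) 0" using lf lead_supp_cong by metis
  qed
  then have ld: "lead w (decimation N f) 0"
    and cd: "cf (decimation N f) 0 = of_int (cf f 0) ^ card (Omega N (UNIV :: 'd set))"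
    by (simp_all add: decimation_eq_dec[OF N] lookup_rescale cf_to_complex)
  have "lead w (decimation N f) (int N *s (m + int e *s n))"
    unfolding de using lead_dilate[OF N lp(1)] lead_supp_cong[OF supp_to_complex] by blast
  then have "int N *s (m + int e *s n) = 0" using ld by (rule lead_unique)
  then have "int N *s (m + int e *s n) = int N *s 0" by (simp add: vec_eq_iff)
  then have mn: "m + int e *s n = 0" by (rule injD[OF inj_scale[OF N]])
  have "cf (decimation N f) (int N *s 0) = of_int (c * cf p n ^ e)"
    unfolding de cf_to_complex cf_dilate[OF N] using lp(2) by (simp add: mn)
  moreover have "int N *s (0 :: int ^ 'd) = 0" by (simp add: vec_eq_iff)
  ultimately have "complex_of_int (cf f 0 ^ card (Omega N (UNIV :: 'd set))) = of_int (c * cf p n ^ e)"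
    using cd by simp
  then have "cf f 0 ^ card (Omega N (UNIV :: 'd set)) = c * cf p n ^ e" by (simp only: of_int_eq_iff)
  then have pos: "c * cf p n ^ e > 0" using f(3) by (metis zero_less_power)
  define p' where "p' = sg (- n) s * p"
  have "s dvd 1" using s(1) by (metis dvd_triv_left)
  then have us: "sg (- n) s dvd (1 :: ('d, int) laurent)" by (rule sg_unit)
  have p': "irreducible p'" unfolding p'_def by (rule irreducible_unit_mult[OF p us])
  have pp: "sg n s * p' = p" by (simp add: p'_def sg_mult_sg s(1) flip: mult.assoc)
  have assoc: "p' dvd h \<longleftrightarrow> p dvd h" for h
  proof
    assume "p' dvd h"
    then show "p dvd h" unfolding p'_def by (rule dvd_mult_right)
  next
    assume "p dvd h"
    then show "p' dvd h" by (metis pp dvd_mult_right)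
  qed
  have sg_pow: "sg n s ^ k = sg (int k *s n) (s ^ k)" for k
  proof (induction k)
    case 0
    have "int 0 *s n = 0" by (simp add: vec_eq_iff)
    then show ?case by simp
  next
    case (Suc k)
    have "int (Suc k) *s n = n + int k *s n" by (simp add: vec_eq_iff algebra_simps)
    then show ?case using Suc by (simp add: sg_mult_sg)
  qed
  have "u * p ^ e = (sg m c * sg n s ^ e) * p' ^ e"
    by (subst pp[symmetric]) (simp add: m(2) power_mult_distrib mult_ac)
  also have "sg m c * sg n s ^ e = sg 0 (c * s ^ e)" by (simp add: sg_pow sg_mult_sg mn)
  finally have up: "u * p ^ e = sg 0 (c * s ^ e) * p' ^ e" .
  have "c * s ^ e = 1"
  proof -
    have "\<bar>c\<bar> = 1" using m(1) by simp
    moreover have "\<bar>s\<bar> = 1" using pn by (simp add: s_def sgn_if)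
    ultimately have "\<bar>c * s ^ e\<bar> = 1" by (simp add: abs_mult power_abs)
    moreover have eq: "c * cf p n ^ e = (c * s ^ e) * (s * cf p n) ^ e"
    proof -
      have "(s * s) ^ e = 1" using s(1) by simp
      then have "c * cf p n ^ e = c * ((s * s) ^ e * cf p n ^ e)" by simp
      then show ?thesis by (simp add: power_mult_distrib mult_ac)
    qed
    have "(c * s ^ e) * (s * cf p n) ^ e > 0" using pos unfolding eq .
    then have "c * s ^ e > 0" using s(2) by (simp add: zero_less_mult_iff not_less zero_less_power order.strict_implies_order)
    ultimately show ?thesis by linarith
  qed
  then have "decimation N f = to_complex (dilate N (p' ^ e))" using de up by simp
  moreover have "0 \<in> supp p'"
    using n unfolding p'_def by (subst supp_sg_mult) (use s(1) in \<open>auto simp: lead_def\<close>)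
  moreover have "f dvd dilate N p'" using fp
    by (metis (no_types) assoc dvd_refl dvd_trans ring_map_dilate ring_map_dvd)
  ultimately show ?thesis using p' e ph assoc by blast
qed

section \<open>The contraction is unramified\<close>

text \<open>
The derivation \<open>\<Sum>v_i x_i d/dx_i\<close>.  It does not enlarge the support, and so it preserves subrings given by
conditions on the exponents.
\<close>

definition euler :: "int ^ 'd::finite \<Rightarrow> ('d, 'a::comm_ring_1) laurent \<Rightarrow> ('d, 'a) laurent" where
  "euler v = map_terms (\<lambda>n. n) (\<lambda>n c. of_int (dp v n) * c)"

lemma cf_euler: "cf (euler v f) n = of_int (dp v n) * cf f n"
  by (simp add: euler_def cf_map_terms)

lemma supp_euler: "supp (euler v f) \<subseteq> supp f"
  by (auto simp: in_keys_iff cf_euler)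

lemma euler_mult: "euler v (f * g) = euler v f * g + f * euler v g"
proof (rule laurent_eqI)
  fix n
  have "cf (euler v f * g) n = (\<Sum>a\<in>supp f. cf (euler v f) a * cf g (n - a))"
    by (rule cf_mult_on) (auto simp: supp_euler)
  then show "cf (euler v (f * g)) n = cf (euler v f * g + f * euler v g) n"
    by (simp add: cf_euler lookup_add cf_mult sum_distrib_left algebra_simps dp_simps flip: sum.distrib)
qed

text \<open>
The cofactor \<open>t\<close> is constant, because the derivative has no larger Newton polytope than \<open>g\<close>; and the
derivative has no constant term, while \<open>g\<close> has one.
\<close>

lemma euler_multiple:
  fixes g t :: "('d::finite, 'a::{idom, ring_char_0}) laurent"
  assumes "0 \<in> supp g" "euler v g = g * t"
  shows "euler v g = 0"
proof (rule ccontr)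
  assume nz: "euler v g \<noteq> 0"
  then have gt: "g \<noteq> 0" "t \<noteq> 0" using assms by auto
  have le: "hi x t \<le> 0" for x
  proof -
    have "hi x (euler v g) \<le> hi x g"
      using nz by (rule hi_le) (use supp_euler hi_ge in blast)
    then show ?thesis using hi_mult[OF gt, of x] by (simp add: assms(2))
  qed
  have "n = 0" if "n \<in> supp t" for n
  proof (rule ccontr)
    assume "n \<noteq> 0"
    then have "dp n n > 0" by (rule dp_self)
    then show False using hi_ge[OF that, of n] le[of n] by linarith
  qed
  then have "t = (\<Sum>n\<in>{0}. sg n (cf t n))" by (intro laurent_sum_on) auto
  then have t: "t = sg 0 (cf t 0)" by simp
  then have eq: "cf (euler v g) n = cf t 0 * cf g n" for n
    using cf_sg_mult[of 0 "cf t 0" g n] by (simp add: assms(2) mult.commute)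
  have "cf t 0 = 0" using eq[of 0] assms(1) by (simp add: cf_euler dp_simps in_keys_iff)
  then show False using t gt by simp
qed

text \<open>
If \<open>f^2\<close> divides the generator, then \<open>f\<close> divides its derivatives, which lie in the contraction.  They are
therefore multiples of the generator and vanish, so no variable occurs in the generator; then \<open>f\<close> is a
constant up to a monomial, and the generator is an associate of \<open>f\<close>.
\<close>

lemma contraction_unramified:
  fixes f p :: "('d::finite, int) laurent"
  assumes N: "N \<ge> 1" and f: "irreducible f" and p: "0 \<in> supp p"
    and ph: "\<And>h. f dvd dilate N h \<Longrightarrow> p dvd h"
  shows "\<not> f * f dvd dilate N p"
proof
  assume "f * f dvd dilate N p"
  then obtain q where q: "dilate N p = f * f * q" by (rule dvdE)
  have f0: "f \<noteq> 0" "\<not> f dvd 1" using f by (auto simp: irreducible_def)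
  have "int N *s (0 :: int ^ 'd) = 0" by (simp add: vec_eq_iff)
  then have g0: "0 \<in> supp (dilate N p)" using p by (force simp: supp_dilate[OF N])
  have D0: "euler v (dilate N p) = 0" for v
  proof -
    have "euler v (dilate N p) \<in> sublattice_ring N"
      using dilate_in_sublattice[OF N, of p] supp_euler[of v "dilate N p"] unfolding sublattice_ring_def by blast
    then obtain h where h: "euler v (dilate N p) = dilate N h" using sublattice_imp_dilate by blast
    have "f dvd euler v (dilate N p)"
      unfolding q mult.assoc euler_mult[of v f "f * q"]
      by (rule dvd_add[OF dvd_mult[OF dvd_triv_left] dvd_triv_left])
    then have "p dvd h" using h ph by simp
    then have "dilate N p dvd euler v (dilate N p)" unfolding h by (rule ring_map_dvd[OF ring_map_dilate])
    then obtain t where "euler v (dilate N p) = dilate N p * t" by (rule dvdE)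
    then show ?thesis by (rule euler_multiple[OF g0])
  qed
  have z0: "n = 0" if "n \<in> supp (dilate N p)" for n
  proof -
    have "dp (axis i 1) n = 0" for i
      using arg_cong[OF D0[of "axis i 1"], of "\<lambda>h. cf h n"] that by (simp add: cf_euler in_keys_iff)
    then show ?thesis by (simp add: dp_axis vec_eq_iff)
  qed
  have w0: "cwidth i (dilate N p) = 0" for i
    unfolding cwidth_eq_0_iff using z0 by metis
  have "dilate N p \<noteq> 0" using g0 by auto
  then have "cwidth i f = 0" for i
    using width_dvd[of f "dilate N p" "axis i 1"] w0[of i] q by (simp add: mult.assoc)
  from monomial_if_cwidth[OF f0(1) this] obtain m c where mc: "c \<noteq> 0" "f = sg m c" by (elim exE conjE)
  \<comment> \<open>\<open>f\<close> is associated to the constant \<open>c\<close>, which lies in the contraction\<close>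
  have s0: "sg 0 c = f * sg (- m) 1" "f = sg 0 c * sg m 1" by (simp_all add: mc(2) sg_mult_sg)
  have d0: "dilate N (sg 0 c) = (sg 0 c :: ('d, int) laurent)" by (simp add: dilate_sg \<open>int N *s 0 = 0\<close>)
  have "f dvd sg 0 c" unfolding s0(1) by (rule dvd_triv_left)
  then have "f dvd dilate N (sg 0 c)" by (simp only: d0)
  then have "p dvd sg 0 c" by (rule ph)
  then have "dilate N p dvd sg 0 c" by (subst d0[symmetric]) (rule ring_map_dvd[OF ring_map_dilate])
  also have "sg 0 c dvd f" unfolding s0(2) by (rule dvd_triv_left)
  finally have "f * f dvd f * 1" unfolding q by (simp add: dvd_mult_left)
  then have "f dvd 1" unfolding laurent_dvd_mult_cancel[OF f0(1)] .
  then show False using f0(2) by blast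
qed

text \<open>
Write \<open>p = f q\<close> in the large ring, where \<open>f\<close> does not divide \<open>q\<close>; then \<open>q\<close> can be cancelled modulo powers of
\<open>f\<close>.
\<close>

lemma contraction_powers:
  fixes f p h :: "('d::finite, int) laurent"
  assumes N: "N \<ge> 1" and f: "irreducible f" and p: "0 \<in> supp p" and fp: "f dvd dilate N p"
    and ph: "\<And>h. f dvd dilate N h \<Longrightarrow> p dvd h"
  shows "f ^ k dvd dilate N h \<longleftrightarrow> p ^ k dvd h"
proof
  assume "p ^ k dvd h"
  then have "dilate N (p ^ k) dvd dilate N h" by (rule ring_map_dvd[OF ring_map_dilate])
  moreover have "f ^ k dvd dilate N (p ^ k)"
    using fp by (simp add: ring_mapD[OF ring_map_dilate] dvd_power_same)
  ultimately show "f ^ k dvd dilate N h" by (rule dvd_trans[rotated])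
next
  obtain q where q: "dilate N p = f * q" using fp by (rule dvdE)
  have fq: "\<not> f dvd q"
  proof
    assume "f dvd q"
    then have "f * f dvd dilate N p" unfolding q by (intro mult_dvd_mono) auto
    then show False using contraction_unramified[OF N f p ph] by blast
  qed
  have f0: "f \<noteq> 0" using f by (simp add: irreducible_def)
  show "f ^ k dvd dilate N h \<Longrightarrow> p ^ k dvd h"
  proof (induction k arbitrary: h)
    case (Suc k)
    then have "f dvd dilate N h" by (auto dest: dvd_mult_left)
    then have "p dvd h" by (rule ph)
    then obtain h' where h': "h = p * h'" by (rule dvdE)
    have "f * f ^ k dvd f * (q * dilate N h')"
      using Suc.prems by (simp add: h' ring_mapD[OF ring_map_dilate] q mult.assoc)
    then have "f ^ k dvd q * dilate N h'" unfolding laurent_dvd_mult_cancel[OF f0] .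
    then have "f ^ k dvd dilate N h'" by (rule irreducible_power_dvd_mult[OF f fq])
    then have "p ^ k dvd h'" by (rule Suc.IH)
    then show ?case unfolding h' by (simp add: mult_dvd_mono)
  qed auto
qed

lemma contraction_ideal:
  fixes f p :: "('d::finite, int) laurent"
  assumes N: "N \<ge> 1" and "\<And>h. f dvd dilate N h \<longleftrightarrow> p dvd h"
  shows "principal_ideal_in UNIV f \<inter> sublattice_ring N = principal_ideal_in (sublattice_ring N) (dilate N p)"
proof (intro set_eqI iffI)
  fix x assume "x \<in> principal_ideal_in UNIV f \<inter> sublattice_ring N"
  then have x: "f dvd x" "x \<in> sublattice_ring N" by (auto simp: principal_ideal_in_def)
  then obtain h where h: "x = dilate N h" using sublattice_imp_dilate by blast
  then have "p dvd h" using x(1) assms(2) by simp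
  then obtain k where "h = p * k" by (rule dvdE)
  then have "x = dilate N k * dilate N p" by (simp add: h ring_mapD[OF ring_map_dilate] mult.commute)
  then show "x \<in> principal_ideal_in (sublattice_ring N) (dilate N p)"
    unfolding principal_ideal_in_def using dilate_in_sublattice[OF N] by blast
next
  fix x assume "x \<in> principal_ideal_in (sublattice_ring N) (dilate N p)"
  then obtain a where a: "x = a * dilate N p" "a \<in> sublattice_ring N" by (auto simp: principal_ideal_in_def)
  then obtain k where "a = dilate N k" using sublattice_imp_dilate by blast
  then have x: "x = dilate N (k * p)" by (simp add: a ring_mapD[OF ring_map_dilate])
  have "f dvd x" unfolding x assms(2) by simp
  then obtain t where "x = f * t" by (rule dvdE)
  then have "x = t * f" by (simp only: mult.commute)
  then have "x \<in> principal_ideal_in UNIV f" unfolding principal_ideal_in_def by blast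
  moreover have "x \<in> sublattice_ring N" unfolding x by (rule dilate_in_sublattice[OF N])
  ultimately show "x \<in> principal_ideal_in UNIV f \<inter> sublattice_ring N" by blast
qed

section \<open>Common factors over the complex numbers\<close>

lemma slice_ring_UNIV: "slice_ring (UNIV :: ('d::finite, 'a::idom) laurent set) i"
  by standard auto

text \<open>
Over the field of fractions of the polynomials free of \<open>x_i\<close> the polynomial \<open>f\<close> remains irreducible, and
its greatest common divisor with \<open>q\<close> is \<open>1\<close>; clearing denominators gives \<open>r\<close>.
\<close>

lemma bezout_free_of_variable:
  fixes f q :: "('d::finite, 'a::{idom, factorial_semiring}) laurent"
  assumes f: "irreducible f" and w: "cwidth i f > 0" and fq: "\<not> f dvd q"
  shows "\<exists>A B r. r \<noteq> 0 \<and> over (- {i}) r \<and> A * f + B * q = r"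
proof -
  have f0: "f \<noteq> 0" using f by (simp add: irreducible_def)
  interpret slice_ring "UNIV :: ('d, 'a) laurent set" i by (rule slice_ring_UNIV)
  obtain r A B c1 c2 s1 s2 where r: "r \<noteq> 0" "r \<in> UNIV" and "A \<in> UNIV" "B \<in> UNIV" "c1 \<in> UNIV"
    "c2 \<in> UNIV" "s1 \<in> UNIV" "s2 \<in> UNIV" and rAB: "r = A * f + B * q"
    and c1: "over (- {i}) c1" "c1 \<noteq> 0" "c1 * f = s1 * r"
    and c2: "over (- {i}) c2" "c2 \<noteq> 0" "c2 * q = s2 * r"
    by (rule euclid[OF UNIV_I UNIV_I f0])
  have free: "\<not> f dvd c" if "over (- {i}) c" "c \<noteq> 0" for c :: "('d, 'a) laurent"
    using width_dvd[of f c "axis i 1"] over_imp_cwidth[OF that(1), of i] w that(2) by auto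
  have "\<not> f dvd r"
  proof
    assume "f dvd r"
    then have "f dvd c2 * q" unfolding c2(3) by (rule dvd_mult)
    then show False using laurent_irreducible_dvd_mult[OF f] free[OF c2(1,2)] fq by blast
  qed
  moreover have "f dvd s1 * r" unfolding c1(3)[symmetric] by (rule dvd_triv_right)
  ultimately have "f dvd s1" using laurent_irreducible_dvd_mult[OF f] by blast
  then obtain s where s: "s1 = f * s" by (rule dvdE)
  have "f * c1 = f * (s * r)" using c1(3) by (simp add: s mult_ac)
  then have "c1 = s * r" using laurent_mult_cancel[OF f0] by blast
  then have "r dvd c1" by simp
  then have "cwidth i r = 0"
    using width_dvd[of r c1 "axis i 1"] over_imp_cwidth[OF c1(1), of i] c1(2) by simp
  obtain m where m: "m \<in> supp r" using r(1) by (meson hi_attained)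
  \<comment> \<open>\<open>r\<close> has width \<open>0\<close> in \<open>x_i\<close>; a shift makes it free of \<open>x_i\<close>\<close>
  define x where "x = (sg (axis i (- (m $ i))) 1 :: ('d, 'a) laurent)"
  have "over (- {i}) (x * r)"
    unfolding over_def
  proof (intro ballI allI impI)
    fix n j assume n: "n \<in> supp (x * r)" and "j \<notin> - {i}"
    then have j: "j = i" by simp
    have "n - axis i (- (m $ i)) \<in> supp r" using n by (simp add: x_def supp_sg_mult)
    then have "(n - axis i (- (m $ i))) $ i = m $ i"
      using m \<open>cwidth i r = 0\<close> unfolding cwidth_eq_0_iff by blast
    then show "n $ j = 0" by (simp add: j axis_def)
  qed
  moreover have "x * r \<noteq> 0" using r(1) by (simp add: x_def sg_eq_0_iff)
  moreover have "(x * A) * f + (x * B) * q = x * r" by (simp add: rAB algebra_simps)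
  ultimately show ?thesis by blast
qed

lemma cwidth_to_complex [simp]: "cwidth i (to_complex f) = cwidth i f"
  by (rule width_supp_cong) simp

lemma to_complex_eq_0_iff [simp]: "to_complex f = 0 \<longleftrightarrow> f = 0"
  using to_complex_eq_iff[of f 0] by (simp add: ring_mapD(2)[OF ring_map_to_complex])

text \<open>Over a field all nonzero constants are units.\<close>

lemma nonunit_complex_cwidth:
  fixes h :: "('d::finite, complex) laurent"
  assumes "h \<noteq> 0" "\<not> h dvd 1"
  shows "\<exists>i. cwidth i h > 0"
proof (rule ccontr)
  assume "\<nexists>i. cwidth i h > 0"
  then have "cwidth i h = 0" for i by simp
  from monomial_if_cwidth[OF assms(1) this] obtain n c where c: "c \<noteq> 0" "h = sg n c" by (elim exE conjE)
  have "c dvd 1" using c(1) by (simp add: dvd_field_iff)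
  then have "h dvd 1" unfolding c(2) by (rule sg_unit)
  then show False using assms(2) by blast
qed

text \<open>
A common factor \<open>h\<close> divides the polynomial \<open>r\<close> of a Bezout relation, which is free of a variable
occurring in \<open>h\<close>.  Irreducibility over the integers thus controls factors over \<open>C\<close>.
\<close>

lemma common_complex_factor_imp_dvd:
  fixes f q :: "('d::finite, int) laurent"
  assumes f: "irreducible f" and h: "\<not> h dvd 1" "h dvd to_complex f" "h dvd to_complex q"
  shows "f dvd q"
proof (rule ccontr)
  assume fq: "\<not> f dvd q"
  note tc = ring_mapD[OF ring_map_to_complex]
  have f0: "f \<noteq> 0" using f by (simp add: irreducible_def)
  have h0: "h \<noteq> 0" using h(2) f0 by auto
  obtain i where i: "cwidth i h > 0" using nonunit_complex_cwidth[OF h0 h(1)] by blast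
  have "cwidth i h \<le> cwidth i f"
    using width_dvd[OF h(2), of "axis i 1"] f0 by simp
  then have wf: "cwidth i f > 0" using i by linarith
  obtain A B r where r: "r \<noteq> 0" "over (- {i}) r" "A * f + B * q = r"
    using bezout_free_of_variable[OF f wf fq] by (elim exE conjE)
  have "h dvd to_complex A * to_complex f + to_complex B * to_complex q"
    using h(2,3) by (intro dvd_add dvd_mult)
  then have "h dvd to_complex (A * f + B * q)" by (simp only: tc)
  then have "h dvd to_complex r" by (simp only: r(3))
  then have "cwidth i h \<le> cwidth i r"
    using width_dvd[of h "to_complex r" "axis i 1"] r(1) by simp
  then show False using i over_imp_cwidth[OF r(2), of i] by simp
qed

section \<open>The multiplicity of the decimation\<close>

text \<open>
If \<open>e\<close> were too small, then \<open>f\<close> would divide \<open>Q\<close> and hence \<open>r\<close>, in which \<open>x_i\<close> does not occur.  If \<open>e\<close> were too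
large, then a complex factor of \<open>f\<close> would divide \<open>q0\<close>, and so would \<open>f\<close>.
\<close>

lemma multiplicity_certificate_sound:
  fixes f q0 :: "('d::finite, int) laurent"
  assumes f: "irreducible f" "cwidth i f > 0" and q0: "\<not> f dvd q0"
    and eq: "to_complex f ^ e * Q = to_complex ((f * q0) ^ e0)"
    and r: "A * to_complex f + B * Q = r" "r \<noteq> 0" "over (- {i}) r"
  shows "e = e0"
proof (rule ccontr)
  note tc = ring_mapD[OF ring_map_to_complex]
  define F where "F = to_complex f"
  have f0: "f \<noteq> 0" using f by (simp add: irreducible_def)
  then have F0: "F \<noteq> 0" by (simp add: F_def)
  then have Fp: "F ^ k \<noteq> 0" for k by simp
  have eq': "F ^ e * Q = F ^ e0 * to_complex q0 ^ e0"
    using eq by (simp add: F_def tc power_mult_distrib)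
  have wF: "cwidth i F > 0" using f(2) by (simp add: F_def)
  assume "e \<noteq> e0"
  then consider "e < e0" | "e0 < e" by linarith
  then show False
  proof cases
    case 1
    then have "F ^ e0 = F ^ e * F ^ (e0 - e)" by (simp flip: power_add)
    then have "F ^ e * Q = F ^ e * (F ^ (e0 - e) * to_complex q0 ^ e0)" using eq' by (simp add: mult.assoc)
    then have Q: "Q = F ^ (e0 - e) * to_complex q0 ^ e0" using laurent_mult_cancel[OF Fp] by blast
    have "F dvd F ^ (e0 - e)" using 1 by (intro dvd_power) auto
    then have "F dvd Q" unfolding Q by (rule dvd_mult2)
    then have "F dvd r" unfolding r(1)[symmetric] F_def by (intro dvd_add dvd_mult) auto
    then have "cwidth i F \<le> cwidth i r" using r(2) by (rule width_dvd)
    then show False using wF over_imp_cwidth[OF r(3), of i] by simp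
  next
    case 2
    then have "F ^ e = F ^ e0 * F ^ (e - e0)" by (simp flip: power_add)
    then have "F ^ e0 * (F ^ (e - e0) * Q) = F ^ e0 * to_complex q0 ^ e0" using eq' by (simp add: mult.assoc)
    then have Q: "F ^ (e - e0) * Q = to_complex q0 ^ e0" using laurent_mult_cancel[OF Fp] by blast
    have "\<not> F dvd 1"
    proof
      assume "F dvd 1"
      then have "cwidth i F \<le> cwidth i (1 :: ('d, complex) laurent)" by (rule width_dvd) simp
      then show False using wF by simp
    qed
    then obtain h where h: "irreducible h" "h dvd F" using irreducible_factor_exists[OF F0] by blast
    have "F dvd F ^ (e - e0)" using 2 by (intro dvd_power) auto
    then have "h dvd F ^ (e - e0)" using h(2) by (rule dvd_trans[rotated])
    then have "h dvd to_complex q0 ^ e0" unfolding Q[symmetric] by (rule dvd_mult2)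
    then have "h dvd to_complex q0" by (rule irreducible_dvd_power[OF h(1)])
    moreover have "\<not> h dvd 1" using h(1) by (simp add: irreducible_def)
    ultimately have "f dvd q0" using common_complex_factor_imp_dvd[OF f(1)] h(2) unfolding F_def by blast
    then show False using q0 by blast
  qed
qed

section \<open>Common factors of a polynomial and its rotations\<close>

lemma irreducible_dvd_prod:
  fixes F :: "'b \<Rightarrow> ('d::finite, 'a::{idom, factorial_semiring}) laurent"
  assumes h: "irreducible h" and "finite A" "h dvd prod F A"
  shows "\<exists>x\<in>A. h dvd F x"
  using assms(2,3)
proof (induction A rule: finite_induct)
  case empty
  then show ?case using h by (simp add: irreducible_def)
next
  case (insert x A)
  then show ?case using laurent_irreducible_dvd_mult[OF h, of "F x" "prod F A"] by auto
qed

lemma irreducible_factor_cwidth: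
  fixes r :: "('d::finite, 'a::{idom, factorial_semiring}) laurent"
  assumes "r \<noteq> 0" "cwidth i r > 0"
  shows "\<exists>h. irreducible h \<and> h dvd r \<and> cwidth i h > 0"
  using assms
proof (induction rule: factor_induct)
  case (unit u)
  then have "cwidth i u \<le> cwidth i (1 :: ('d, 'a) laurent)" by (intro width_dvd) auto
  then show ?case using unit.prems by simp
next
  case (mult q c)
  have q0: "q \<noteq> 0" using mult.hyps(1) by (simp add: irreducible_def)
  show ?case
  proof (cases "cwidth i q > 0")
    case True
    then show ?thesis using mult.hyps(1) by (intro exI[of _ q]) simp
  next
    case False
    then have "cwidth i c > 0" using mult.prems width_mult[OF q0 mult.hyps(2), of "axis i 1"] by simp
    then show ?thesis using mult.IH by (meson dvd_mult)
  qed
qed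

text \<open>The rotation by \<open>(t^k_i)\<close>, as a polynomial in \<open>t\<close>.\<close>

definition rotation_lift :: "nat \<Rightarrow> ('d::finite \<Rightarrow> nat) \<Rightarrow> ('d, int) laurent \<Rightarrow> ('d, int poly) laurent" where
  "rotation_lift N k = map_terms (\<lambda>n. n) (\<lambda>n c. monom c (\<Sum>i\<in>UNIV. k i * expo N (n $ i)))"

lemma ev_rotation_lift:
  assumes "z ^ N = 1" "N \<ge> 1"
  shows "ev of_int z (rotation_lift N k f) = rescale (\<lambda>i. z ^ k i) (to_complex f)"
proof (rule laurent_eqI)
  fix n
  have "(z ^ k i) ^ N = 1" for i using assms(1) by (metis mult.commute power_mult power_one)
  from power_expo[OF this assms(2)]
  have "(\<Prod>i\<in>UNIV. z ^ (k i * expo N (n $ i))) = (\<Prod>i\<in>UNIV. (z ^ k i) powi (n $ i))"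
    by (simp add: power_mult)
  then show "cf (ev of_int z (rotation_lift N k f)) n = cf (rescale (\<lambda>i. z ^ k i) (to_complex f)) n"
    by (simp add: cf_ev ring_map_of_int rotation_lift_def cf_map_terms evi_hom lookup_rescale
        cf_to_complex power_sum)
qed

lemma supp_ev_conjugate:
  assumes "z ^ N = 1" "N \<ge> 1" "coprime a N" "a > 0"
  shows "supp (ev of_int (z ^ a) H) = supp (ev of_int z H)"
  by (auto simp: in_keys_iff cf_ev ring_map_of_int conjugate_root_iff[OF assms])

lemma slice_ring_ev: "slice_ring (Set.range (ev of_int z :: ('d::finite, int poly) laurent \<Rightarrow> _)) i"
proof -
  note hom = ring_mapD[OF ring_map_ev[OF ring_map_of_int, of z]]
  have s: "slice i k (ev of_int z H) = ev of_int z (slice i k H)" for k and H :: "('d, int poly) laurent"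
    by (rule laurent_eqI) (simp add: cf_slice cf_ev ring_map_of_int evi_hom)
  have x: "sg (axis i k) 1 = ev of_int z (sg (axis i k) 1)" for k
    by (rule laurent_eqI) (simp add: cf_sg cf_ev ring_map_of_int evi_hom)
  show ?thesis
  proof
    show "1 \<in> Set.range (ev of_int z :: ('d, int poly) laurent \<Rightarrow> _)" by (metis hom(1) rangeI)
  next
    fix f g :: "('d, complex) laurent"
    assume "f \<in> Set.range (ev of_int z)" "g \<in> Set.range (ev of_int z)"
    then show "f + g \<in> Set.range (ev of_int z)" "f - g \<in> Set.range (ev of_int z)" "f * g \<in> Set.range (ev of_int z)"
      by (auto simp flip: hom)
  next
    fix f :: "('d, complex) laurent" and k
    assume "f \<in> Set.range (ev of_int z)"
    then show "slice i k f \<in> Set.range (ev of_int z)" by (auto simp: s)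
  next
    fix k show "sg (axis i k) 1 \<in> Set.range (ev of_int z :: ('d, int poly) laurent \<Rightarrow> _)"
      unfolding x by (rule rangeI)
  qed
qed

text \<open>
Replacing \<open>z\<close> by \<open>z^a\<close> respects all identities over \<open>Z[z]\<close> and all supports.  So the Euclidean
algorithm is run over \<open>Z[z]\<close>: its result \<open>r\<close> is a multiple of \<open>h\<close> and thus has positive width in some \<open>x_i\<close>,
and its conjugate has the same width; an irreducible factor of the conjugate in which \<open>x_i\<close> occurs divides
both polynomials.
\<close>

lemma conjugate_common_factor:
  fixes f :: "('d::finite, int) laurent"
  assumes z: "z ^ N = 1" "N \<ge> 1" and a: "coprime a N" "a > 0" and f0: "f \<noteq> 0"
    and h: "\<not> h dvd 1" "h dvd to_complex f" "h dvd rescale (\<lambda>i. z ^ k i) (to_complex f)"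
  shows "\<exists>h'. irreducible h' \<and> h' dvd to_complex f \<and> h' dvd rescale (\<lambda>i. (z ^ a) ^ k i) (to_complex f)"
proof -
  note hom = ring_mapD[OF ring_map_ev[OF ring_map_of_int]]
  have tc: "ev of_int z' (const_poly f) = to_complex f" for z'
    by (simp add: ev_const_poly ring_map_of_int to_complex_eq)
  have za: "(z ^ a) ^ N = 1" using z(1) by (metis mult.commute power_mult power_one)
  define F1 where "F1 = const_poly f"
  define F2 where "F2 = rotation_lift N k f"
  have F2: "ev of_int z F2 = rescale (\<lambda>i. z ^ k i) (to_complex f)"
    "ev of_int (z ^ a) F2 = rescale (\<lambda>i. (z ^ a) ^ k i) (to_complex f)"
    unfolding F2_def using ev_rotation_lift z za by blast+
  have F1: "ev of_int z F1 = to_complex f" "ev of_int (z ^ a) F1 = to_complex f"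
    by (simp_all add: F1_def tc)
  have tf0: "to_complex f \<noteq> 0" using f0 by simp
  have h0: "h \<noteq> 0" using h(2) tf0 by auto
  obtain i where i: "cwidth i h > 0" using nonunit_complex_cwidth[OF h0 h(1)] by blast
  interpret slice_ring "Set.range (ev of_int z :: ('d, int poly) laurent \<Rightarrow> _)" i
    by (rule slice_ring_ev)
  have m1: "to_complex f \<in> Set.range (ev of_int z)" unfolding F1(1)[symmetric] by (rule rangeI)
  have m2: "rescale (\<lambda>i. z ^ k i) (to_complex f) \<in> Set.range (ev of_int z)"
    unfolding F2(1)[symmetric] by (rule rangeI)
  obtain r A B c1 c2 s1 s2 where r: "r \<noteq> 0" and rR: "r \<in> Set.range (ev of_int z)"
    and "A \<in> Set.range (ev of_int z)" "B \<in> Set.range (ev of_int z)"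
    and c1R: "c1 \<in> Set.range (ev of_int z)" and c2R: "c2 \<in> Set.range (ev of_int z)"
    and s1R: "s1 \<in> Set.range (ev of_int z)" and s2R: "s2 \<in> Set.range (ev of_int z)"
    and rAB: "r = A * to_complex f + B * rescale (\<lambda>i. z ^ k i) (to_complex f)"
    and c1: "over (- {i}) c1" "c1 \<noteq> 0" "c1 * to_complex f = s1 * r"
    and c2: "over (- {i}) c2" "c2 \<noteq> 0" "c2 * rescale (\<lambda>i. z ^ k i) (to_complex f) = s2 * r"
    by (rule euclid[OF m1 m2 tf0])
  obtain R where R: "r = ev of_int z R" using rR by blast
  obtain C1 where C1: "c1 = ev of_int z C1" using c1R by blast
  obtain C2 where C2: "c2 = ev of_int z C2" using c2R by blast
  obtain S1 where S1: "s1 = ev of_int z S1" using s1R by blast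
  obtain S2 where S2: "s2 = ev of_int z S2" using s2R by blast
  note conj = supp_ev_conjugate[OF z a]
  have transfer: "ev of_int (z ^ a) H = 0 \<longleftrightarrow> ev of_int z H = 0" for H :: "('d, int poly) laurent"
    by (metis conj keys_eq_empty)
  have "ev of_int z (C1 * F1 - S1 * R) = 0" using c1(3) by (simp add: hom C1 F1 S1 R)
  then have "ev of_int (z ^ a) (C1 * F1 - S1 * R) = 0" unfolding transfer .
  then have e1: "ev of_int (z ^ a) C1 * to_complex f = ev of_int (z ^ a) S1 * ev of_int (z ^ a) R"
    by (simp add: hom F1)
  have "ev of_int z (C2 * F2 - S2 * R) = 0" using c2(3) by (simp add: hom C2 F2 S2 R)
  then have "ev of_int (z ^ a) (C2 * F2 - S2 * R) = 0" unfolding transfer .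
  then have e2: "ev of_int (z ^ a) C2 * rescale (\<lambda>i. (z ^ a) ^ k i) (to_complex f)
      = ev of_int (z ^ a) S2 * ev of_int (z ^ a) R"
    by (simp add: hom F2)
  have "h dvd r" unfolding rAB using h(2,3) by (intro dvd_add dvd_mult)
  then have "cwidth i h \<le> cwidth i r" using r by (rule width_dvd)
  then have "cwidth i (ev of_int (z ^ a) R) > 0"
    using i width_supp_cong[OF conj[of R], of "axis i 1"] by (simp add: R)
  moreover have "ev of_int (z ^ a) R \<noteq> 0" using r by (simp add: transfer R)
  ultimately obtain h' where h': "irreducible h'" "h' dvd ev of_int (z ^ a) R" "cwidth i h' > 0"
    using irreducible_factor_cwidth by blast
  have free: "\<not> h' dvd ev of_int (z ^ a) C" if "over (- {i}) (ev of_int z C)" "ev of_int z C \<noteq> 0" for C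
  proof
    assume "h' dvd ev of_int (z ^ a) C"
    then have "cwidth i h' \<le> cwidth i (ev of_int (z ^ a) C)"
      by (rule width_dvd) (simp add: transfer that(2))
    also have "\<dots> = cwidth i (ev of_int z C)" by (rule width_supp_cong[OF conj])
    also have "\<dots> = 0" using over_imp_cwidth[OF that(1), of i] by simp
    finally show False using h'(3) by simp
  qed
  have "h' dvd ev of_int (z ^ a) C1 * to_complex f" unfolding e1 using h'(2) by (rule dvd_mult)
  then have "h' dvd to_complex f"
    using laurent_irreducible_dvd_mult[OF h'(1)] free[of C1] c1(1,2) unfolding C1 by blast
  moreover have "h' dvd ev of_int (z ^ a) C2 * rescale (\<lambda>i. (z ^ a) ^ k i) (to_complex f)"
    unfolding e2 using h'(2) by (rule dvd_mult)
  then have "h' dvd rescale (\<lambda>i. (z ^ a) ^ k i) (to_complex f)"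
    using laurent_irreducible_dvd_mult[OF h'(1)] free[of C2] c2(1,2) unfolding C2 by blast
  ultimately show ?thesis using h'(1) by blast
qed

lemma euler_to_complex: "euler v (to_complex f) = to_complex (euler v f)"
  by (rule laurent_eqI) (simp add: cf_euler cf_to_complex)

text \<open>Dirichlet's theorem for the fractions \<open>k_i / N\<close>, with the denominators cleared.\<close>

lemma simultaneous_approximation:
  fixes k :: "int ^ 'd::finite"
  assumes "M \<ge> 1" "N \<ge> 1"
  shows "\<exists>q p. 0 < q \<and> q \<le> int (M ^ CARD('d)) \<and> (\<forall>i. int M * \<bar>q * k $ i - int N * p i\<bar> < int N)"
proof -
  \<comment> \<open>Dirichlet's theorem is about numbers indexed by an initial segment\<close>
  obtain \<iota> :: "nat \<Rightarrow> 'd" where \<iota>: "bij_betw \<iota> {..<CARD('d)} UNIV"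
    using ex_bij_betw_nat_finite[of "UNIV :: 'd set"] by (auto simp: atLeast0LessThan)
  obtain q p where q: "0 < q" "q \<le> int (M ^ CARD('d))"
    "\<And>j. j < CARD('d) \<Longrightarrow> \<bar>of_int q * (real_of_int (k $ \<iota> j) / real N) - of_int (p j)\<bar> < 1 / real M"
    using Dirichlet_approx_simult[of M "CARD('d)" "\<lambda>j. real_of_int (k $ \<iota> j) / real N"] assms by auto
  have "int M * \<bar>q * k $ i - int N * p (inv_into {..<CARD('d)} \<iota> i)\<bar> < int N" for i
  proof -
    define j where "j = inv_into {..<CARD('d)} \<iota> i"
    have j: "j < CARD('d)" "\<iota> j = i"
      using \<iota> unfolding j_def bij_betw_def by (metis UNIV_I inv_into_into lessThan_iff, metis UNIV_I f_inv_into_f)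
    have "\<bar>real_of_int q * (real_of_int (k $ i) / real N) - real_of_int (p j)\<bar> * (real M * real N) < 1 / real M * (real M * real N)"
      using q(3)[OF j(1)] assms unfolding j(2) by (intro mult_strict_right_mono) auto
    also have "\<dots> = real N" using assms by simp
    also have "\<bar>real_of_int q * (real_of_int (k $ i) / real N) - real_of_int (p j)\<bar> * (real M * real N)
        = real M * \<bar>(real_of_int q * (real_of_int (k $ i) / real N) - real_of_int (p j)) * real N\<bar>"
      by (simp add: abs_mult)
    also have "(real_of_int q * (real_of_int (k $ i) / real N) - real_of_int (p j)) * real N
        = real_of_int (q * k $ i - int N * p j)"
      using assms by (simp add: field_simps)
    finally have "real_of_int (int M * \<bar>q * k $ i - int N * p j\<bar>) < real_of_int (int N)" by simp
    then show ?thesis unfolding j_def[symmetric] of_int_less_iff .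
  qed
  then show ?thesis using q(1,2) by (intro exI[of _ q] exI[of _ "\<lambda>i. p (inv_into {..<CARD('d)} \<iota> i)"]) auto
qed

lemma powi_1_iff_primitive:
  assumes "primitive N z"
  shows "z powi m = 1 \<longleftrightarrow> int N dvd m"
proof -
  have z: "z ^ N = 1" "N \<ge> 1" using assms by (auto simp: primitive_def)
  have "z powi m = 1 \<longleftrightarrow> N dvd expo N m"
    using power_expo[OF z, of m] primitive_pow_eq_1[OF assms, of "expo N m"] by simp
  also have "\<dots> \<longleftrightarrow> int N dvd int (expo N m)" by simp
  also have "\<dots> \<longleftrightarrow> int N dvd m" by (simp add: int_expo[OF z(2)] dvd_add_left_iff)
  finally show ?thesis .
qed

lemma unit_multiple_same_supp:
  fixes h :: "('d::finite, complex) laurent"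
  assumes "h \<noteq> 0" "g = u * h" "u dvd 1" "supp g = supp h"
  obtains c where "u = sg 0 c"
proof -
  obtain m c where m: "c dvd 1" "u = sg m c" using assms(3) unfolding unit_iff_monomial by blast
  have c0: "c \<noteq> 0" using m(1) by auto
  then have u0: "u \<noteq> 0" by (simp add: m(2) sg_eq_0_iff)
  have g0: "g \<noteq> 0" using assms(1,2) u0 by simp
  have "dp m m = 0"
  proof -
    have "hi m g = hi m h" by (simp add: hi_def assms(4))
    moreover have "hi m g = hi m u + hi m h" unfolding assms(2) by (rule hi_mult[OF u0 assms(1)])
    moreover have "hi m u = dp m m" unfolding m(2) using c0 by (intro hi_eqI) auto
    ultimately show ?thesis by simp
  qed
  then have "m = 0" using dp_self[of m] by auto
  then show ?thesis using that m(2) by blast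
qed

text \<open>
The rotation multiplies \<open>h\<close> by a constant, so the functional \<open>k\<close> is constant modulo \<open>N\<close> on the support of
\<open>h\<close>.  By Dirichlet's theorem some multiple \<open>q k\<close> is congruent modulo \<open>N\<close> to a vector \<open>v\<close> so small that the
congruence for \<open>v\<close> is an equality.  Thus \<open>h\<close> is an eigenvector of the derivation of \<open>v\<close>, and \<open>h\<close> divides
the derivative of \<open>f\<close>; by irreducibility so does \<open>f\<close>, whence the derivative is \<open>0\<close> and \<open>v = 0\<close> by the
hypothesis on the rank.  But \<open>q\<close> is prime to \<open>N\<close>, so \<open>k = 0\<close> modulo \<open>N\<close>.
\<close>

lemma rotation_stabilizer_trivial:
  fixes f :: "('d::finite, int) laurent" and h :: "('d, complex) laurent"
  assumes f: "irreducible f" "0 \<in> supp f" and rank: "\<And>v. (\<forall>n\<in>supp f. dp v n = 0) \<Longrightarrow> v = 0"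
    and W: "total_width f \<le> W" and N: "primitive N z"
    and cop: "\<And>a. 0 < a \<Longrightarrow> a \<le> (W + 1) ^ CARD('d) \<Longrightarrow> coprime a N"
    and h: "\<not> h dvd 1" "h dvd to_complex f" and u: "u dvd 1" "rescale (\<lambda>i. z ^ k i) h = u * h"
  shows "int N dvd int (k i)"
proof (rule ccontr)
  assume ndvd: "\<not> int N dvd int (k i)"
  have z: "z ^ N = 1" "N \<ge> 1" using N by (auto simp: primitive_def)
  have z0: "z \<noteq> 0" using z by (auto simp: power_0_left)
  have f0: "f \<noteq> 0" using f by (simp add: irreducible_def)
  have h0: "h \<noteq> 0" using h(2) f0 by auto
  define kv where "kv = (\<chi> i. int (k i))"
  have "supp (rescale (\<lambda>i. z ^ k i) h) = supp h" using z0 by (intro supp_rescale) auto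
  from unit_multiple_same_supp[OF h0 u(2,1) this] obtain c where c: "u = sg 0 c" .
  have rot: "(\<Prod>i\<in>UNIV. (z ^ k i) powi (n $ i)) = z powi (dp kv n)" for n
  proof -
    have "(z ^ k i) powi (n $ i) = z powi (int (k i) * n $ i)" for i
      by (simp add: power_int_mult)
    moreover have "(\<Prod>i\<in>A. z powi (g i)) = z powi (sum g A)" if "finite A" for g and A :: "'d set"
      using that by (induction A rule: finite_induct) (simp_all add: power_int_add z0)
    ultimately show ?thesis by (simp add: dp_def kv_def)
  qed
  have const: "z powi (dp kv n) = c" if "n \<in> supp h" for n
    using arg_cong[OF u(2), of "\<lambda>f. cf f n"] that
    by (simp add: lookup_rescale rot c cf_sg_mult in_keys_iff)
  obtain n0 where n0: "n0 \<in> supp h" using h0 by (meson hi_attained)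
  have kdvd: "int N dvd dp kv (n - n0)" if "n \<in> supp h" for n
  proof -
    have "z powi (dp kv n) = z powi (dp kv n0)" using const that n0 by simp
    then have "z powi (dp kv (n - n0)) = 1"
      by (simp add: dp_simps power_int_diff z0)
    then show ?thesis unfolding powi_1_iff_primitive[OF N] .
  qed
  have "W + 1 \<ge> 1" by simp
  from simultaneous_approximation[OF this z(2), of kv] obtain q p where
    q: "0 < q" "q \<le> int ((W + 1) ^ CARD('d))"
    and p: "\<And>i. int (W + 1) * \<bar>q * kv $ i - int N * p i\<bar> < int N" by (elim exE conjE) blast
  \<comment> \<open>the components of \<open>v\<close> are less than \<open>N / (W + 1)\<close> in absolute value\<close>
  define v where "v = (\<chi> i. q * kv $ i - int N * p i)"
  have "coprime (nat q) N" by (intro cop) (use q in \<open>simp_all only: nat_le_iff zero_less_nat_eq\<close>)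
  then have qN: "coprime q (int N)" using q(1) by (metis coprime_int_iff int_nat_eq order_less_imp_le)
  have "v \<noteq> 0"
  proof
    assume "v = 0"
    then have "v $ i = 0" by simp
    then have "q * int (k i) = int N * p i" by (simp add: v_def kv_def)
    then have "int N dvd q * int (k i)" by simp
    then have "int N dvd int (k i)" using qN by (simp add: coprime_dvd_mult_right_iff coprime_commute)
    then show False using ndvd by blast
  qed
  have dv: "dp v n = dp v n0" if n: "n \<in> supp h" for n
  proof (rule ccontr)
    assume ne: "dp v n \<noteq> dp v n0"
    have "dp v (n - n0) = q * dp kv (n - n0) - int N * dp (\<chi> i. p i) (n - n0)"
      by (simp add: dp_def v_def left_diff_distrib sum_subtractf sum_distrib_left mult.assoc)
    then have "int N dvd dp v (n - n0)" using kdvd[OF n] by simp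
    moreover have "dp v (n - n0) \<noteq> 0" using ne by (simp add: dp_simps)
    ultimately have "int N \<le> \<bar>dp v (n - n0)\<bar>" by (metis abs_of_nat dvd_imp_le_int)
    then have "int (W + 1) * int N \<le> int (W + 1) * \<bar>dp v (n - n0)\<bar>" by (intro mult_left_mono) auto
    also have "\<bar>dp v (n - n0)\<bar> \<le> (\<Sum>i\<in>UNIV. \<bar>v $ i * (n - n0) $ i\<bar>)" unfolding dp_def by (rule sum_abs)
    also have "int (W + 1) * (\<Sum>i\<in>UNIV. \<bar>v $ i * (n - n0) $ i\<bar>)
        = (\<Sum>i\<in>UNIV. (int (W + 1) * \<bar>v $ i\<bar>) * \<bar>(n - n0) $ i\<bar>)"
      by (simp add: sum_distrib_left abs_mult mult.assoc)
    also have "\<dots> \<le> (\<Sum>i\<in>UNIV. int N * int (cwidth i f))"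
    proof (rule sum_mono)
      fix i
      have "\<bar>(n - n0) $ i\<bar> \<le> int (cwidth i h)"
        using width_le_diff[OF n n0, of "axis i 1"] by (simp add: dp_axis)
      also have "cwidth i h \<le> cwidth i f" using width_dvd[OF h(2), of "axis i 1"] f0 by simp
      finally have "\<bar>(n - n0) $ i\<bar> \<le> int (cwidth i f)" by simp
      moreover have "int (W + 1) * \<bar>v $ i\<bar> \<le> int N" using p[of i] by (simp add: v_def)
      ultimately show "int (W + 1) * \<bar>v $ i\<bar> * \<bar>(n - n0) $ i\<bar> \<le> int N * int (cwidth i f)"
        by (intro mult_mono) auto
    qed
    also have "\<dots> = int N * int (total_width f)" by (simp add: total_width_def sum_distrib_left)
    also have "\<dots> \<le> int N * int W" using W by (intro mult_left_mono) auto
    finally have "int (W + 1) * int N \<le> int N * int W" by simp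
    then show False using z(2) by (simp add: algebra_simps)
  qed
  have "euler v h = sg 0 (of_int (dp v n0)) * h"
  proof (rule laurent_eqI)
    fix n show "cf (euler v h) n = cf (sg 0 (of_int (dp v n0)) * h) n"
      using dv[of n] by (cases "n \<in> supp h") (auto simp: cf_euler cf_sg_mult in_keys_iff simp del: single_of_int)
  qed
  then have hd: "h dvd euler v h" by simp
  obtain s where s: "to_complex f = h * s" using h(2) by (rule dvdE)
  have "h dvd euler v (h * s)" unfolding euler_mult using hd by (intro dvd_add dvd_mult2) auto
  then have "h dvd to_complex (euler v f)" by (simp add: s flip: euler_to_complex)
  then have "f dvd euler v f" by (rule common_complex_factor_imp_dvd[OF f(1) h])
  then obtain t where "euler v f = f * t" by (rule dvdE)
  then have D0: "euler v f = 0" by (rule euler_multiple[OF f(2)])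
  have "dp v n = 0" if n: "n \<in> supp f" for n
  proof -
    have "cf (euler v f) n = 0" unfolding D0 by simp
    then show ?thesis using n by (simp add: cf_euler in_keys_iff)
  qed
  then have "v = 0" using rank by blast
  then show False using \<open>v \<noteq> 0\<close> by blast
qed

text \<open>Each irreducible factor over \<open>C\<close> has positive total width.\<close>

lemma few_irreducible_factors:
  fixes G :: "('d::finite, complex) laurent"
  assumes "G \<noteq> 0"
  shows "\<exists>Hs. finite Hs \<and> card Hs \<le> total_width G \<and>
    (\<forall>q. irreducible q \<longrightarrow> q dvd G \<longrightarrow> (\<exists>h\<in>Hs. \<exists>u. u dvd 1 \<and> q = u * h))"
  using assms
proof (induction rule: factor_induct)
  case (unit u)
  have "\<not> irreducible q" if "q dvd u" for q
    using dvd_trans[OF that unit] by (simp add: irreducible_def)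
  then show ?case by (intro exI[of _ "{}"]) auto
next
  case (mult p c)
  have p0: "p \<noteq> 0" "\<not> p dvd 1" using mult.hyps(1) by (auto simp: irreducible_def)
  obtain Hs where Hs: "finite Hs" "card Hs \<le> total_width c"
    "\<And>q. irreducible q \<Longrightarrow> q dvd c \<Longrightarrow> \<exists>h\<in>Hs. \<exists>u. u dvd 1 \<and> q = u * h"
    using mult.IH by meson
  obtain i where "cwidth i p > 0" using nonunit_complex_cwidth[OF p0] by blast
  then have "total_width p \<noteq> 0" unfolding total_width_eq_0 by force
  then have "card (insert p Hs) \<le> total_width (p * c)"
    using Hs(1,2) p0(1) mult.hyps(2) by (simp add: total_width_mult card_insert_if)
  moreover have "\<exists>h\<in>insert p Hs. \<exists>u. u dvd 1 \<and> q = u * h" if q: "irreducible q" "q dvd p * c" for q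
  proof (cases "q dvd c")
    case True
    then show ?thesis using Hs(3)[OF q(1)] by blast
  next
    case False
    then have "q dvd p" using laurent_irreducible_dvd_mult[OF q] by blast
    then obtain v where v: "v dvd 1" "p = v * q"
      using irreducible_dvd_irreducible[OF mult.hyps(1) q(1)] by blast
    obtain w where w: "1 = v * w" using v(1) by (rule dvdE)
    have "q = (v * w) * q" by (simp flip: w)
    then have "q = w * p" unfolding v(2) by (simp only: mult_ac)
    moreover have "w dvd 1" using w by (metis dvd_triv_right)
    ultimately show ?thesis by blast
  qed
  ultimately show ?case using Hs(1) by (intro exI[of _ "insert p Hs"]) auto
qed

lemma rescale_cancel:
  assumes "\<And>i. z i \<noteq> 0"
  shows "rescale (\<lambda>i. inverse (z i)) (rescale z f) = f" "rescale z (rescale (\<lambda>i. inverse (z i)) f) = f"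
  using assms by (simp_all add: rescale_rescale)

lemma irreducible_rescale:
  assumes z: "\<And>i. z i \<noteq> 0" and h: "irreducible h"
  shows "irreducible (rescale z h)"
proof -
  define y where "y = (\<lambda>i. inverse (z i))"
  have y: "\<And>i. y i \<noteq> 0" using z by (simp add: y_def)
  note Z = ring_mapD[OF ring_map_rescale[of z, OF z]] and Y = ring_mapD[OF ring_map_rescale[of y, OF y]]
  have c: "rescale y (rescale z f) = f" "rescale z (rescale y f) = f" for f
    unfolding y_def by (rule rescale_cancel[of z, OF z])+
  show ?thesis
  proof (rule irreducibleI)
    show "rescale z h \<noteq> 0" using h by (metis c(1) Y(2) irreducible_def)
    show "\<not> rescale z h dvd 1"
      using h ring_map_dvd[OF ring_map_rescale[of y, OF y], of "rescale z h" 1]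
      by (auto simp: c Y irreducible_def)
  next
    fix a b assume "rescale z h = a * b"
    then have "h = rescale y a * rescale y b" by (metis c(1) Y(4))
    then have "rescale y a dvd 1 \<or> rescale y b dvd 1" using h unfolding irreducible_def by blast
    then show "a dvd 1 \<or> b dvd 1"
      using ring_map_dvd[OF ring_map_rescale[of z, OF z], of "rescale y a" 1]
        ring_map_dvd[OF ring_map_rescale[of z, OF z], of "rescale y b" 1] by (auto simp: c Z)
  qed
qed

text \<open>
For each \<open>a\<close> from \<open>1\<close> to \<open>W^2 + 1\<close> there is a pair of irreducible factors of \<open>f\<close>, the second of which
becomes the first by the rotation by \<open>z^(a k)\<close>.  There are at most \<open>W^2\<close> pairs up to units, so two values
\<open>a < b\<close> belong to the same pair, and the rotation by \<open>z^((b - a) k)\<close> fixes a factor up to a unit.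
\<close>

lemma no_common_factor_with_rotation:
  fixes f :: "('d::finite, int) laurent" and h :: "('d, complex) laurent"
  assumes f: "irreducible f" "0 \<in> supp f" and rank: "\<And>v. (\<forall>n\<in>supp f. dp v n = 0) \<Longrightarrow> v = 0"
    and W: "total_width f \<le> W" and N: "primitive N z"
    and cop: "\<And>a. 0 < a \<Longrightarrow> a \<le> max (W ^ 2 + 1) ((W + 1) ^ CARD('d)) \<Longrightarrow> coprime a N"
    and h: "\<not> h dvd 1" "h dvd to_complex f" "h dvd rescale (\<lambda>i. z ^ k i) (to_complex f)"
  shows "int N dvd int (k i)"
proof -
  define F where "F = to_complex f"
  define R where "R a = rescale (\<lambda>i. z ^ (a * k i))" for a :: nat
  define R' where "R' a = rescale (\<lambda>i. inverse (z ^ (a * k i)))" for a :: nat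
  have z: "z ^ N = 1" "N \<ge> 1" using N by (auto simp: primitive_def)
  have z0: "z \<noteq> 0" using z by (auto simp: power_0_left)
  have f0: "f \<noteq> 0" using f by (simp add: irreducible_def)
  have F0: "F \<noteq> 0" using f0 by (simp add: F_def)
  have homR: "ring_map (R a)" and homR': "ring_map (R' a)" for a
    unfolding R_def R'_def using z0 by (auto intro!: ring_map_rescale)
  have RR': "R a (R' a g) = g" "R' a (R a g) = g" for a g
    unfolding R_def R'_def using z0 by (auto intro!: rescale_cancel)
  have "\<exists>h'. irreducible h' \<and> h' dvd F \<and> h' dvd R a F" if a: "a \<in> {1..W ^ 2 + 1}" for a
  proof -
    have "a > 0" "coprime a N" using a cop[of a] by auto
    from conjugate_common_factor[OF z this(2,1) f0 h] show ?thesis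
      by (simp add: F_def R_def power_mult)
  qed
  then obtain H where H: "\<And>a. a \<in> {1..W ^ 2 + 1} \<Longrightarrow> irreducible (H a) \<and> H a dvd F \<and> H a dvd R a F"
    by metis
  \<comment> \<open>the factor of \<open>f\<close> which the rotation takes to \<open>H a\<close>\<close>
  define Y where "Y a = R' a (H a)" for a
  have Y: "irreducible (Y a)" "Y a dvd F" "R a (Y a) = H a" if "a \<in> {1..W ^ 2 + 1}" for a
  proof -
    show "irreducible (Y a)"
      unfolding Y_def R'_def using H[OF that] z0 by (intro irreducible_rescale) auto
    have "R' a (H a) dvd R' a (R a F)" using H[OF that] by (intro ring_map_dvd[OF homR']) auto
    then show "Y a dvd F" by (simp add: Y_def RR')
    show "R a (Y a) = H a" by (simp add: Y_def RR')
  qed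
  obtain Hs where Hs: "finite Hs" "card Hs \<le> total_width F"
    "\<And>q. irreducible q \<Longrightarrow> q dvd F \<Longrightarrow> \<exists>h\<in>Hs. \<exists>u. u dvd 1 \<and> q = u * h"
    using few_irreducible_factors[OF F0] by meson
  have "total_width F = total_width f" by (simp add: total_width_def F_def)
  then have cardHs: "card (Hs \<times> Hs) \<le> W ^ 2"
    using Hs(2) W by (simp add: card_cartesian_product power2_eq_square mult_mono)
  have "\<exists>x. x \<in> Hs \<and> (\<exists>u. u dvd 1 \<and> H a = u * x)" if "a \<in> {1..W ^ 2 + 1}" for a
    using Hs(3)[of "H a"] H[OF that] by blast
  then obtain X where X: "\<And>a. a \<in> {1..W ^ 2 + 1} \<Longrightarrow> X a \<in> Hs \<and> (\<exists>u. u dvd 1 \<and> H a = u * X a)" by metis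
  have "\<exists>x. x \<in> Hs \<and> (\<exists>u. u dvd 1 \<and> Y a = u * x)" if "a \<in> {1..W ^ 2 + 1}" for a
    using Hs(3)[of "Y a"] Y[OF that] by blast
  then obtain X' where X': "\<And>a. a \<in> {1..W ^ 2 + 1} \<Longrightarrow> X' a \<in> Hs \<and> (\<exists>u. u dvd 1 \<and> Y a = u * X' a)" by metis
  have "\<not> inj_on (\<lambda>a. (X a, X' a)) {1..W ^ 2 + 1}"
  proof
    assume "inj_on (\<lambda>a. (X a, X' a)) {1..W ^ 2 + 1}"
    then have "card {1..W ^ 2 + 1} \<le> card (Hs \<times> Hs)"
      using X X' Hs(1) by (intro card_inj_on_le) auto
    then show False using cardHs by simp
  qed
  then have "\<exists>a b. a \<in> {1..W ^ 2 + 1} \<and> b \<in> {1..W ^ 2 + 1} \<and> a < b \<and> X a = X b \<and> X' a = X' b"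
    unfolding inj_on_def by (metis Pair_inject linorder_neqE_nat)
  then obtain a b where ab: "a \<in> {1..W ^ 2 + 1}" "b \<in> {1..W ^ 2 + 1}" "a < b"
    and eq: "X a = X b" "X' a = X' b" by (elim exE conjE)
  have assoc: "\<exists>u. u dvd 1 \<and> q = u * p" if pq: "\<exists>u. u dvd 1 \<and> p = u * x" "\<exists>u. u dvd 1 \<and> q = u * x"
    for p q x :: "('d, complex) laurent"
  proof -
    obtain s where s: "s dvd 1" "p = s * x" using pq(1) by (elim exE conjE)
    obtain t where t: "t dvd 1" "q = t * x" using pq(2) by (elim exE conjE)
    obtain s' where s': "1 = s * s'" using s(1) by (rule dvdE)
    have "x = (s * s') * x" by (simp flip: s')
    then have "x = s' * p" unfolding s(2) by (simp only: mult_ac)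
    then have "q = (t * s') * p" using t(2) by (simp add: mult.assoc)
    moreover have "s' dvd 1" using s' by (metis dvd_triv_right)
    then have "t * s' dvd 1" using t(1) by (metis mult_dvd_mono mult_1)
    ultimately show ?thesis by blast
  qed
  have "\<exists>u. u dvd 1 \<and> H b = u * H a"
    using assoc[of "H a" "X a" "H b"] X[OF ab(1)] X[OF ab(2)] eq(1) by simp
  then obtain u1 where u1: "u1 dvd 1" "H b = u1 * H a" by (elim exE conjE)
  have "\<exists>u. u dvd 1 \<and> Y a = u * Y b"
    using assoc[of "Y b" "X' b" "Y a"] X'[OF ab(1)] X'[OF ab(2)] eq(2) by simp
  then obtain u2 where u2: "u2 dvd 1" "Y a = u2 * Y b" by (elim exE conjE)
  define u where "u = R' a (R b u2 * u1)"
  have "R b (Y a) = R b u2 * (u1 * R a (Y a))"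
    using u1(2) Y(3)[OF ab(1)] Y(3)[OF ab(2)] by (simp add: u2(2) ring_mapD(4)[OF homR])
  then have "R' a (R b (Y a)) = R' a (R b u2 * u1 * R a (Y a))" by (simp add: mult.assoc)
  then have "R' a (R b (Y a)) = u * Y a"
    by (simp add: u_def ring_mapD(4)[OF homR'] RR')
  moreover have "R' a (R b g) = rescale (\<lambda>i. z ^ ((b - a) * k i)) g" for g
  proof -
    have "inverse (z ^ (a * k i)) * z ^ (b * k i) = z ^ ((b - a) * k i)" for i
    proof -
      have "z ^ (b * k i) = z ^ (a * k i) * z ^ ((b - a) * k i)"
        using ab(3) by (simp add: algebra_simps flip: power_add)
      then show ?thesis using z0 by simp
    qed
    then show ?thesis by (simp add: R_def R'_def rescale_rescale)
  qed
  ultimately have rot: "rescale (\<lambda>i. z ^ ((b - a) * k i)) (Y a) = u * Y a" by simp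
  have "R b u2 dvd 1" using ring_map_dvd[OF homR u2(1), of b] by (simp add: ring_mapD(1)[OF homR])
  then have "R b u2 * u1 dvd 1" using u1(1) by (metis mult_dvd_mono mult_1)
  then have u: "u dvd 1"
    unfolding u_def using ring_map_dvd[OF homR', of "R b u2 * u1" 1 a] by (simp add: ring_mapD(1)[OF homR'])
  have "int N dvd int ((b - a) * k i)"
  proof (rule rotation_stabilizer_trivial[OF f rank W N _ _ _ u rot])
    fix a assume "0 < a" "a \<le> (W + 1) ^ CARD('d)"
    then show "coprime a N" by (intro cop) auto
  next
    show "\<not> Y a dvd 1" using Y(1)[OF ab(1)] by (simp add: irreducible_def)
    show "Y a dvd to_complex f" using Y(2)[OF ab(1)] by (simp add: F_def)
  qed
  then have "N dvd (b - a) * k i" by (simp only: int_dvd_int_iff)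
  moreover have "coprime (b - a) N" using ab by (intro cop) auto
  ultimately show ?thesis by (simp add: coprime_dvd_mult_right_iff coprime_commute)
qed

text \<open>
If \<open>f^2\<close> divides the decimation, then an irreducible complex factor of \<open>f\<close> divides one of the nontrivial rotations
of \<open>f\<close>.
\<close>

lemma decimation_multiplicity_one:
  fixes f :: "('d::finite, int) laurent"
  assumes f: "irreducible f" "0 \<in> supp f" and rank: "\<And>v. (\<forall>n\<in>supp f. dp v n = 0) \<Longrightarrow> v = 0"
    and W: "total_width f \<le> W" and N: "N \<ge> 1"
    and cop: "\<And>a. 0 < a \<Longrightarrow> a \<le> max (W ^ 2 + 1) ((W + 1) ^ CARD('d)) \<Longrightarrow> coprime a N"
    and dvd: "to_complex f ^ e dvd decimation N f"
  shows "e \<le> 1"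
proof (rule ccontr)
  assume "\<not> e \<le> 1"
  then have e2: "to_complex f ^ 2 dvd to_complex f ^ e" by (intro le_imp_power_dvd) simp
  define F where "F = to_complex f"
  obtain z where p: "primitive N z" using primitive_exp[OF N] by blast
  have f0: "f \<noteq> 0" using f by (simp add: irreducible_def)
  have F0: "F \<noteq> 0" using f0 by (simp add: F_def)
  have F1: "\<not> F dvd 1"
  proof
    assume "F dvd 1"
    then obtain n c where nc: "c dvd 1" "F = sg n c" unfolding unit_iff_monomial by blast
    have "c \<noteq> 0" using nc(1) by auto
    then have "supp F = {n}" using nc(2) by simp
    then have "supp f = {n}" by (simp only: F_def supp_to_complex)
    then have "supp f = {0}" using f(2) by auto
    \<comment> \<open>any coordinate functional contradicts the rank condition\<close>
    then have "axis undefined 1 = (0 :: int ^ 'd)" by (intro rank) (simp add: dp_simps)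
    then have "axis undefined 1 $ undefined = (0 :: int ^ 'd) $ undefined" by simp
    then show False by (simp add: axis_def)
  qed
  define P where "P = (\<Prod>\<rho>\<in>Omega N UNIV - {\<lambda>_. 1}. rescale \<rho> F)"
  have "decimation N f = F * P"
    unfolding decimation_eq_dec[OF N] dec_def P_def F_def
    by (subst prod.remove[OF finite_Omega[OF N] one_in_Omega]) simp
  then have "F * F dvd F * P" using dvd e2 by (simp add: F_def power2_eq_square) (meson dvd_trans)
  then have "F dvd P" unfolding laurent_dvd_mult_cancel[OF F0] .
  obtain h where h: "irreducible h" "h dvd F" using irreducible_factor_exists[OF F0 F1] by blast
  have "h dvd P" using h(2) \<open>F dvd P\<close> by (rule dvd_trans)
  then obtain \<rho> where \<rho>: "\<rho> \<in> Omega N UNIV - {\<lambda>_. 1}" "h dvd rescale \<rho> F"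
    using irreducible_dvd_prod[OF h(1) _ , of "Omega N UNIV - {\<lambda>_. 1}"] finite_Omega[OF N, of UNIV]
    unfolding P_def by blast
  have "\<forall>i. \<exists>k. \<rho> i = z ^ k"
    using \<rho>(1) primitive_bij[OF p] by (auto simp: Omega_def bij_betw_def image_iff set_eq_iff)
  then obtain k where k: "\<And>i. \<rho> i = z ^ k i" by metis
  then have \<rho>k: "\<rho> = (\<lambda>i. z ^ k i)" by auto
  have "int N dvd int (k i)" for i
    using no_common_factor_with_rotation[OF f rank W p cop, of h k i] h \<rho>(2)
    by (simp add: F_def \<rho>k irreducible_def)
  then have "\<rho> i = 1" for i using k primitive_pow_eq_1[OF p, of "k i"] by simp
  then show False using \<rho>(1) by auto
qed

text \<open>The multiples of a vector \<open>v\<close> orthogonal to the group lie in different cosets.\<close>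

lemma finite_index_imp_full_rank:
  fixes G :: "(int ^ 'd::finite) set"
  assumes "finite_index (group_closure G)" and v: "\<forall>n\<in>G. dp v n = 0"
  shows "v = 0"
proof (rule ccontr)
  assume "v \<noteq> 0"
  then have vv: "dp v v > 0" by (rule dp_self)
  define E where "E = {(x, y). x - y \<in> group_closure G}"
  \<comment> \<open>the functional \<open>v\<close> vanishes on the group\<close>
  have cl: "dp v x = 0" if "x \<in> group_closure G" for x
    using that by induction (auto simp: dp_simps v)
  have "inj (\<lambda>k :: int. E `` {k *s v})"
  proof (rule injI)
    fix k l assume "E `` {k *s v} = E `` {l *s v}"
    moreover have "l *s v \<in> E `` {l *s v}" by (auto simp: E_def intro: group_closure.intros)
    ultimately have "k *s v - l *s v \<in> group_closure G" by (auto simp: E_def)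
    from cl[OF this] have "k * dp v v = l * dp v v" by (simp add: dp_simps dp_scale)
    then show "k = l" using vv by simp
  qed
  moreover have "Set.range (\<lambda>k :: int. E `` {k *s v}) \<subseteq> UNIV // E" by (auto simp: quotient_def)
  ultimately have "finite (UNIV :: int set)"
    using assms(1) unfolding finite_index_def E_def[symmetric] by (meson finite_imageD finite_subset)
  then show False by simp
qed

section \<open>Computable functions\<close>

text \<open>
Total computable functions of one and of two arguments.  Functions of more arguments are reduced to
these by pairing.
\<close>

definition rec1 :: "(nat \<Rightarrow> nat) \<Rightarrow> bool" where
  "rec1 f \<longleftrightarrow> (\<exists>P. \<forall>n. computes P [n] (f n))"

definition rec2 :: "(nat \<Rightarrow> nat \<Rightarrow> nat) \<Rightarrow> bool" where
  "rec2 f \<longleftrightarrow> (\<exists>P. \<forall>m n. computes P [m, n] (f m n))"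

lemma computes_Comp1: "computes G xs y \<Longrightarrow> computes F [y] z \<Longrightarrow> computes (Comp F [G]) xs z"
  by (rule computes.comp[of xs "[G]" "[y]"]) auto

lemma computes_Comp2:
  "computes G xs y \<Longrightarrow> computes H xs y' \<Longrightarrow> computes F [y, y'] z \<Longrightarrow> computes (Comp F [G, H]) xs z"
  by (rule computes.comp[of xs "[G, H]" "[y, y']"]) auto

lemma computes_Proj: "i < length xs \<Longrightarrow> y = xs ! i \<Longrightarrow> computes (Proj i) xs y"
  by (simp add: computes.proj)

lemma rec1_id: "rec1 (\<lambda>n. n)"
  unfolding rec1_def by (intro exI[of _ "Proj 0"] allI computes_Proj) auto

lemma rec1_comp:
  assumes "rec1 f" "rec1 g"
  shows "rec1 (\<lambda>n. f (g n))"
proof -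
  obtain F where F: "\<And>n. computes F [n] (f n)" using assms(1) unfolding rec1_def by blast
  obtain G where G: "\<And>n. computes G [n] (g n)" using assms(2) unfolding rec1_def by blast
  show ?thesis unfolding rec1_def by (intro exI[of _ "Comp F [G]"] allI computes_Comp1[OF G F])
qed

lemma rec2_app:
  assumes "rec2 h" "rec1 f" "rec1 g"
  shows "rec1 (\<lambda>n. h (f n) (g n))"
proof -
  obtain H where H: "\<And>m n. computes H [m, n] (h m n)" using assms(1) unfolding rec2_def by blast
  obtain F where F: "\<And>n. computes F [n] (f n)" using assms(2) unfolding rec1_def by blast
  obtain G where G: "\<And>n. computes G [n] (g n)" using assms(3) unfolding rec1_def by blast
  show ?thesis unfolding rec1_def by (intro exI[of _ "Comp H [F, G]"] allI computes_Comp2[OF F G H])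
qed

lemma rec1_app2:
  assumes "rec1 f" "rec2 g"
  shows "rec2 (\<lambda>m n. f (g m n))"
proof -
  obtain F where F: "\<And>n. computes F [n] (f n)" using assms(1) unfolding rec1_def by blast
  obtain G where G: "\<And>m n. computes G [m, n] (g m n)" using assms(2) unfolding rec2_def by blast
  show ?thesis unfolding rec2_def by (intro exI[of _ "Comp F [G]"] allI computes_Comp1[OF G F])
qed

lemma rec2_app2:
  assumes "rec2 h" "rec2 f" "rec2 g"
  shows "rec2 (\<lambda>m n. h (f m n) (g m n))"
proof -
  obtain H where H: "\<And>m n. computes H [m, n] (h m n)" using assms(1) unfolding rec2_def by blast
  obtain F where F: "\<And>m n. computes F [m, n] (f m n)" using assms(2) unfolding rec2_def by blast
  obtain G where G: "\<And>m n. computes G [m, n] (g m n)" using assms(3) unfolding rec2_def by blast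
  show ?thesis unfolding rec2_def by (intro exI[of _ "Comp H [F, G]"] allI computes_Comp2[OF F G H])
qed

lemma rec2_fst: "rec2 (\<lambda>m n. m)"
  unfolding rec2_def by (intro exI[of _ "Proj 0"] allI computes_Proj) auto

lemma rec2_snd: "rec2 (\<lambda>m n. n)"
  unfolding rec2_def by (intro exI[of _ "Proj 1"] allI computes_Proj) auto

lemma rec1_Suc: "rec1 Suc"
  unfolding rec1_def by (intro exI[of _ Succ] allI computes.succ)

lemma rec1_0: "rec1 (\<lambda>n. 0)"
  unfolding rec1_def by (intro exI[of _ Zero] allI computes.zero)

lemma rec1_const: "rec1 (\<lambda>n. c)"
  by (induction c) (auto intro: rec1_0 rec1_comp[OF rec1_Suc])

lemma rec1_primrec:
  assumes "rec2 s"
  shows "rec1 (\<lambda>n. rec_nat c s n)"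
proof -
  obtain S where S: "\<And>m n. computes S [m, n] (s m n)" using assms unfolding rec2_def by blast
  have base: "\<exists>P. \<forall>xs. computes P xs c"
  proof (induction c)
    case 0
    show ?case by (intro exI[of _ Zero] allI computes.zero)
  next
    case (Suc c)
    then obtain P where P: "\<And>xs. computes P xs c" by blast
    show ?case by (intro exI[of _ "Comp Succ [P]"] allI computes_Comp1[OF P computes.succ])
  qed
  then obtain B where B: "\<And>xs. computes B xs c" by blast
  have "computes (PrimRec B S) [n] (rec_nat c s n)" for n
    by (induction n) (auto intro: computes.rec_0 computes.rec_Suc B S)
  then show ?thesis unfolding rec1_def by blast
qed

text \<open>Primitive recursion with a parameter \<open>n\<close>, for steps that ignore the counter.\<close>

lemma rec2_iterate:
  assumes "rec2 s" "rec1 g"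
  shows "rec2 (\<lambda>k n. ((\<lambda>y. s y n) ^^ k) (g n))"
proof -
  obtain S where S: "\<And>m n. computes S [m, n] (s m n)" using assms unfolding rec2_def by blast
  obtain G where G: "\<And>n. computes G [n] (g n)" using assms unfolding rec1_def by blast
  have "computes (PrimRec G (Comp S [Proj 1, Proj 2])) [k, n] (((\<lambda>y. s y n) ^^ k) (g n))" for k n
  proof (induction k)
    case 0
    show ?case by (simp add: computes.rec_0 G)
  next
    case (Suc k)
    have "computes (Comp S [Proj 1, Proj 2]) [k, ((\<lambda>y. s y n) ^^ k) (g n), n] (s (((\<lambda>y. s y n) ^^ k) (g n)) n)"
      by (rule computes_Comp2[OF computes_Proj computes_Proj S]) auto
    with Suc show ?case by (simp add: computes.rec_Suc)
  qed
  then show ?thesis unfolding rec2_def by blast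
qed

lemma rec2_add: "rec2 (+)"
proof -
  have "((\<lambda>y. Suc y) ^^ k) n = k + n" for k n by (induction k) auto
  then show ?thesis using rec2_iterate[OF rec1_app2[OF rec1_Suc rec2_fst] rec1_id] by simp
qed

lemma rec2_mult: "rec2 (*)"
proof -
  have "((\<lambda>y. y + n) ^^ k) 0 = k * n" for k n by (induction k) auto
  then show ?thesis using rec2_iterate[OF rec2_add rec1_0] by simp
qed

lemma rec1_pred: "rec1 (\<lambda>n. n - 1)"
proof -
  have "rec_nat 0 (\<lambda>k y. k) n = n - 1" for n by (cases n) auto
  then show ?thesis using rec1_primrec[OF rec2_fst, of 0] by simp
qed

lemma rec2_diff: "rec2 (-)"
proof -
  \<comment> \<open>the minuend is the parameter of the recursion, so the arguments are swapped\<close>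
  have "((\<lambda>y. y - 1) ^^ k) n = n - k" for k n :: nat by (induction k) auto
  then have "rec2 (\<lambda>k n. n - k)" using rec2_iterate[OF rec1_app2[OF rec1_pred rec2_fst] rec1_id] by simp
  from rec2_app2[OF this rec2_snd rec2_fst] show ?thesis by simp
qed

lemmas rec1_add = rec2_app[OF rec2_add] and rec1_mult = rec2_app[OF rec2_mult]
  and rec1_diff = rec2_app[OF rec2_diff] and rec1_suc = rec1_comp[OF rec1_Suc]

lemma rec1_mu:
  assumes "rec2 h" "\<And>n. \<exists>m. h m n = 0"
  shows "rec1 (\<lambda>n. LEAST m. h m n = 0)"
proof -
  obtain H where H: "\<And>m n. computes H [m, n] (h m n)" using assms unfolding rec2_def by blast
  have "computes (Mu H) [n] (LEAST m. h m n = 0)" for n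
  proof (rule computes.mu)
    show "computes H [LEAST m. h m n = 0, n] 0"
      using H[of "LEAST m. h m n = 0" n] LeastI_ex[OF assms(2)[of n]] by simp
    fix m assume "m < (LEAST m. h m n = 0)"
    then have "h m n \<noteq> 0" by (rule not_less_Least)
    then show "\<exists>y>0. computes H [m, n] y" using H[of m n] by blast
  qed
  then show ?thesis unfolding rec1_def by blast
qed

lemma rec1_triangle: "rec1 triangle"
proof -
  have "rec_nat 0 (\<lambda>k y. Suc k + y) n = triangle n" for n by (induction n) auto
  then show ?thesis
    using rec1_primrec[OF rec2_app2[OF rec2_add rec1_app2[OF rec1_Suc rec2_fst] rec2_snd], of 0] by simp
qed

abbreviation pr :: "nat \<Rightarrow> nat \<Rightarrow> nat" where "pr m n \<equiv> prod_encode (m, n)"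
abbreviation p1 :: "nat \<Rightarrow> nat" where "p1 n \<equiv> fst (prod_decode n)"
abbreviation p2 :: "nat \<Rightarrow> nat" where "p2 n \<equiv> snd (prod_decode n)"

lemma rec2_pr: "rec2 pr"
  unfolding prod_encode_def
  using rec2_app2[OF rec2_add rec1_app2[OF rec1_triangle rec2_add] rec2_fst] by simp

lemmas rec1_pr = rec2_app[OF rec2_pr]

lemma triangle_mono: "m \<le> n \<Longrightarrow> triangle m \<le> triangle n"
  by (induction n) (auto simp: le_Suc_eq)

lemma triangle_p1_p2: "triangle (p1 n + p2 n) + p1 n = n"
proof -
  have "triangle (p1 n + p2 n) + p1 n = pr (p1 n) (p2 n)"
    by (simp only: prod_encode_def case_prod_conv)
  then show ?thesis by simp
qed

text \<open>The diagonal on which the pair with code \<open>n\<close> lies, as a result of a search.\<close>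

lemma triangle_root: "(LEAST k. Suc n - triangle (Suc k) = 0) = p1 n + p2 n"
proof (rule Least_equality)
  show "Suc n - triangle (Suc (p1 n + p2 n)) = 0"
    using triangle_p1_p2[of n] by simp
next
  fix k assume *: "Suc n - triangle (Suc k) = 0"
  show "p1 n + p2 n \<le> k"
  proof (rule ccontr)
    assume "\<not> p1 n + p2 n \<le> k"
    then have "triangle (Suc k) \<le> triangle (p1 n + p2 n)" by (intro triangle_mono) simp
    then have "triangle (Suc k) \<le> n" using triangle_p1_p2[of n] by linarith
    then show False using * by linarith
  qed
qed

lemma rec1_root: "rec1 (\<lambda>n. p1 n + p2 n)"
proof -
  have "rec2 (\<lambda>k n. Suc n - triangle (Suc k))"
    by (rule rec2_app2[OF rec2_diff rec1_app2[OF rec1_Suc rec2_snd]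
        rec1_app2[OF rec1_triangle rec1_app2[OF rec1_Suc rec2_fst]]])
  moreover have "\<exists>k. Suc n - triangle (Suc k) = 0" for n by (intro exI[of _ n]) simp
  ultimately have "rec1 (\<lambda>n. LEAST k. Suc n - triangle (Suc k) = 0)" by (rule rec1_mu)
  then show ?thesis unfolding triangle_root .
qed

lemma p1_eq: "n - triangle (p1 n + p2 n) = p1 n"
  using triangle_p1_p2[of n] by linarith

lemma rec1_fst_decode: "rec1 p1"
proof -
  have "rec1 (\<lambda>n. n - triangle (p1 n + p2 n))"
    by (intro rec1_diff rec1_id rec1_comp[OF rec1_triangle rec1_root])
  then show ?thesis unfolding p1_eq .
qed

lemma rec1_snd_decode: "rec1 p2"
proof -
  have "rec1 (\<lambda>n. (p1 n + p2 n) - p1 n)" by (intro rec1_diff rec1_root rec1_fst_decode)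
  then show ?thesis by simp
qed

lemmas rec1_p1 = rec1_comp[OF rec1_fst_decode] and rec1_p2 = rec1_comp[OF rec1_snd_decode]

lemma rec2_iff_rec1: "rec2 h \<longleftrightarrow> rec1 (\<lambda>n. h (p1 n) (p2 n))"
proof
  assume "rec2 h"
  then show "rec1 (\<lambda>n. h (p1 n) (p2 n))" by (rule rec2_app[OF _ rec1_fst_decode rec1_snd_decode])
next
  assume "rec1 (\<lambda>n. h (p1 n) (p2 n))"
  from rec1_app2[OF this rec2_pr] show "rec2 h" by simp
qed

text \<open>Primitive recursion with a parameter: the counter is carried along as the first component of a pair.\<close>

lemma rec1_rec_nat:
  assumes s: "rec1 (\<lambda>m. s (p1 m) (p1 (p2 m)) (p2 (p2 m)))" and g: "rec1 g" and f: "rec1 f"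
  shows "rec1 (\<lambda>n. rec_nat (g n) (s n) (f n))"
proof -
  define t where "t y n = pr (Suc (p1 y)) (s n (p1 y) (p2 y))" for y n
  have "rec1 (\<lambda>m. pr (p2 m) (p1 m))" by (intro rec1_pr rec1_p1 rec1_p2 rec1_id)
  from rec1_comp[OF s this] have "rec1 (\<lambda>m. s (p2 m) (p1 (p1 m)) (p2 (p1 m)))" by simp
  then have "rec1 (\<lambda>m. t (p1 m) (p2 m))"
    unfolding t_def by (intro rec1_pr rec1_suc rec1_p1 rec1_id)
  then have "rec2 t" by (simp add: rec2_iff_rec1)
  then have it: "rec2 (\<lambda>k n. ((\<lambda>y. t y n) ^^ k) (pr 0 (g n)))"
    by (intro rec2_iterate rec1_pr rec1_const g)
  have "((\<lambda>y. t y n) ^^ k) (pr 0 (g n)) = pr k (rec_nat (g n) (s n) k)" for k n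
    by (induction k) (auto simp: t_def)
  with it have "rec2 (\<lambda>k n. pr k (rec_nat (g n) (s n) k))" by simp
  from rec1_p2[OF rec2_app[OF this f rec1_id]] show ?thesis by simp
qed

section \<open>Decidable predicates\<close>

definition decid :: "(nat \<Rightarrow> bool) \<Rightarrow> bool" where
  "decid P \<longleftrightarrow> rec1 (\<lambda>n. if P n then 1 else 0)"

lemma rec1_if:
  assumes "decid P" "rec1 f" "rec1 g"
  shows "rec1 (\<lambda>n. if P n then f n else g n)"
proof -
  have "rec1 (\<lambda>n. (if P n then 1 else 0) * f n + (1 - (if P n then 1 else 0)) * g n)"
    using assms unfolding decid_def by (intro rec1_add rec1_mult rec1_diff rec1_const)
  moreover have "(if P n then 1 else 0) * f n + (1 - (if P n then 1 else 0)) * g n = (if P n then f n else g n)" for n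
    by simp
  ultimately show ?thesis by simp
qed

lemma decid_zero: "rec1 f \<Longrightarrow> decid (\<lambda>n. f n = 0)"
proof -
  assume "rec1 f"
  then have "rec1 (\<lambda>n. 1 - f n)" by (intro rec1_diff rec1_const)
  moreover have "1 - f n = (if f n = 0 then 1 else 0)" for n by simp
  ultimately show ?thesis by (simp add: decid_def)
qed

lemma decid_le: "rec1 f \<Longrightarrow> rec1 g \<Longrightarrow> decid (\<lambda>n. f n \<le> g n)"
  using decid_zero[OF rec1_diff[of f g]] by simp

lemma decid_comp: "decid P \<Longrightarrow> rec1 f \<Longrightarrow> decid (\<lambda>n. P (f n))"
  unfolding decid_def by (rule rec1_comp)

lemma decid_not:
  assumes "decid P"
  shows "decid (\<lambda>n. \<not> P n)"
proof -
  have "rec1 (\<lambda>n. if P n then 0 else 1)" using assms by (intro rec1_if rec1_const)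
  moreover have "(if P n then 0 else 1) = (if \<not> P n then 1 else (0 :: nat))" for n by simp
  ultimately show ?thesis by (simp add: decid_def)
qed

lemma decid_and: "decid P \<Longrightarrow> decid Q \<Longrightarrow> decid (\<lambda>n. P n \<and> Q n)"
proof -
  assume "decid P" "decid Q"
  then have "rec1 (\<lambda>n. if P n then (if Q n then 1 else 0) else 0)"
    by (intro rec1_if rec1_const)
  moreover have "(if P n then (if Q n then 1 else 0) else 0) = (if P n \<and> Q n then 1 else (0::nat))" for n by simp
  ultimately show ?thesis by (simp add: decid_def)
qed

lemma decid_or: "decid P \<Longrightarrow> decid Q \<Longrightarrow> decid (\<lambda>n. P n \<or> Q n)"
  using decid_not[OF decid_and[OF decid_not decid_not], of P Q] by simp

lemma decid_eq: "rec1 f \<Longrightarrow> rec1 g \<Longrightarrow> decid (\<lambda>n. f n = g n)"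
  using decid_and[OF decid_le[of f g] decid_le[of g f]] by (simp add: eq_iff)

lemma decid_const: "decid (\<lambda>n. b)"
  unfolding decid_def by (cases b) (auto intro: rec1_const)

text \<open>The list of alternatives does not depend on the input.\<close>

lemma decid_finite_ex: "(\<And>x. x \<in> set xs \<Longrightarrow> decid (P x)) \<Longrightarrow> decid (\<lambda>n. \<exists>x\<in>set xs. P x n)"
  by (induction xs) (auto intro: decid_or decid_const)

lemma decid_finite_all: "(\<And>x. x \<in> set xs \<Longrightarrow> decid (P x)) \<Longrightarrow> decid (\<lambda>n. \<forall>x\<in>set xs. P x n)"
  by (induction xs) (auto intro: decid_and decid_const)

text \<open>The program is only claimed to terminate on inputs that have a witness.\<close>

lemma search_program:
  assumes "decid (\<lambda>m. C (p1 m) (p2 m))" "rec1 out"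
  shows "\<exists>P. \<forall>n. (\<exists>w. C n w) \<longrightarrow> computes P [n] (out (pr n (LEAST w. C n w)))"
proof -
  have "rec1 (\<lambda>m. pr (p2 m) (p1 m))" by (intro rec1_pr rec1_p1 rec1_p2 rec1_id)
  from decid_comp[OF assms(1) this] have "decid (\<lambda>m. C (p2 m) (p1 m))" by simp
  then have "rec1 (\<lambda>m. if C (p2 m) (p1 m) then 0 else 1)" by (intro rec1_if rec1_const)
  then have "rec2 (\<lambda>w n. if C n w then 0 else 1)" by (simp add: rec2_iff_rec1)
  then obtain H where H: "\<And>w n. computes H [w, n] (if C n w then 0 else 1)" unfolding rec2_def by blast
  obtain R where R: "\<And>m n. computes R [m, n] (pr m n)" using rec2_pr unfolding rec2_def by blast
  obtain Q where Q: "\<And>n. computes Q [n] (out n)" using assms(2) unfolding rec1_def by blast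
  have "computes (Comp Q [Comp R [Proj 0, Mu H]]) [n] (out (pr n (LEAST w. C n w)))" if "\<exists>w. C n w" for n
  proof (rule computes_Comp1[OF computes_Comp2[OF computes_Proj _ R] Q])
    show "computes (Mu H) [n] (LEAST w. C n w)"
    proof (rule computes.mu)
      show "computes H [LEAST w. C n w, n] 0"
        using H[of "LEAST w. C n w" n] LeastI_ex[OF that] by simp
      fix m assume "m < (LEAST w. C n w)"
      then have "\<not> C n m" by (rule not_less_Least)
      then have "computes H [m, n] 1" using H[of m n] by simp
      then show "\<exists>y>0. computes H [m, n] y" by (intro exI[of _ 1]) simp
    qed
  qed auto
  then show ?thesis by blast
qed

section \<open>Computing with lists\<close>

text \<open>Head, tail and entries of a coded list; past the end the value is \<open>0\<close>.\<close>

definition hdc :: "nat \<Rightarrow> nat" where "hdc n = p1 (n - 1)"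
definition tlc :: "nat \<Rightarrow> nat" where "tlc n = p2 (n - 1)"
definition nthc :: "nat \<Rightarrow> nat \<Rightarrow> nat" where "nthc n k = hdc ((tlc ^^ k) n)"

lemma prod_decode_0: "prod_decode 0 = (0, 0)"
  using prod_encode_inverse[of "(0, 0)"] by (simp add: prod_encode_def)

lemma hdc_simps [simp]: "hdc (Suc n) = p1 n" "hdc 0 = 0" "tlc (Suc n) = p2 n" "tlc 0 = 0"
  by (simp_all add: hdc_def tlc_def prod_decode_0)

lemma rec1_hdc: "rec1 f \<Longrightarrow> rec1 (\<lambda>n. hdc (f n))"
  unfolding hdc_def by (intro rec1_p1 rec1_diff rec1_const)

lemma rec1_tlc: "rec1 f \<Longrightarrow> rec1 (\<lambda>n. tlc (f n))"
  unfolding tlc_def by (intro rec1_p2 rec1_diff rec1_const)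

lemma rec1_nthc:
  assumes "rec1 f" "rec1 g"
  shows "rec1 (\<lambda>n. nthc (f n) (g n))"
proof -
  have eq: "(tlc ^^ k) m = rec_nat m (\<lambda>_. tlc) k" for k m by (induction k) auto
  show ?thesis
    unfolding nthc_def eq using assms
    by (intro rec1_hdc rec1_rec_nat rec1_tlc rec1_p2 rec1_id)
qed

lemma nthc_0 [simp]: "nthc 0 k = 0"
proof -
  have "(tlc ^^ k) 0 = 0" by (induction k) auto
  then show ?thesis by (simp add: nthc_def)
qed

lemma nthc_list_encode: "nthc (list_encode xs) k = (if k < length xs then xs ! k else 0)"
proof (induction xs arbitrary: k)
  case Nil
  then show ?case by simp
next
  case (Cons x xs)
  show ?case
  proof (cases k)
    case 0
    then show ?thesis by (simp add: nthc_def)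
  next
    case (Suc j)
    have "(tlc ^^ Suc j) (list_encode (x # xs)) = (tlc ^^ j) (list_encode xs)"
      by (simp only: funpow_Suc_right o_apply) simp
    then show ?thesis using Cons[of j] Suc by (simp add: nthc_def)
  qed
qed

lemma length_le_list_encode: "length xs \<le> list_encode xs"
proof (induction xs)
  case (Cons x xs)
  have "list_encode xs \<le> pr x (list_encode xs)" by (rule le_prod_encode_2)
  then show ?case using Cons by simp
qed auto

text \<open>
The state of the loop consists of the code of the remaining list and the accumulator.  The number of steps
is the code of the list, which is at least its length; further steps do nothing.
\<close>

lemma rec1_fold:
  assumes s: "rec1 (\<lambda>m. s (p1 m) (p1 (p2 m)) (p2 (p2 m)))" and l: "rec1 l" and g: "rec1 g"
  shows "rec1 (\<lambda>n. fold (s n) (list_decode (l n)) (g n))"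
proof -
  define t where "t n y = (if p1 y = 0 then y else pr (tlc (p1 y)) (s n (hdc (p1 y)) (p2 y)))" for n y
  have iter: "rec_nat (pr (list_encode xs) a) (\<lambda>_. t n) (k + length xs) = pr 0 (fold (s n) xs a)" for xs a n k
  proof (induction xs arbitrary: a)
    case Nil
    have "rec_nat (pr 0 a) (\<lambda>_. t n) k = pr 0 a" by (induction k) (auto simp: t_def)
    then show ?case by simp
  next
    case (Cons x xs)
    have shift: "rec_nat b (\<lambda>_. t n) (Suc j) = rec_nat (t n b) (\<lambda>_. t n) j" for b j
      by (induction j) auto
    have "t n (pr (list_encode (x # xs)) a) = pr (list_encode xs) (s n x a)"
      by (simp add: t_def)
    then show ?case using Cons[of "s n x a"] shift[of "pr (list_encode (x # xs)) a" "k + length xs"] by simp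
  qed
  have "rec1 (\<lambda>n. rec_nat (pr (l n) (g n)) (\<lambda>_. t n) (l n))"
  proof (rule rec1_rec_nat[OF _ rec1_pr[OF l g] l])
    have "rec1 (\<lambda>m. pr (p1 m) (pr (hdc (p1 (p2 (p2 m)))) (p2 (p2 (p2 m)))))"
      by (intro rec1_pr rec1_hdc rec1_p1 rec1_p2 rec1_id)
    from rec1_comp[OF s this] have "rec1 (\<lambda>m. s (p1 m) (hdc (p1 (p2 (p2 m)))) (p2 (p2 (p2 m))))" by simp
    then show "rec1 (\<lambda>m. t (p1 m) (p2 (p2 m)))"
      unfolding t_def by (intro rec1_if decid_zero rec1_pr rec1_tlc rec1_p1 rec1_p2 rec1_id)
  qed
  moreover have "rec_nat (pr (l n) (g n)) (\<lambda>_. t n) (l n) = pr 0 (fold (s n) (list_decode (l n)) (g n))" for n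
    using iter[of "list_decode (l n)" "g n" n "l n - length (list_decode (l n))"]
      length_le_list_encode[of "list_decode (l n)"] by simp
  ultimately have "rec1 (\<lambda>n. pr 0 (fold (s n) (list_decode (l n)) (g n)))" by simp
  from rec1_p2[OF this] show ?thesis by simp
qed

lemma decid_list_all:
  assumes P: "decid (\<lambda>m. P (p1 m) (p2 m))" and l: "rec1 l"
  shows "decid (\<lambda>n. \<forall>x\<in>set (list_decode (l n)). P n x)"
proof -
  have "rec1 (\<lambda>n. fold (\<lambda>x y. if P n x then y else 1) (list_decode (l n)) 0)"
  proof (rule rec1_fold[OF _ l rec1_const])
    have "rec1 (\<lambda>m. pr (p1 m) (p1 (p2 m)))" by (intro rec1_pr rec1_p1 rec1_p2 rec1_id)
    from decid_comp[OF P this] have "decid (\<lambda>m. P (p1 m) (p1 (p2 m)))" by simp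
    then show "rec1 (\<lambda>m. if P (p1 m) (p1 (p2 m)) then p2 (p2 m) else 1)"
      by (intro rec1_if rec1_p2 rec1_id rec1_const)
  qed
  then have "decid (\<lambda>n. fold (\<lambda>x y. if P n x then y else 1) (list_decode (l n)) (0 :: nat) = 0)"
    by (rule decid_zero)
  moreover have eq: "fold (\<lambda>x y. if Q x then y else 1) xs a = 0 \<longleftrightarrow> (\<forall>x\<in>set xs. Q x) \<and> a = 0"
    for Q and xs :: "nat list" and a :: nat
    by (induction xs arbitrary: a) auto
  ultimately show ?thesis by (simp only: eq simp_thms)
qed

section \<open>Computing with integers and rational numbers\<close>

lemma rec1_half: "rec1 f \<Longrightarrow> rec1 (\<lambda>n. f n div 2)"
proof -
  have "rec1 (\<lambda>m. Suc (p2 m) - (2 * p1 m + 2))"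
    by (intro rec1_diff rec1_suc rec1_add rec1_mult rec1_const rec1_p1 rec1_p2 rec1_id)
  then have "rec2 (\<lambda>k n. Suc n - (2 * k + 2))" by (simp add: rec2_iff_rec1)
  moreover have "\<exists>k. Suc n - (2 * k + 2) = 0" for n :: nat by (intro exI[of _ n]) simp
  ultimately have "rec1 (\<lambda>n. LEAST k. Suc n - (2 * k + 2) = 0)" by (rule rec1_mu)
  moreover have "(LEAST k. Suc n - (2 * k + 2) = 0) = n div 2" for n :: nat
    by (rule Least_equality) auto
  ultimately have "rec1 (\<lambda>n. n div 2)" by simp
  then show "rec1 f \<Longrightarrow> rec1 (\<lambda>n. f n div 2)" by (rule rec1_comp)
qed

lemma decid_even: "rec1 f \<Longrightarrow> decid (\<lambda>n. even (f n))"
proof -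
  assume "rec1 f"
  then have "decid (\<lambda>n. f n - 2 * (f n div 2) = 0)"
    by (intro decid_zero rec1_diff rec1_mult rec1_const rec1_half)
  moreover have "m - 2 * (m div 2) = 0 \<longleftrightarrow> even m" for m :: nat by presburger
  ultimately show ?thesis by simp
qed

definition reci :: "(nat \<Rightarrow> int) \<Rightarrow> bool" where
  "reci f \<longleftrightarrow> rec1 (\<lambda>n. int_encode (f n))"

lemma int_encode_cases: "int_encode i = (if i \<ge> 0 then 2 * nat i else Suc (2 * nat (- i - 1)))"
  by (simp add: int_encode_def sum_encode_def)

lemma int_decode_cases: "int_decode n = (if even n then int (n div 2) else - int (n div 2) - 1)"
  by (simp add: int_decode_def sum_decode_def)

lemma reci_decode: "rec1 f \<Longrightarrow> reci (\<lambda>n. int_decode (f n))"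
  by (simp add: reci_def)

lemma rec1_nat: "reci f \<Longrightarrow> rec1 (\<lambda>n. nat (f n))"
proof -
  assume "reci f"
  then have "rec1 (\<lambda>n. if even (int_encode (f n)) then int_encode (f n) div 2 else 0)"
    unfolding reci_def by (intro rec1_if decid_even rec1_half rec1_const)
  moreover have "(if even (int_encode i) then int_encode i div 2 else 0) = nat i" for i
    by (simp add: int_encode_cases)
  ultimately show ?thesis by simp
qed

lemma rec1_nat_neg: "reci f \<Longrightarrow> rec1 (\<lambda>n. nat (- f n))"
proof -
  assume "reci f"
  then have "rec1 (\<lambda>n. if even (int_encode (f n)) then 0 else Suc (int_encode (f n) div 2))"
    unfolding reci_def by (intro rec1_if decid_even rec1_suc rec1_half rec1_const)
  moreover have "(if even (int_encode i) then 0 else Suc (int_encode i div 2)) = nat (- i)" for i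
    by (simp add: int_encode_cases) linarith
  ultimately show ?thesis by simp
qed

text \<open>Arithmetic on integers is reduced to natural numbers by means of positive and negative parts.\<close>

lemma reci_diff_nat: "rec1 f \<Longrightarrow> rec1 g \<Longrightarrow> reci (\<lambda>n. int (f n) - int (g n))"
proof -
  assume "rec1 f" "rec1 g"
  then have "rec1 (\<lambda>n. if g n \<le> f n then 2 * (f n - g n) else 2 * (g n - f n) - 1)"
    by (intro rec1_if decid_le rec1_mult rec1_diff rec1_const)
  moreover have "(if b \<le> a then 2 * (a - b) else 2 * (b - a) - 1) = int_encode (int a - int b)" for a b :: nat
    by (auto simp: int_encode_cases nat_diff_distrib')
  ultimately show ?thesis by (simp add: reci_def)
qed

lemma reci_int: "rec1 f \<Longrightarrow> reci (\<lambda>n. int (f n))"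
  using reci_diff_nat[of f "\<lambda>_. 0"] rec1_const by simp

lemma reci_add:
  assumes "reci f" "reci g"
  shows "reci (\<lambda>n. f n + g n)"
proof -
  have "reci (\<lambda>n. int (nat (f n) + nat (g n)) - int (nat (- f n) + nat (- g n)))"
    by (intro reci_diff_nat rec1_add rec1_nat rec1_nat_neg assms)
  moreover have "int (nat a + nat b) - int (nat (- a) + nat (- b)) = a + b" for a b by linarith
  ultimately show ?thesis by simp
qed

lemma reci_mult:
  assumes "reci f" "reci g"
  shows "reci (\<lambda>n. f n * g n)"
proof -
  have "reci (\<lambda>n. int (nat (f n) * nat (g n) + nat (- f n) * nat (- g n))
      - int (nat (f n) * nat (- g n) + nat (- f n) * nat (g n)))"
    by (intro reci_diff_nat rec1_add rec1_mult rec1_nat rec1_nat_neg assms)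
  moreover have "int (nat a * nat b + nat (- a) * nat (- b)) - int (nat a * nat (- b) + nat (- a) * nat b) = a * b" for a b
    by (cases "a \<ge> 0"; cases "b \<ge> 0") (simp_all add: not_le)
  ultimately show ?thesis by simp
qed

lemma reci_const: "reci (\<lambda>n. c)"
  by (simp add: reci_def rec1_const)

lemma decid_int_zero: "reci f \<Longrightarrow> decid (\<lambda>n. f n = 0)"
  using decid_eq[of "\<lambda>n. int_encode (f n)" "\<lambda>n. int_encode 0"] rec1_const
  by (simp add: reci_def int_encode_eq)

text \<open>Rational numbers have many codes; fractions need not be reduced, which keeps the arithmetic simple.\<close>

definition decode_rat :: "nat \<Rightarrow> rat" where
  "decode_rat n = of_int (int_decode (p1 n)) / of_nat (Suc (p2 n))"

definition recq :: "(nat \<Rightarrow> rat) \<Rightarrow> bool" where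
  "recq f \<longleftrightarrow> (\<exists>h. rec1 h \<and> (\<forall>n. decode_rat (h n) = f n))"

lemma recq_decode: "rec1 f \<Longrightarrow> recq (\<lambda>n. decode_rat (f n))"
  by (auto simp: recq_def)

lemma decode_rat_surj: "\<exists>n. decode_rat n = q"
proof -
  obtain a b where ab: "quotient_of q = (a, b)" by (cases "quotient_of q")
  then have b: "b > 0" by (rule quotient_of_denom_pos)
  have "decode_rat (pr (int_encode a) (nat b - 1)) = of_int a / of_nat (Suc (nat b - 1))"
    by (simp add: decode_rat_def)
  also have "Suc (nat b - 1) = nat b" using b by simp
  also have "of_int a / of_nat (nat b) = q" using quotient_of_div[OF ab] b by simp
  finally show ?thesis by blast
qed

lemma recq_const: "recq (\<lambda>n. c)"
  using decode_rat_surj[of c] rec1_const unfolding recq_def by blast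

lemma recq_frac:
  assumes "reci a" "rec1 b"
  shows "recq (\<lambda>n. of_int (a n) / of_nat (Suc (b n)))"
proof -
  have "rec1 (\<lambda>n. pr (int_encode (a n)) (b n))" using assms by (intro rec1_pr) (simp_all add: reci_def)
  moreover have "decode_rat (pr (int_encode (a n)) (b n)) = of_int (a n) / of_nat (Suc (b n))" for n
    by (simp add: decode_rat_def)
  ultimately show ?thesis unfolding recq_def by blast
qed

lemma recqE:
  assumes "recq f"
  obtains a b where "reci a" "rec1 b" "\<And>n. f n = of_int (a n) / of_nat (Suc (b n))"
proof -
  obtain h where h: "rec1 h" "\<And>n. decode_rat (h n) = f n" using assms unfolding recq_def by blast
  show ?thesis
    by (rule that[of "\<lambda>n. int_decode (p1 (h n))" "\<lambda>n. p2 (h n)"])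
      (auto simp: decode_rat_def simp flip: h(2) intro!: reci_decode rec1_p1 rec1_p2 h(1))
qed

lemma recq_add:
  assumes "recq f" "recq g"
  shows "recq (\<lambda>n. f n + g n)"
proof -
  obtain a b where f: "reci a" "rec1 b" "\<And>n. f n = of_int (a n) / of_nat (Suc (b n))"
    using recqE[OF assms(1)] by blast
  obtain c d where g: "reci c" "rec1 d" "\<And>n. g n = of_int (c n) / of_nat (Suc (d n))"
    using recqE[OF assms(2)] by blast
  have "recq (\<lambda>n. of_int (a n * int (Suc (d n)) + c n * int (Suc (b n))) / of_nat (Suc (b n * d n + b n + d n)))"
    by (intro recq_frac reci_add reci_mult reci_int rec1_add rec1_mult rec1_suc f g)
  moreover have "of_int (x * int (Suc v) + y * int (Suc u)) / of_nat (Suc (u * v + u + v))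
      = (of_int x / of_nat (Suc u) + of_int y / of_nat (Suc v) :: rat)" for x y u v
  proof -
    have "(of_nat (Suc (u * v + u + v)) :: rat) = of_nat (Suc u) * of_nat (Suc v)"
      by (simp add: algebra_simps)
    moreover have "(of_nat (Suc u) :: rat) \<noteq> 0" "(of_nat (Suc v) :: rat) \<noteq> 0"
      by (simp_all del: of_nat_Suc)
    ultimately show ?thesis by (simp add: add_frac_eq del: of_nat_Suc)
  qed
  ultimately show ?thesis by (simp only: f(3) g(3))
qed

lemma recq_mult:
  assumes "recq f" "recq g"
  shows "recq (\<lambda>n. f n * g n)"
proof -
  obtain a b where f: "reci a" "rec1 b" "\<And>n. f n = of_int (a n) / of_nat (Suc (b n))"
    using recqE[OF assms(1)] by blast
  obtain c d where g: "reci c" "rec1 d" "\<And>n. g n = of_int (c n) / of_nat (Suc (d n))"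
    using recqE[OF assms(2)] by blast
  have "recq (\<lambda>n. of_int (a n * c n) / of_nat (Suc (b n * d n + b n + d n)))"
    by (intro recq_frac reci_mult rec1_add rec1_mult f g)
  moreover have "of_int (x * y) / of_nat (Suc (u * v + u + v))
      = (of_int x / of_nat (Suc u) * (of_int y / of_nat (Suc v)) :: rat)" for x y u v
  proof -
    have "(of_nat (Suc (u * v + u + v)) :: rat) = of_nat (Suc u) * of_nat (Suc v)"
      by (simp add: algebra_simps)
    then show ?thesis by (simp del: of_nat_Suc)
  qed
  ultimately show ?thesis by (simp only: f(3) g(3))
qed

lemma recq_if:
  assumes "decid P" "recq f" "recq g"
  shows "recq (\<lambda>n. if P n then f n else g n)"
proof -
  obtain h where h: "rec1 h" "\<And>n. decode_rat (h n) = f n" using assms(2) unfolding recq_def by blast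
  obtain k where k: "rec1 k" "\<And>n. decode_rat (k n) = g n" using assms(3) unfolding recq_def by blast
  have "decode_rat (if P n then h n else k n) = (if P n then f n else g n)" for n using h k by simp
  then show ?thesis unfolding recq_def using rec1_if[OF assms(1) h(1) k(1)] by blast
qed

lemma decid_rat_zero:
  assumes "recq f"
  shows "decid (\<lambda>n. f n = 0)"
proof -
  obtain a b where f: "reci a" "rec1 b" "\<And>n. f n = of_int (a n) / of_nat (Suc (b n))"
    using recqE[OF assms(1)] by blast
  have "f n = 0 \<longleftrightarrow> a n = 0" for n by (simp add: f(3) del: of_nat_Suc)
  then show ?thesis using decid_int_zero[OF f(1)] by simp
qed

lemma recq_sum_list:
  assumes F: "recq (\<lambda>m. F (p1 m) (p2 m))" and l: "rec1 l"
  shows "recq (\<lambda>n. \<Sum>t\<leftarrow>list_decode (l n). F n t)"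
proof -
  obtain h where h: "rec1 h" "\<And>m. decode_rat (h m) = F (p1 m) (p2 m)" using F unfolding recq_def by blast
  have "recq (\<lambda>m. decode_rat (h (pr (p1 m) (p1 (p2 m)))) + decode_rat (p2 (p2 m)))"
    by (intro recq_add recq_decode rec1_comp[OF h(1)] rec1_pr rec1_p1 rec1_p2 rec1_id)
  then obtain a where a: "rec1 a" "\<And>m. decode_rat (a m) = F (p1 m) (p1 (p2 m)) + decode_rat (p2 (p2 m))"
    unfolding recq_def h(2) by auto
  obtain z where z: "decode_rat z = 0" using decode_rat_surj by blast
  define s where "s n x y = a (pr n (pr x y))" for n x y
  have "rec1 (\<lambda>n. fold (s n) (list_decode (l n)) z)"
    unfolding s_def by (intro rec1_fold rec1_comp[OF a(1)] rec1_pr rec1_p1 rec1_p2 rec1_id l rec1_const)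
  moreover have "decode_rat (fold (s n) xs y) = (\<Sum>t\<leftarrow>xs. F n t) + decode_rat y" for n xs y
    by (induction xs arbitrary: y) (auto simp: s_def a(2))
  ultimately show ?thesis unfolding recq_def using z by (intro exI[of _ "\<lambda>n. fold (s n) (list_decode (l n)) z"]) auto
qed

section \<open>Computing with Laurent polynomials\<close>

text \<open>The enumeration of the coordinates which the coding refers to.\<close>

locale coordinates =
  fixes ds :: "'d::finite list"
  assumes distinct_ds: "distinct ds" and set_ds: "set ds = UNIV"
begin

definition idx :: "'d \<Rightarrow> nat" where
  "idx i = (SOME k. k < length ds \<and> ds ! k = i)"

lemma idx: "idx i < length ds" "ds ! idx i = i"
proof -
  have "\<exists>k. k < length ds \<and> ds ! k = i" using set_ds by (metis UNIV_I in_set_conv_nth)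
  then have "idx i < length ds \<and> ds ! idx i = i" unfolding idx_def by (rule someI_ex)
  then show "idx i < length ds" "ds ! idx i = i" by auto
qed

definition decode_vec :: "nat \<Rightarrow> int ^ 'd" where
  "decode_vec n = (\<chi> i. int_decode (nthc n (idx i)))"

lemma nthc_encode_vec: "nthc (encode_vec ds v) (idx i) = int_encode (v $ i)"
  using idx[of i] by (simp add: encode_vec_def nthc_list_encode)

lemma decode_vec_encode [simp]: "decode_vec (encode_vec ds v) = v"
  by (simp add: decode_vec_def nthc_encode_vec vec_eq_iff)

definition recv :: "(nat \<Rightarrow> int ^ 'd) \<Rightarrow> bool" where
  "recv v \<longleftrightarrow> rec1 (\<lambda>n. encode_vec ds (v n))"

lemma rec1_list_encode_map:
  "(\<And>i. i \<in> set js \<Longrightarrow> rec1 (g i)) \<Longrightarrow> rec1 (\<lambda>n. list_encode (map (\<lambda>i. g i n) js))"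
  by (induction js) (auto intro!: rec1_const rec1_suc rec1_pr)

lemma recv_iff: "recv v \<longleftrightarrow> (\<forall>i. reci (\<lambda>n. v n $ i))"
proof
  assume v: "recv v"
  show "\<forall>i. reci (\<lambda>n. v n $ i)"
  proof
    fix i
    have "reci (\<lambda>n. int_decode (nthc (encode_vec ds (v n)) (idx i)))"
      using v unfolding recv_def by (intro reci_decode rec1_nthc rec1_const)
    then show "reci (\<lambda>n. v n $ i)" by (simp add: nthc_encode_vec)
  qed
next
  assume "\<forall>i. reci (\<lambda>n. v n $ i)"
  then show "recv v"
    unfolding recv_def encode_vec_def reci_def by (intro rec1_list_encode_map) blast
qed

lemma recv_decode: "rec1 f \<Longrightarrow> recv (\<lambda>n. decode_vec (f n))"
  unfolding recv_iff decode_vec_def by (simp add: reci_decode rec1_nthc rec1_const)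

lemma recv_add: "recv u \<Longrightarrow> recv v \<Longrightarrow> recv (\<lambda>n. u n + v n)"
  unfolding recv_iff by (simp add: reci_add)

lemma recv_const: "recv (\<lambda>n. v)"
  unfolding recv_def by (rule rec1_const)

lemma decid_vec_eq:
  assumes "recv u" "recv v"
  shows "decid (\<lambda>n. u n = v n)"
proof -
  have "decid (\<lambda>n. encode_vec ds (u n) = encode_vec ds (v n))"
    using assms unfolding recv_def by (rule decid_eq)
  moreover have "encode_vec ds x = encode_vec ds y \<longleftrightarrow> x = y" for x y by (metis decode_vec_encode)
  ultimately show ?thesis by (simp only:)
qed

text \<open>
A code of a Laurent polynomial with coefficients in \<open>Q[t]\<close> lists its terms \<open>c t^k x^n\<close>, in any order
and possibly with repetitions.  So equality is not equality of codes, but it is decidable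
(\<open>decid_poly_zero\<close>).
\<close>

definition decode_term :: "nat \<Rightarrow> ('d, rat poly) laurent" where
  "decode_term t = sg (decode_vec (p1 t)) (monom (decode_rat (p2 (p2 t))) (p1 (p2 t)))"

definition decode_poly :: "nat \<Rightarrow> ('d, rat poly) laurent" where
  "decode_poly n = (\<Sum>t\<leftarrow>list_decode n. decode_term t)"

definition recp :: "(nat \<Rightarrow> ('d, rat poly) laurent) \<Rightarrow> bool" where
  "recp f \<longleftrightarrow> (\<exists>h. rec1 h \<and> (\<forall>n. decode_poly (h n) = f n))"

lemma recpE:
  assumes "recp f"
  obtains h where "rec1 h" "\<And>n. decode_poly (h n) = f n"
  using assms unfolding recp_def by blast

lemma recpI: "rec1 h \<Longrightarrow> (\<And>n. decode_poly (h n) = f n) \<Longrightarrow> recp f"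
  unfolding recp_def by blast

lemma recp_decode: "rec1 f \<Longrightarrow> recp (\<lambda>n. decode_poly (f n))"
  unfolding recp_def by blast

lemma recp_comp:
  assumes "recp f" "rec1 g"
  shows "recp (\<lambda>n. f (g n))"
proof -
  obtain h where h: "rec1 h" "\<And>n. decode_poly (h n) = f n" using assms(1) unfolding recp_def by blast
  show ?thesis by (rule recpI[OF rec1_comp[OF h(1) assms(2)]]) (rule h(2))
qed

lemma decode_poly_cons: "decode_poly (Suc (pr t c)) = decode_term t + decode_poly c"
  by (simp add: decode_poly_def)

lemma decode_poly_0: "decode_poly 0 = 0"
  by (simp add: decode_poly_def)

lemma recp_term:
  assumes "recv v" "rec1 k" "recq q"
  shows "recp (\<lambda>n. sg (v n) (monom (q n) (k n)))"
proof -
  obtain h where h: "rec1 h" "\<And>n. decode_rat (h n) = q n" using assms(3) unfolding recq_def by blast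
  show ?thesis
  proof (rule recpI)
    show "rec1 (\<lambda>n. Suc (pr (pr (encode_vec ds (v n)) (pr (k n) (h n))) 0))"
      using assms(1,2) h(1) unfolding recv_def by (intro rec1_suc rec1_pr rec1_const)
    show "decode_poly (Suc (pr (pr (encode_vec ds (v n)) (pr (k n) (h n))) 0)) = sg (v n) (monom (q n) (k n))" for n
      by (simp add: decode_poly_cons decode_poly_0 decode_term_def h(2))
  qed
qed

lemma recp_add:
  assumes "recp f" "recp g"
  shows "recp (\<lambda>n. f n + g n)"
proof -
  obtain h where h: "rec1 h" "\<And>n. decode_poly (h n) = f n" using assms(1) unfolding recp_def by blast
  obtain k where k: "rec1 k" "\<And>n. decode_poly (k n) = g n" using assms(2) unfolding recp_def by blast
  have *: "decode_poly (fold (\<lambda>x y. Suc (pr x y)) xs c) = (\<Sum>t\<leftarrow>xs. decode_term t) + decode_poly c" for xs c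
    by (induction xs arbitrary: c) (simp_all add: decode_poly_cons add_ac)
  show ?thesis
  proof (rule recpI)
    show "rec1 (\<lambda>n. fold (\<lambda>x y. Suc (pr x y)) (list_decode (h n)) (k n))"
      by (intro rec1_fold[where s = "\<lambda>n x y. Suc (pr x y)"] rec1_suc rec1_pr rec1_p1 rec1_p2 rec1_id h(1) k(1))
    show "decode_poly (fold (\<lambda>x y. Suc (pr x y)) (list_decode (h n)) (k n)) = f n + g n" for n
      by (simp add: * k(2) flip: h(2)) (simp add: decode_poly_def)
  qed
qed

lemma recp_fold:
  assumes op: "recp (\<lambda>m. B (decode_poly (p1 m)) (decode_poly (p2 m)))"
    and F: "recp (\<lambda>m. F (p1 m) (p2 m))" and l: "rec1 l" and c: "decode_poly c = c'"
  shows "recp (\<lambda>n. fold (\<lambda>t y. B (F n t) y) (list_decode (l n)) c')"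
proof -
  obtain b where b: "rec1 b" "\<And>m. decode_poly (b m) = B (decode_poly (p1 m)) (decode_poly (p2 m))" using op unfolding recp_def by blast
  obtain h where h: "rec1 h" "\<And>m. decode_poly (h m) = F (p1 m) (p2 m)" using F unfolding recp_def by blast
  define s where "s n x y = b (pr (h (pr n x)) y)" for n x y
  show ?thesis
  proof (rule recpI)
    show "rec1 (\<lambda>n. fold (s n) (list_decode (l n)) c)"
      unfolding s_def
      by (intro rec1_fold rec1_comp[OF b(1)] rec1_comp[OF h(1)] rec1_pr rec1_p1 rec1_p2 rec1_id l rec1_const)
    have "decode_poly (fold (s n) xs y) = fold (\<lambda>t y. B (F n t) y) xs (decode_poly y)" for n xs y
      by (induction xs arbitrary: y) (simp_all add: s_def b(2) h(2))
    then show "decode_poly (fold (s n) (list_decode (l n)) c) = fold (\<lambda>t y. B (F n t) y) (list_decode (l n)) c'" for n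
      using c by simp
  qed
qed

lemma recp_rec_nat:
  assumes op: "recp (\<lambda>m. B (decode_poly (p1 m)) (decode_poly (p2 m)))"
    and F: "recp (\<lambda>m. F (p1 m) (p2 m))" and l: "rec1 l" and c: "decode_poly c = c'"
  shows "recp (\<lambda>n. rec_nat c' (\<lambda>k y. B (F n k) y) (l n))"
proof -
  obtain b where b: "rec1 b" "\<And>m. decode_poly (b m) = B (decode_poly (p1 m)) (decode_poly (p2 m))" using op unfolding recp_def by blast
  obtain h where h: "rec1 h" "\<And>m. decode_poly (h m) = F (p1 m) (p2 m)" using F unfolding recp_def by blast
  define s where "s n k y = b (pr (h (pr n k)) y)" for n k y
  show ?thesis
  proof (rule recpI)
    show "rec1 (\<lambda>n. rec_nat c (s n) (l n))"
      unfolding s_def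
      by (intro rec1_rec_nat rec1_comp[OF b(1)] rec1_comp[OF h(1)] rec1_pr rec1_p1 rec1_p2 rec1_id l rec1_const)
    have "decode_poly (rec_nat c (s n) k) = rec_nat c' (\<lambda>k y. B (F n k) y) k" for n k
      by (induction k) (simp_all add: s_def b(2) h(2) c)
    then show "decode_poly (rec_nat c (s n) (l n)) = rec_nat c' (\<lambda>k y. B (F n k) y) (l n)" for n .
  qed
qed

lemma recp_decode_poly_add: "recp (\<lambda>m. decode_poly (p1 m) + decode_poly (p2 m))"
  by (intro recp_add recp_decode rec1_p1 rec1_p2 rec1_id)

lemma recp_sum_list:
  assumes "recp (\<lambda>m. F (p1 m) (p2 m))" "rec1 l"
  shows "recp (\<lambda>n. \<Sum>t\<leftarrow>list_decode (l n). F n t)"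
proof -
  have "fold (\<lambda>t y. F n t + y) xs a = (\<Sum>t\<leftarrow>xs. F n t) + a" for n xs a
    by (induction xs arbitrary: a) (simp_all add: add_ac)
  then show ?thesis using recp_fold[OF recp_decode_poly_add assms decode_poly_0] by simp
qed

lemma recp_sum_range:
  assumes "recp (\<lambda>m. F (p1 m) (p2 m))" "rec1 l"
  shows "recp (\<lambda>n. \<Sum>k<l n. F n k)"
proof -
  have "rec_nat 0 (\<lambda>k y. F n k + y) j = (\<Sum>k<j. F n k)" for n j
    by (induction j) (simp_all add: add.commute)
  then show ?thesis using recp_rec_nat[OF recp_decode_poly_add assms decode_poly_0] by simp
qed

text \<open>An additive operation is computable if it is computable on terms.\<close>

lemma recp_additive:
  assumes add: "\<And>n a b. \<Phi> n (a + b) = \<Phi> n a + \<Phi> n b"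
    and \<Phi>: "recp (\<lambda>m. \<Phi> (p1 m) (decode_term (p2 m)))" and f: "recp f"
  shows "recp (\<lambda>n. \<Phi> n (f n))"
proof -
  obtain h where h: "rec1 h" "\<And>n. decode_poly (h n) = f n" using f unfolding recp_def by blast
  have z: "\<Phi> n 0 = 0" for n using add[of n 0 0] by simp
  have "\<Phi> n (\<Sum>t\<leftarrow>xs. decode_term t) = (\<Sum>t\<leftarrow>xs. \<Phi> n (decode_term t))" for n xs
    by (induction xs) (simp_all add: z add)
  then have "(\<Sum>t\<leftarrow>list_decode (h n). \<Phi> n (decode_term t)) = \<Phi> n (f n)" for n
    by (simp add: decode_poly_def flip: h(2))
  moreover have "recp (\<lambda>n. \<Sum>t\<leftarrow>list_decode (h n). \<Phi> n (decode_term t))"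
    by (rule recp_sum_list[OF \<Phi> h(1)])
  ultimately show ?thesis by simp
qed

lemma recp_mult:
  assumes "recp f" "recp g"
  shows "recp (\<lambda>n. f n * g n)"
proof -
  have "recp (\<lambda>m. decode_term (p2 (p1 m)) * decode_term (p2 m))"
  proof -
    have "recp (\<lambda>m. sg (decode_vec (p1 (p2 (p1 m))) + decode_vec (p1 (p2 m)))
        (monom (decode_rat (p2 (p2 (p2 (p1 m)))) * decode_rat (p2 (p2 (p2 m)))) (p1 (p2 (p2 (p1 m))) + p1 (p2 (p2 m)))))"
      by (intro recp_term recv_add recv_decode rec1_add recq_mult recq_decode rec1_p1 rec1_p2 rec1_id)
    then show ?thesis by (simp add: decode_term_def sg_mult_sg mult_monom)
  qed
  then have "recp (\<lambda>m. decode_term (p2 m) * g (p1 m))"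
    by (intro recp_additive[where \<Phi> = "\<lambda>m y. decode_term (p2 m) * y"] recp_comp[OF assms(2)] rec1_p1 rec1_id)
      (simp_all add: distrib_left)
  then show ?thesis
    by (intro recp_additive[where \<Phi> = "\<lambda>n x. x * g n"] assms(1)) (simp_all add: distrib_right)
qed

lemma decode_poly_surj: "\<exists>n. decode_poly n = H"
proof -
  have add: "\<exists>n. decode_poly n = a + b" if ab: "\<exists>n. decode_poly n = a" "\<exists>n. decode_poly n = b" for a b
  proof -
    obtain m n where mn: "decode_poly m = a" "decode_poly n = b" using ab by blast
    have "recp (\<lambda>_. decode_poly m + decode_poly n)" by (intro recp_add recp_decode rec1_const)
    then obtain h where "\<And>x. decode_poly (h x) = decode_poly m + decode_poly n" by (rule recpE) blast
    then show ?thesis using mn by blast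
  qed
  have sum: "\<exists>n. decode_poly n = sum F A" if "finite A" "\<And>x. x \<in> A \<Longrightarrow> \<exists>n. decode_poly n = F x"
    for A :: "'b set" and F
    using that by (induction A rule: finite_induct) (auto intro: decode_poly_0 add)
  have mono: "\<exists>n. decode_poly n = sg v (monom q k)" for v q k
  proof -
    have "recp (\<lambda>_. sg v (monom q k))" by (intro recp_term recv_const rec1_const recq_const)
    then show ?thesis by (meson recpE)
  qed
  have "\<exists>n. decode_poly n = sg v p" for v p
  proof -
    have "sg v p = sg v (\<Sum>i\<le>degree p. monom (coeff p i) i)"
      by (simp add: poly_as_sum_of_monoms)
    also have "\<dots> = (\<Sum>i\<le>degree p. sg v (monom (coeff p i) i))"
      by (rule laurent_eqI) (simp add: lookup_sum cf_sg)
    finally show ?thesis using sum[of "{..degree p}"] mono by simp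
  qed
  then have "\<exists>n. decode_poly n = (\<Sum>v\<in>supp H. sg v (cf H v))" by (intro sum) auto
  then show ?thesis by (simp flip: laurent_sum)
qed

lemma recp_const: "recp (\<lambda>n. H)"
  using decode_poly_surj[of H] recp_decode[OF rec1_const] by metis

lemma recp_diff:
  assumes "recp f" "recp g"
  shows "recp (\<lambda>n. f n - g n)"
proof -
  have "recp (\<lambda>n. f n + (- 1) * g n)" by (intro recp_add recp_mult recp_const assms)
  then show ?thesis by simp
qed

lemma recp_decode_poly_mult: "recp (\<lambda>m. decode_poly (p1 m) * decode_poly (p2 m))"
  by (intro recp_mult recp_decode rec1_p1 rec1_p2 rec1_id)

lemma recp_prod_list:
  assumes "recp (\<lambda>m. F (p1 m) (p2 m))" "rec1 l"
  shows "recp (\<lambda>n. \<Prod>t\<leftarrow>list_decode (l n). F n t)"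
proof -
  obtain c where c: "decode_poly c = 1" using decode_poly_surj by blast
  have "fold (\<lambda>t y. F n t * y) xs a = (\<Prod>t\<leftarrow>xs. F n t) * a" for n xs a
    by (induction xs arbitrary: a) (simp_all add: mult_ac)
  then show ?thesis using recp_fold[OF recp_decode_poly_mult assms c] by simp
qed

lemma recp_prod_range:
  assumes "recp (\<lambda>m. F (p1 m) (p2 m))" "rec1 l"
  shows "recp (\<lambda>n. \<Prod>k<l n. F n k)"
proof -
  obtain c where c: "decode_poly c = 1" using decode_poly_surj by blast
  have "rec_nat 1 (\<lambda>k y. F n k * y) j = (\<Prod>k<j. F n k)" for n j
    by (induction j) (simp_all add: mult.commute)
  then show ?thesis using recp_rec_nat[OF recp_decode_poly_mult assms c] by simp
qed

lemma recp_power: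
  assumes "recp f" "rec1 e"
  shows "recp (\<lambda>n. f n ^ e n)"
  using recp_prod_range[where F = "\<lambda>n k. f n" and l = e] recp_comp[OF assms(1) rec1_p1[OF rec1_id]] assms(2)
  by simp

lemma recq_coeff:
  assumes "recp f" "recv v" "rec1 k"
  shows "recq (\<lambda>n. coeff (cf (f n) (v n)) (k n))"
proof -
  obtain h where h: "rec1 h" "\<And>n. decode_poly (h n) = f n" using assms(1) unfolding recp_def by blast
  define F where "F n t = (if decode_vec (p1 t) = v n \<and> p1 (p2 t) = k n then decode_rat (p2 (p2 t)) else 0)" for n t
  have v: "recv (\<lambda>m. v (p1 m))" using assms(2) unfolding recv_def by (rule rec1_comp) (intro rec1_p1 rec1_id)
  have k: "rec1 (\<lambda>m. k (p1 m))" by (intro rec1_comp[OF assms(3)] rec1_p1 rec1_id)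
  have "recq (\<lambda>m. F (p1 m) (p2 m))"
    unfolding F_def
    by (intro recq_if decid_and decid_vec_eq decid_eq recv_decode recq_decode recq_const v k rec1_p1 rec1_p2 rec1_id)
  then have "recq (\<lambda>n. \<Sum>t\<leftarrow>list_decode (h n). F n t)" by (rule recq_sum_list[OF _ h(1)])
  moreover have "(\<Sum>t\<leftarrow>xs. F n t) = coeff (cf (\<Sum>t\<leftarrow>xs. decode_term t) (v n)) (k n)" for n xs
    by (induction xs) (auto simp: F_def decode_term_def lookup_add cf_sg)
  ultimately show ?thesis by (simp add: decode_poly_def flip: h(2))
qed

text \<open>Only the coefficients at the terms listed in the code have to be inspected.\<close>

lemma decid_poly_zero:
  assumes "recp f"
  shows "decid (\<lambda>n. f n = 0)"
proof -
  obtain h where h: "rec1 h" "\<And>n. decode_poly (h n) = f n" using assms(1) unfolding recp_def by blast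
  define Z where "Z n t \<longleftrightarrow> coeff (cf (decode_poly (h n)) (decode_vec (p1 t))) (p1 (p2 t)) = 0" for n t
  have "decid (\<lambda>m. Z (p1 m) (p2 m))"
    unfolding Z_def
    by (intro decid_rat_zero recq_coeff recp_decode recv_decode rec1_comp[OF h(1)] rec1_p1 rec1_p2 rec1_id)
  then have "decid (\<lambda>n. \<forall>t\<in>set (list_decode (h n)). Z n t)" by (rule decid_list_all[OF _ h(1)])
  moreover have "(\<forall>t\<in>set (list_decode (h n)). Z n t) \<longleftrightarrow> f n = 0" for n
  proof
    assume *: "\<forall>t\<in>set (list_decode (h n)). Z n t"
    have "coeff (cf (decode_poly (h n)) v) k = 0" for v k
    proof (rule ccontr)
      assume nz: "coeff (cf (decode_poly (h n)) v) k \<noteq> 0"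
      have "\<exists>t\<in>set xs. decode_vec (p1 t) = v \<and> p1 (p2 t) = k" if "coeff (cf (\<Sum>t\<leftarrow>xs. decode_term t) v) k \<noteq> 0" for xs
        using that by (induction xs) (auto simp: decode_term_def lookup_add cf_sg split: if_splits)
      then obtain t where "t \<in> set (list_decode (h n))" "decode_vec (p1 t) = v" "p1 (p2 t) = k"
        using nz unfolding decode_poly_def by blast
      then show False using * nz unfolding Z_def by blast
    qed
    then have "cf (f n) v = 0" for v by (simp add: poly_eq_iff flip: h(2))
    then show "f n = 0" by (intro laurent_eqI) simp
  qed (simp add: Z_def h(2))
  ultimately show ?thesis by simp
qed

text \<open>
A projection onto the polynomials with constant coefficients: applying it to a polynomial found by
a search ensures that \<open>t\<close> does not occur.
\<close>

definition set_t_1 :: "('d, rat poly) laurent \<Rightarrow> ('d, rat poly) laurent" where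
  "set_t_1 = lmap (\<lambda>p. [:poly p 1:])"

lemma ring_map_poly_at: "ring_map (\<lambda>p. [:poly p 1:] :: rat poly)"
  by (simp add: ring_map_def one_pCons)

lemma recp_set_t_1:
  assumes "recp f"
  shows "recp (\<lambda>n. set_t_1 (f n))"
proof (rule recp_additive[where \<Phi> = "\<lambda>_. set_t_1", OF _ _ assms])
  show "set_t_1 (a + b) = set_t_1 a + set_t_1 b" for a b
    unfolding set_t_1_def by (rule ring_mapD(3)[OF ring_map_lmap[OF ring_map_poly_at]])
  have "set_t_1 (decode_term t) = sg (decode_vec (p1 t)) (monom (decode_rat (p2 (p2 t))) 0)" for t
    by (simp add: set_t_1_def decode_term_def lmap_sg poly_monom monom_0)
  then show "recp (\<lambda>m. set_t_1 (decode_term (p2 m)))"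
    by simp (intro recp_term recv_decode rec1_const recq_decode rec1_p1 rec1_p2 rec1_id)
qed

text \<open>The substitution \<open>x_i = 1\<close>, a projection onto the polynomials in which \<open>x_i\<close> does not occur.\<close>

definition drop_var :: "'d \<Rightarrow> ('d, rat poly) laurent \<Rightarrow> ('d, rat poly) laurent" where
  "drop_var i = map_terms (\<lambda>n. \<chi> j. if j = i then 0 else n $ j) (\<lambda>_ c. c)"

lemma recp_drop_var:
  assumes "recp f"
  shows "recp (\<lambda>n. drop_var i (f n))"
proof (rule recp_additive[where \<Phi> = "\<lambda>_. drop_var i", OF _ _ assms])
  show "drop_var i (a + b) = drop_var i a + drop_var i b" for a b
    unfolding drop_var_def by (rule map_terms_add) simp
  have v: "recv (\<lambda>m. \<chi> j. if j = i then 0 else decode_vec (p1 (p2 m)) $ j)"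
    unfolding recv_iff
  proof
    fix j
    have "recv (\<lambda>m. decode_vec (p1 (p2 m)))" by (intro recv_decode rec1_p1 rec1_p2 rec1_id)
    then have "reci (\<lambda>m. decode_vec (p1 (p2 m)) $ j)" unfolding recv_iff by blast
    then show "reci (\<lambda>m. (\<chi> j. if j = i then 0 else decode_vec (p1 (p2 m)) $ j) $ j)"
      by (cases "j = i") (simp_all add: reci_const)
  qed
  have "drop_var i (decode_term t) = sg (\<chi> j. if j = i then 0 else decode_vec (p1 t) $ j) (monom (decode_rat (p2 (p2 t))) (p1 (p2 t)))" for t
    by (simp add: drop_var_def decode_term_def map_terms_sg)
  then show "recp (\<lambda>m. drop_var i (decode_term (p2 m)))"
    by simp (intro recp_term v recq_decode rec1_p1 rec1_p2 rec1_id)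
qed

lemma over_drop_var: "over (- {i}) (drop_var i H)"
proof -
  have "supp (drop_var i H) \<subseteq> (\<Union>n\<in>supp H. supp (sg (\<chi> j. if j = i then 0 else n $ j) (cf H n)))"
    unfolding drop_var_def map_terms_def by (rule keys_sum)
  then show ?thesis by (auto simp: over_def split: if_splits)
qed

lemma drop_var_id_iff: "drop_var i H = H \<longleftrightarrow> over (- {i}) H"
proof
  assume "over (- {i}) H"
  then have "(\<chi> j. if j = i then 0 else n $ j) = n" if "n \<in> supp H" for n
    using that by (auto simp: over_def vec_eq_iff)
  then have "drop_var i H = (\<Sum>n\<in>supp H. sg n (cf H n))"
    unfolding drop_var_def map_terms_def by (intro sum.cong) auto
  then show "drop_var i H = H" by (simp flip: laurent_sum)
qed (metis over_drop_var)

lemma recp_var_norm: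
  assumes "rec1 N" "recp f"
  shows "recp (\<lambda>n. var_norm (N n) i (f n))"
  unfolding var_norm_def
proof (rule recp_prod_range[where F = "\<lambda>n k. twist (N n) i k (f n)", OF _ assms(1)])
  show "recp (\<lambda>m. twist (N (p1 m)) i (p2 m) (f (p1 m)))"
  proof (rule recp_additive[where \<Phi> = "\<lambda>m. twist (N (p1 m)) i (p2 m)"])
    show "twist (N (p1 m)) i (p2 m) (a + b) = twist (N (p1 m)) i (p2 m) a + twist (N (p1 m)) i (p2 m) b" for m a b
      unfolding twist_def by (rule map_terms_add) (simp add: distrib_left)
    show "recp (\<lambda>m. f (p1 m))" by (intro recp_comp[OF assms(2)] rec1_p1 rec1_id)
    have "recv (\<lambda>m. decode_vec (p1 (p2 m)))" by (intro recv_decode rec1_p1 rec1_p2 rec1_id)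
    then have v: "reci (\<lambda>m. decode_vec (p1 (p2 m)) $ i)" unfolding recv_iff by blast
    have "twist M i k (decode_term t) = sg (decode_vec (p1 t)) (monom (decode_rat (p2 (p2 t))) (k * expo M (decode_vec (p1 t) $ i) + p1 (p2 t)))" for M k t
      by (simp add: twist_def decode_term_def map_terms_sg mult_monom)
    then show "recp (\<lambda>m. twist (N (p1 (p1 m))) i (p2 (p1 m)) (decode_term (p2 m)))"
      unfolding expo_def
      by simp (intro recp_term recv_decode recq_decode rec1_add rec1_mult rec1_diff rec1_nat rec1_nat_neg
          v rec1_comp[OF assms(1)] rec1_const rec1_p1 rec1_p2 rec1_id)
  qed
qed

lemma recp_norms:
  assumes "rec1 N" "recp f"
  shows "recp (\<lambda>n. foldr (var_norm (N n)) js (f n))"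
  by (induction js) (simp_all add: assms recp_var_norm)

section \<open>Reading factorizations\<close>

text \<open>
Translates the given coding of rational numbers: the denominator is coded as an integer there, and
as its predecessor here.
\<close>

definition ratconv :: "nat \<Rightarrow> nat" where
  "ratconv c = pr (p1 c) (p2 c div 2 - 1)"

lemma decode_rat_ratconv: "decode_rat (ratconv (encode_rat q)) = q"
proof -
  obtain a b where ab: "quotient_of q = (a, b)" by (cases "quotient_of q")
  then have b: "b > 0" by (rule quotient_of_denom_pos)
  then have "int_encode b div 2 - 1 = nat b - 1" by (simp add: int_encode_cases)
  then have "decode_rat (ratconv (encode_rat q)) = of_int a / of_nat (Suc (nat b - 1))"
    by (simp add: decode_rat_def ratconv_def encode_rat_def ab)
  also have "Suc (nat b - 1) = nat b" using b by simp
  also have "of_int a / of_nat (nat b) = q" using quotient_of_div[OF ab] b by simp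
  finally show ?thesis .
qed

lemma rec1_ratconv: "rec1 f \<Longrightarrow> rec1 (\<lambda>n. ratconv (f n))"
  unfolding ratconv_def by (intro rec1_pr rec1_p1 rec1_p2 rec1_diff rec1_half rec1_const)

lemma decode_rat_ratconv_0: "decode_rat (ratconv 0) = 0"
  by (simp add: ratconv_def decode_rat_def prod_decode_0 int_decode_cases)

lemma coeff_beyond: "length (coeffs p) \<le> k \<Longrightarrow> coeff p k = 0"
  using nth_default_coeffs_eq[of p] nth_default_beyond[of "coeffs p" k 0] by simp

text \<open>
The code of a list is at least its length, so the code is a sufficient range of summation; the entries past
the end are read as \<open>0\<close>.
\<close>

lemma read_poly:
  "(\<Sum>k<encode_poly p. monom (decode_rat (ratconv (nthc (encode_poly p) k))) k) = p"
proof (rule poly_eqI)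
  fix j
  have val: "decode_rat (ratconv (nthc (encode_poly p) k)) = coeff p k" for k
  proof (cases "k < length (coeffs p)")
    case True
    then have "coeffs p ! k = coeff p k"
      using nth_default_coeffs_eq[of p] by (metis nth_default_nth)
    then show ?thesis using True by (simp add: encode_poly_def nthc_list_encode decode_rat_ratconv)
  next
    case False
    then have "coeff p k = 0" by (intro coeff_beyond) simp
    then show ?thesis using False by (simp add: encode_poly_def nthc_list_encode decode_rat_ratconv_0)
  qed
  have len: "length (coeffs p) \<le> encode_poly p"
    using length_le_list_encode[of "map encode_rat (coeffs p)"] by (simp add: encode_poly_def)
  have "coeff (\<Sum>k<encode_poly p. monom (decode_rat (ratconv (nthc (encode_poly p) k))) k) j
      = (\<Sum>k<encode_poly p. if k = j then coeff p j else 0)"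
    unfolding val coeff_sum by (intro sum.cong) auto
  also have "\<dots> = coeff p j"
  proof (cases "j < encode_poly p")
    case False
    then have "length (coeffs p) \<le> j" using len by simp
    then have "coeff p j = 0" by (rule coeff_beyond)
    then show ?thesis by simp
  qed simp
  finally show "coeff (\<Sum>k<encode_poly p. monom (decode_rat (ratconv (nthc (encode_poly p) k))) k) j = coeff p j" .
qed

definition read_coeff :: "nat \<Rightarrow> rat poly" where
  "read_coeff c = (\<Sum>k<c. monom (decode_rat (ratconv (nthc c k))) k)"

lemma read_coeff_encode [simp]: "read_coeff (encode_poly p) = p"
  unfolding read_coeff_def by (rule read_poly)

lemma recp_read_coeff:
  assumes "recv v" "rec1 f"
  shows "recp (\<lambda>n. sg (v n) (read_coeff (f n)))"
proof -
  have v: "recv (\<lambda>m. v (p1 m))" using assms(1) unfolding recv_def by (rule rec1_comp) (intro rec1_p1 rec1_id)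
  have "recp (\<lambda>m. sg (v (p1 m)) (monom (decode_rat (ratconv (nthc (f (p1 m)) (p2 m)))) (p2 m)))"
    by (intro recp_term v recq_decode rec1_ratconv rec1_nthc rec1_comp[OF assms(2)] rec1_p1 rec1_p2 rec1_id)
  then have "recp (\<lambda>n. \<Sum>k<f n. sg (v n) (monom (decode_rat (ratconv (nthc (f n) k))) k))"
    by (rule recp_sum_range[OF _ assms(2)])
  moreover have eq: "(\<Sum>k\<in>A. sg v (g k)) = sg v (sum g A)"
    for v :: "int ^ 'd" and g :: "nat \<Rightarrow> rat poly" and A
    by (rule laurent_eqI) (simp add: lookup_sum cf_sg)
  ultimately show ?thesis unfolding read_coeff_def by (simp only: eq)
qed

definition read_terms :: "nat \<Rightarrow> ('d, rat poly) laurent" where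
  "read_terms c = (\<Sum>t\<leftarrow>list_decode c. sg (decode_vec (p1 t)) (read_coeff (p2 t)))"

lemma read_terms_encode: "read_terms (encode_terms ds ts) = (\<Sum>(n, a)\<leftarrow>ts. sg n a)"
  by (simp add: read_terms_def encode_terms_def o_def case_prod_unfold)

lemma recp_read_terms: "rec1 f \<Longrightarrow> recp (\<lambda>n. read_terms (f n))"
  unfolding read_terms_def
  by (intro recp_sum_list recp_read_coeff recv_decode rec1_p1 rec1_p2 rec1_id)

lemma recp_read_terms_prod: "rec1 f \<Longrightarrow> recp (\<lambda>n. \<Prod>t\<leftarrow>list_decode (f n). read_terms t)"
  by (intro recp_prod_list recp_read_terms rec1_p2 rec1_id)

lemma nthc_le: "nthc n k \<le> n"
proof -
  have hd: "hdc m \<le> m" for m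
  proof (cases m)
    case (Suc j)
    then show ?thesis using le_prod_encode_1[of "p1 j" "p2 j"] by simp
  qed simp
  have tl: "tlc m \<le> m" for m
  proof (cases m)
    case (Suc j)
    then show ?thesis using le_prod_encode_2[of "p2 j" "p1 j"] by simp
  qed simp
  have "(tlc ^^ k) n \<le> n" by (induction k) (auto intro: order_trans[OF tl])
  then show ?thesis unfolding nthc_def using hd order_trans by blast
qed

lemma list_decode_mem_le: "t \<in> set (list_decode n) \<Longrightarrow> t \<le> n"
proof -
  assume "t \<in> set (list_decode n)"
  then obtain k where "k < length (list_decode n)" "t = list_decode n ! k" by (metis in_set_conv_nth)
  then have "t = nthc (list_encode (list_decode n)) k" by (simp only: nthc_list_encode if_True)
  then show ?thesis using nthc_le[of n k] by simp
qed

lemma abs_int_decode_le: "\<bar>int_decode n\<bar> \<le> int n"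
  unfolding int_decode_cases by (auto; presburger)

text \<open>
The codes of the exponents are parts of the code of the polynomial, and the code of a pair is not less
than its components.
\<close>

lemma supp_decode_poly_bound:
  assumes "v \<in> supp (decode_poly c)"
  shows "\<bar>v $ i\<bar> \<le> int c"
proof -
  have "\<exists>t\<in>set xs. decode_vec (p1 t) = v" if "cf (\<Sum>t\<leftarrow>xs. decode_term t) v \<noteq> 0" for xs
    using that by (induction xs) (auto simp: decode_term_def lookup_add cf_sg split: if_splits)
  then obtain t where t: "t \<in> set (list_decode c)" "decode_vec (p1 t) = v"
    using assms unfolding decode_poly_def in_keys_iff by blast
  have "\<bar>v $ i\<bar> \<le> int (nthc (p1 t) (idx i))"
    using abs_int_decode_le by (simp add: decode_vec_def flip: t(2))
  also have "nthc (p1 t) (idx i) \<le> p1 t" by (rule nthc_le)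
  also have "p1 t \<le> t" using le_prod_encode_1[of "p1 t" "p2 t"] by simp
  also have "t \<le> c" by (rule list_decode_mem_le[OF t(1)])
  finally show ?thesis by simp
qed

end

section \<open>Certificates for the multiplicity\<close>

text \<open>
The facts about the contraction, for fixed \<open>N\<close>, that determine the multiplicity \<open>e\<close>; the generator is
the dilation of \<open>p\<close>.
\<close>

definition contraction_data :: "nat \<Rightarrow> ('d::finite, int) laurent \<Rightarrow> ('d, int) laurent \<Rightarrow> nat \<Rightarrow> bool" where
  "contraction_data N f p e \<longleftrightarrow> irreducible p \<and> e \<ge> 1 \<and> 0 \<in> supp p \<and> f dvd dilate N p \<and>
    decimation N f = to_complex (dilate N (p ^ e)) \<and> (\<forall>h. f dvd dilate N h \<longrightarrow> p dvd h)"

lemma contraction_data_quotient: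
  assumes N: "N \<ge> 1" and f: "irreducible f" and "contraction_data N f p e"
  obtains q where "\<not> f dvd q" "decimation N f = to_complex ((f * q) ^ e)"
proof -
  have p: "0 \<in> supp p" "f dvd dilate N p" "decimation N f = to_complex (dilate N (p ^ e))"
    "\<And>h. f dvd dilate N h \<Longrightarrow> p dvd h"
    using assms(3) unfolding contraction_data_def by blast+
  obtain q where q: "dilate N p = f * q" using p(2) by (rule dvdE)
  have "\<not> f dvd q"
  proof
    assume "f dvd q"
    then have "f * f dvd dilate N p" unfolding q by (intro mult_dvd_mono) auto
    then show False using contraction_unramified[OF N f p(1,4)] by blast
  qed
  moreover have "decimation N f = to_complex ((f * q) ^ e)"
    by (simp add: p(3) ring_mapD(7)[OF ring_map_dilate] q)
  ultimately show ?thesis by (rule that)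
qed

lemma ring_map_of_rat: "ring_map (of_rat :: rat \<Rightarrow> complex)"
  by (simp add: ring_map_def of_rat_add of_rat_mult)

text \<open>Integer polynomials among those with coefficients in \<open>Q[t]\<close>, the domain of all computations.\<close>

definition emb :: "('d::finite, int) laurent \<Rightarrow> ('d, rat poly) laurent" where
  "emb f = const_poly (lmap of_int f)"

lemma ring_map_emb: "ring_map (emb :: ('d::finite, int) laurent \<Rightarrow> _)"
proof -
  have 1: "ring_map (lmap (of_int :: int \<Rightarrow> rat) :: ('d, int) laurent \<Rightarrow> _)"
    by (intro ring_map_lmap ring_map_of_int)
  show ?thesis
    unfolding ring_map_def emb_def
    by (simp add: ring_mapD[OF 1] ring_mapD[OF ring_map_const_poly])
qed

lemma cf_emb: "cf (emb f) n = [:of_int (cf f n):]"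
  by (simp add: emb_def const_poly_def cf_lmap)

lemma supp_emb [simp]: "supp (emb f) = supp f"
  by (auto simp: in_keys_iff cf_emb)

lemma ev_emb: "ev of_rat z (emb f) = to_complex f"
  by (rule laurent_eqI)
    (simp add: cf_ev ring_map_of_rat cf_emb peval_const cf_to_complex)

lemma minimal_polynomial_dvd:
  fixes p g :: "rat poly"
  assumes p: "irreducible p" and "peval of_rat z p = 0" "peval of_rat z g = 0"
  shows "p dvd g"
proof (rule ccontr)
  assume "\<not> p dvd g"
  moreover have "prime_elem p" using p by (rule irreducible_imp_prime_elem)
  ultimately have "coprime p g" by (intro prime_elem_imp_coprime)
  then have "fst (bezout_coefficients p g) * p + snd (bezout_coefficients p g) * g = 1"
    by (simp add: bezout_coefficients_fst_snd)
  from arg_cong[OF this, of "peval of_rat z"] assms(2,3) show False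
    by (simp add: ring_mapD[OF ring_map_peval[OF ring_map_of_rat]])
qed

lemma coefficientwise_dvd:
  fixes H :: "('d::finite, 'a::comm_ring_1) laurent"
  assumes "\<And>n. p dvd cf H n"
  shows "\<exists>S. H = sg 0 p * S"
proof -
  have "\<exists>s. cf H n = p * s" for n using assms[of n] by (metis dvdE)
  then obtain s where s: "\<And>n. cf H n = p * s n" by metis
  have "H = (\<Sum>n\<in>supp H. sg 0 p * sg n (s n))"
    by (subst laurent_sum) (simp add: sg_mult_sg s)
  then have "H = sg 0 p * (\<Sum>n\<in>supp H. sg n (s n))" by (simp add: sum_distrib_left)
  then show ?thesis by blast
qed

text \<open>
The product \<open>\<Prod>(t^k - 1)\<close> over \<open>0 < k < N\<close> is nonzero at the primitive \<open>N\<close>th roots of unity and \<open>0\<close> at the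
others.  So a polynomial \<open>H\<close> vanishes at the primitive roots if and only if \<open>t^N - 1\<close> divides its product with \<open>cyc N\<close>; cyclotomic
polynomials are not needed.
\<close>

definition cyc :: "nat \<Rightarrow> ('d::finite, rat poly) laurent" where
  "cyc N = (\<Prod>k<N - 1. sg 0 (monom 1 (Suc k)) - 1)"

definition tpow :: "nat \<Rightarrow> ('d::finite, rat poly) laurent" where
  "tpow N = sg 0 (monom 1 N) - 1"

lemma ev_sg: "ev of_rat z (sg n c) = sg n (peval of_rat z c)"
  by (simp add: lmap_sg ring_mapD[OF ring_map_peval[OF ring_map_of_rat]])

lemma ev_tpow: "ev of_rat z (tpow N) = sg 0 (z ^ N - 1)"
  by (simp add: tpow_def ring_mapD[OF ring_map_ev[OF ring_map_of_rat]] ev_sg peval_monom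
      ring_map_of_rat single_diff)

lemma ev_cyc: "ev of_rat z (cyc N) = (\<Prod>k<N - 1. sg 0 (z ^ Suc k - 1))"
  unfolding cyc_def ring_mapD(9)[OF ring_map_ev[OF ring_map_of_rat]]
  by (intro prod.cong refl) (rule ev_tpow[unfolded tpow_def])

lemma ev_cyc_primitive:
  assumes "primitive N z"
  shows "ev of_rat z (cyc N) \<noteq> 0"
proof -
  have "z ^ Suc k - 1 \<noteq> 0" if "k < N - 1" for k
    using primitive_pow_eq_1[OF assms, of "Suc k"] that by (auto dest: dvd_imp_le)
  then show ?thesis
    unfolding ev_cyc by (subst laurent_prod_eq_0_iff) (auto simp: sg_eq_0_iff)
qed

lemma ev_cyc_nonprimitive:
  assumes "z ^ N = 1" "N \<ge> 1" "\<not> primitive N z"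
  shows "ev of_rat z (cyc N) = 0"
proof -
  have "\<not> inj_on (\<lambda>k. z ^ k) {..<N}" using assms by (simp add: primitive_def)
  then have "\<exists>k l. k < l \<and> l < N \<and> z ^ k = z ^ l"
    unfolding inj_on_def by (metis lessThan_iff linorder_neqE_nat)
  then obtain k l where kl: "k < l" "l < N" "z ^ k = z ^ l" by (elim exE conjE)
  have "z \<noteq> 0" using assms(1,2) by (auto simp: power_0_left)
  moreover have "z ^ l = z ^ k * z ^ (l - k)" using kl(1) by (simp flip: power_add)
  ultimately have "z ^ (l - k) = 1" using kl(3) by simp
  moreover have "Suc (l - k - 1) = l - k" using kl(1) by simp
  ultimately have "z ^ Suc (l - k - 1) - 1 = 0" by simp
  then have z: "sg 0 (z ^ Suc (l - k - 1) - 1) = (0 :: ('a, complex) laurent)" by simp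
  have "l - k - 1 < N - 1" using kl by linarith
  then show ?thesis
    unfolding ev_cyc by (intro prod_zero) (use z in auto)
qed

text \<open>The roots of \<open>t^N - 1\<close> are simple.\<close>

lemma unity_poly_dvd:
  fixes h :: "rat poly"
  assumes N: "N \<ge> 1" and "\<And>z. z ^ N = 1 \<Longrightarrow> peval of_rat z h = 0"
  shows "monom 1 N - 1 dvd h"
proof -
  define X where "X = (monom 1 N - 1 :: rat poly)"
  have "degree (monom 1 N + (- 1) :: rat poly) = degree (monom 1 N :: rat poly)"
    using N by (intro degree_add_eq_left) (auto simp: degree_monom_eq)
  then have dX: "degree X = N" by (simp add: X_def degree_monom_eq)
  then have X0: "X \<noteq> 0" using N by auto
  define r where "r = h mod X"
  note hom = ring_mapD[OF ring_map_peval[OF ring_map_of_rat]]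
  have "r = 0"
  proof (rule ccontr)
    assume r0: "r \<noteq> 0"
    then have dr: "degree r < N" using degree_mod_less[OF X0, of h] dX by (simp add: r_def)
    have "peval of_rat z r = 0" if "z ^ N = 1" for z
    proof -
      have "h = h div X * X + r" by (simp add: r_def)
      from arg_cong[OF this, of "peval of_rat z"] show ?thesis
        using assms(2)[OF that] that
        by (simp add: hom X_def peval_monom ring_map_of_rat)
    qed
    then have sub: "roots1 N \<subseteq> {z. poly (map_poly of_rat r) z = 0}" by (auto simp: peval_def)
    have R0: "map_poly (of_rat :: rat \<Rightarrow> complex) r \<noteq> 0" using r0 by (auto simp: poly_eq_iff coeff_map_poly)
    have "N = card (roots1 N)" using N by (simp add: card_roots_unity_eq)
    also have "\<dots> \<le> card {z. poly (map_poly of_rat r) z = (0 :: complex)}"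
      by (rule card_mono[OF poly_roots_finite[OF R0] sub])
    also have "\<dots> \<le> degree (map_poly (of_rat :: rat \<Rightarrow> complex) r)" by (rule card_poly_roots_bound[OF R0])
    also have "\<dots> = degree r" by (rule degree_map_poly) auto
    finally show False using dr by simp
  qed
  then show ?thesis by (auto simp: r_def X_def mod_eq_0_iff_dvd)
qed

lemma card_Omega: "N \<ge> 1 \<Longrightarrow> card (Omega N (UNIV :: 'd::finite set)) = N ^ CARD('d)"
proof -
  assume N: "N \<ge> 1"
  have "Omega N (UNIV :: 'd set) = PiE UNIV (\<lambda>_. roots1 N)" by (auto simp: Omega_def)
  then show ?thesis using N by (simp add: card_PiE card_roots_unity_eq)
qed

text \<open>If no variable occurs in \<open>f\<close>, then all \<open>N^d\<close> rotations of \<open>f\<close> are equal to \<open>f\<close>.\<close>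

lemma decimation_constant_multiplicity:
  fixes f :: "('d::finite, int) laurent"
  assumes N: "N \<ge> 1" and f: "irreducible f" "supp f = {0}" and c: "contraction_data N f p e"
  shows "e = N ^ CARD('d)"
proof (rule ccontr)
  define M where "M = N ^ CARD('d)"
  have f0: "f \<noteq> 0" "\<not> f dvd 1" using f(1) by (auto simp: irreducible_def)
  obtain q where q: "\<not> f dvd q" "decimation N f = to_complex ((f * q) ^ e)"
    using contraction_data_quotient[OF N f(1) c] by blast
  have "f \<in> sublattice_ring N" using f(2) by (simp add: sublattice_ring_def)
  then have "decimation N f = to_complex f ^ M"
    unfolding decimation_eq_dec[OF N] M_def by (simp add: dec_sublattice card_Omega[OF N])
  then have "to_complex (f ^ M) = to_complex ((f * q) ^ e)"
    using q(2) by (simp add: ring_mapD[OF ring_map_to_complex])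
  then have eq: "f ^ M = f ^ e * q ^ e" by (simp add: power_mult_distrib)
  have fp: "f ^ k \<noteq> 0" for k using f0 by simp
  assume "e \<noteq> N ^ CARD('d)"
  then consider "M < e" | "e < M" unfolding M_def by linarith
  then show False
  proof cases
    case 1
    then have "f ^ e = f ^ M * f ^ (e - M)" by (simp flip: power_add)
    with eq have "f ^ M = f ^ M * f ^ (e - M) * q ^ e" by (simp only:)
    then have "f ^ M * 1 = f ^ M * (f ^ (e - M) * q ^ e)" by (simp only: mult.assoc mult_1_right)
    then have "1 = f ^ (e - M) * q ^ e" unfolding laurent_mult_cancel[OF fp] .
    moreover have "f dvd f ^ (e - M) * q ^ e" using 1 by (intro dvd_mult2 dvd_power) auto
    ultimately show False using f0(2) by simp
  next
    case 2
    then have "f ^ M = f ^ e * f ^ (M - e)" by (simp flip: power_add)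
    then have "f ^ e * f ^ (M - e) = f ^ e * q ^ e" using eq by simp
    then have "f ^ (M - e) = q ^ e" unfolding laurent_mult_cancel[OF fp] .
    moreover have "f dvd f ^ (M - e)" using 2 by (intro dvd_power) auto
    ultimately have "f dvd q ^ e" by simp
    then show False using irreducible_dvd_power[OF f(1)] q(1) by blast
  qed
qed

context coordinates
begin

text \<open>
The conditions say, in this order, that \<open>x_i\<close> occurs in \<open>F\<close>, that there is a Bezout relation with a nonzero
right-hand side \<open>R\<close>, and that the decimation of \<open>F\<close> is \<open>F^e Q\<close> at every primitive \<open>N\<close>th root of unity.
\<close>

definition multiplicity_cert where
  "multiplicity_cert N F Q S A B R e i \<longleftrightarrow> drop_var i F - F \<noteq> 0 \<and> A * F + B * Q - R = 0 \<and> R \<noteq> 0 \<and>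
    cyc N * (foldr (var_norm N) ds F - F ^ e * Q) - tpow N * S = 0"

lemma cf_set_t_1: "cf (set_t_1 Y) n = [:poly (cf Y n) 1:]"
  unfolding set_t_1_def by (subst cf_lmap) simp_all

lemma set_t_1_emb: "set_t_1 (emb f) = emb f"
  by (rule laurent_eqI) (simp add: cf_set_t_1 cf_emb)

lemma supp_ev_set_t_1: "supp (ev of_rat z (set_t_1 Y)) = supp (set_t_1 Y)"
  by (auto simp: in_keys_iff cf_ev ring_map_of_rat cf_set_t_1 peval_const)

lemma over_supp_cong: "supp f = supp g \<Longrightarrow> over I f = over I g"
  by (simp add: over_def)

lemma drop_var_emb:
  assumes "0 \<in> supp f"
  shows "drop_var i (emb f) - emb f = 0 \<longleftrightarrow> cwidth i f = 0"
proof -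
  have "drop_var i (emb f) - emb f = 0 \<longleftrightarrow> over (- {i}) (emb f)"
    using drop_var_id_iff[of i "emb f"] by simp
  also have "\<dots> \<longleftrightarrow> over (- {i}) f" by (rule over_supp_cong) simp
  also have "\<dots> \<longleftrightarrow> cwidth i f = 0"
    unfolding cwidth_eq_0_iff over_def using assms by (auto; metis zero_index)
  finally show ?thesis .
qed

text \<open>
The certificate is evaluated at one primitive root.  The right-hand side of the Bezout relation is free of
\<open>x_i\<close>, and it is free of \<open>t\<close> so that it does not become \<open>0\<close>.
\<close>

lemma multiplicity_cert_sound:
  assumes N: "N \<ge> 1" and f: "irreducible f" "0 \<in> supp f" and c: "contraction_data N f p e0"
    and cert: "multiplicity_cert N (emb f) Q S A B (set_t_1 (drop_var i R)) e i"
  shows "e = e0"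
proof -
  note cert = cert[unfolded multiplicity_cert_def]
  obtain q where q: "\<not> f dvd q" "decimation N f = to_complex ((f * q) ^ e0)"
    using contraction_data_quotient[OF N f(1) c] by blast
  obtain z where z: "primitive N z" using primitive_exp[OF N] by blast
  note hom = ring_mapD[OF ring_map_ev[OF ring_map_of_rat, of z]]
  have dec: "ev of_rat z (foldr (var_norm N) ds (emb f)) = decimation N f"
    unfolding ev_norms[OF ring_map_of_rat z distinct_ds] set_ds ev_emb decimation_eq_dec[OF N] dec_def ..
  have "cyc N * (foldr (var_norm N) ds (emb f) - emb f ^ e * Q) = tpow N * S" using cert by simp
  from arg_cong[OF this, of "ev of_rat z"]
  have "ev of_rat z (cyc N) * (decimation N f - to_complex f ^ e * ev of_rat z Q) = sg 0 (z ^ N - 1) * ev of_rat z S"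
    by (simp add: hom dec ev_emb ev_tpow)
  also have "\<dots> = 0" using z by (simp add: primitive_def)
  finally have "decimation N f - to_complex f ^ e * ev of_rat z Q = 0"
    by (simp add: laurent_mult_eq_0_iff ev_cyc_primitive[OF z])
  then have eq: "to_complex f ^ e * ev of_rat z Q = to_complex ((f * q) ^ e0)" using q(2) by simp
  have "A * emb f + B * Q = set_t_1 (drop_var i R)" using cert by simp
  from arg_cong[OF this, of "ev of_rat z"]
  have r: "ev of_rat z A * to_complex f + ev of_rat z B * ev of_rat z Q = ev of_rat z (set_t_1 (drop_var i R))"
    by (simp add: hom ev_emb)
  have "supp (set_t_1 (drop_var i R)) \<noteq> {}" using cert by simp
  then have r0: "ev of_rat z (set_t_1 (drop_var i R)) \<noteq> 0"
    using supp_ev_set_t_1[of z "drop_var i R"] by (metis keys_zero)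
  have "supp (set_t_1 (drop_var i R)) \<subseteq> supp (drop_var i R)" by (auto simp: in_keys_iff cf_set_t_1)
  then have "over (- {i}) (ev of_rat z (set_t_1 (drop_var i R)))"
    using over_drop_var[of i R] unfolding over_def supp_ev_set_t_1 by blast
  moreover have "cwidth i f > 0" using cert drop_var_emb[OF f(2), of i] by auto
  ultimately show ?thesis
    using multiplicity_certificate_sound[OF f(1) _ q(1) eq r r0] by blast
qed

text \<open>All polynomials other than \<open>S\<close> have integer coefficients, so \<open>set_t_1\<close> does not change them.\<close>

lemma multiplicity_cert_complete:
  assumes N: "N \<ge> 1" and f: "irreducible f" "0 \<in> supp f" and c: "contraction_data N f p e"
    and i: "cwidth i f > 0"
  shows "\<exists>Q S A B R. multiplicity_cert N (emb f) (set_t_1 Q) S (set_t_1 A) (set_t_1 B) (set_t_1 (drop_var i R)) e i"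
proof -
  obtain q where q: "\<not> f dvd q" "decimation N f = to_complex ((f * q) ^ e)"
    using contraction_data_quotient[OF N f(1) c] by blast
  have "\<not> f dvd q ^ e" using irreducible_dvd_power[OF f(1)] q(1) by blast
  from bezout_free_of_variable[OF f(1) i this] obtain A B r where
    r: "r \<noteq> 0" "over (- {i}) r" "A * f + B * q ^ e = r" by (elim exE conjE)
  note E = ring_mapD[OF ring_map_emb]
  define H where "H = cyc N * (foldr (var_norm N) ds (emb f) - emb f ^ e * emb (q ^ e))"
  have "ev of_rat z H = 0" if z: "z ^ N = 1" for z
  proof (cases "primitive N z")
    case True
    note hom = ring_mapD[OF ring_map_ev[OF ring_map_of_rat, of z]]
    have dec: "ev of_rat z (foldr (var_norm N) ds (emb f)) = decimation N f"
      unfolding ev_norms[OF ring_map_of_rat True distinct_ds] set_ds ev_emb decimation_eq_dec[OF N] dec_def ..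
    have "decimation N f = to_complex f ^ e * to_complex (q ^ e)"
      by (simp add: q(2) ring_mapD[OF ring_map_to_complex] power_mult_distrib)
    then show ?thesis by (simp add: H_def hom dec ev_emb)
  next
    case False
    show ?thesis
      by (simp add: H_def ring_mapD[OF ring_map_ev[OF ring_map_of_rat]] ev_cyc_nonprimitive[OF z N False])
  qed
  then have "peval of_rat z (cf H n) = 0" if "z ^ N = 1" for z n
    using that cf_ev[OF ring_map_of_rat, of z H n] by simp
  then have "monom 1 N - 1 dvd cf H n" for n by (intro unity_poly_dvd[OF N])
  then obtain S where "H = sg 0 (monom 1 N - 1) * S" using coefficientwise_dvd by blast
  then have S: "H = tpow N * S" by (simp add: tpow_def single_diff)
  have "drop_var i (emb r) = emb r"
    unfolding drop_var_id_iff using r(2) over_supp_cong[OF supp_emb, of "- {i}" r] by blast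
  then have R: "set_t_1 (drop_var i (emb r)) = emb r" by (simp add: set_t_1_emb)
  have "emb r \<noteq> 0" using r(1) supp_emb[of r] by (metis keys_eq_empty)
  moreover have "emb A * emb f + emb B * emb (q ^ e) - emb r = 0" by (simp add: E flip: r(3))
  moreover have "drop_var i (emb f) - emb f \<noteq> 0" using drop_var_emb[OF f(2), of i] i by simp
  ultimately have "multiplicity_cert N (emb f) (set_t_1 (emb (q ^ e))) S (set_t_1 (emb A)) (set_t_1 (emb B))
      (set_t_1 (drop_var i (emb r))) e i"
    using S unfolding multiplicity_cert_def R set_t_1_emb H_def by simp
  then show ?thesis by blast
qed

section \<open>Programs for the multiplicity and for its modulus\<close>

text \<open>
With the code \<open>c\<close> of a factorization and the irreducible polynomial \<open>p\<close> that it contains, the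
witness \<open>s\<close> shows that the polynomial with code \<open>x\<close> is congruent modulo \<open>p\<close> to the product of the
listed factors.
\<close>

definition represents :: "nat \<Rightarrow> nat \<Rightarrow> nat \<Rightarrow> bool" where
  "represents c x s \<longleftrightarrow>
    read_terms (nthc c 1) * (\<Prod>t\<leftarrow>list_decode (nthc c 2). read_terms t) - set_t_1 (decode_poly x)
      - sg 0 (read_coeff (nthc c 0)) * decode_poly s = 0"

lemma ev_terms: "ev of_rat \<theta> (\<Sum>(n, a)\<leftarrow>ts. sg n a) = terms_at \<theta> ts"
proof (induction ts)
  case Nil
  show ?case by (simp add: terms_at_def ring_mapD[OF ring_map_ev[OF ring_map_of_rat]])
next
  case (Cons t ts)
  obtain n a where t: "t = (n, a)" by (cases t)
  have "ev of_rat \<theta> (\<Sum>(n, a)\<leftarrow>t # ts. sg n a) = sg n (peval of_rat \<theta> a) + terms_at \<theta> ts"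
    by (simp add: t ring_mapD[OF ring_map_ev[OF ring_map_of_rat]] ev_sg Cons.IH)
  also have "\<dots> = terms_at \<theta> (t # ts)" by (simp add: t terms_at_def peval_def)
  finally show ?case .
qed

text \<open>
The congruence modulo \<open>p\<close> is equivalent to equality at a root \<open>\<theta>\<close> of \<open>p\<close>, and a polynomial
with rational coefficients is determined by its value at \<open>\<theta>\<close>.  The coefficients of \<open>f\<close> can thus be found
without any computation in the number field.
\<close>

lemma represents_iff:
  assumes "abs_factorization f d"
  shows "(\<exists>s. represents (encode_data ds d) x s) \<longleftrightarrow> set_t_1 (decode_poly x) = emb f"
proof -
  obtain p u fs where d: "d = (p, u, fs)" by (cases d)
  obtain \<theta> where p: "irreducible p" and \<theta>: "peval of_rat \<theta> p = 0"
    and fac: "to_complex f = terms_at \<theta> u * (\<Prod>h\<leftarrow>fs. terms_at \<theta> h)"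
    using assms unfolding abs_factorization_def d peval_def by auto
  note hom = ring_mapD[OF ring_map_ev[OF ring_map_of_rat, of \<theta>]]
  define H where "H = (\<Sum>(n, a)\<leftarrow>u. sg n a) * (\<Prod>h\<leftarrow>fs. \<Sum>(n, a)\<leftarrow>h. sg n a)"
  have rep: "represents (encode_data ds d) x s \<longleftrightarrow> H - set_t_1 (decode_poly x) - sg 0 p * decode_poly s = 0" for s
    unfolding represents_def encode_data_def d case_prod_conv nthc_list_encode
    by (simp add: numeral_eq_Suc read_terms_encode o_def H_def del: list_encode.simps)
  have "ev of_rat \<theta> (\<Prod>h\<leftarrow>fs. \<Sum>(n, a)\<leftarrow>h. sg n a) = (\<Prod>h\<leftarrow>fs. terms_at \<theta> h)"
    by (induction fs) (simp_all add: hom ev_terms)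
  then have evH: "ev of_rat \<theta> H = to_complex f"
    by (simp add: H_def hom ev_terms fac)
  show ?thesis
  proof
    assume "\<exists>s. represents (encode_data ds d) x s"
    then obtain s where "H - set_t_1 (decode_poly x) - sg 0 p * decode_poly s = 0" unfolding rep by blast
    from arg_cong[OF this, of "ev of_rat \<theta>"]
    have eq: "ev of_rat \<theta> (set_t_1 (decode_poly x)) = to_complex f" by (simp add: hom evH ev_sg \<theta>)
    show "set_t_1 (decode_poly x) = emb f"
    proof (rule laurent_eqI)
      fix n
      have "of_rat (poly (cf (decode_poly x) n) 1) = (of_int (cf f n) :: complex)"
        using arg_cong[OF eq, of "\<lambda>h. cf h n"]
        by (simp add: cf_ev ring_map_of_rat cf_set_t_1 peval_const cf_to_complex)
      then have "of_rat (poly (cf (decode_poly x) n) 1) = (of_rat (of_int (cf f n)) :: complex)" by simp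
      then have "poly (cf (decode_poly x) n) 1 = of_int (cf f n)" by (simp only: of_rat_eq_iff)
      then show "cf (set_t_1 (decode_poly x)) n = cf (emb f) n" by (simp add: cf_set_t_1 cf_emb)
    qed
  next
    assume x: "set_t_1 (decode_poly x) = emb f"
    have "ev of_rat \<theta> (H - emb f) = 0" by (simp add: hom evH ev_emb)
    then have "peval of_rat \<theta> (cf (H - emb f) n) = 0" for n
      using cf_ev[OF ring_map_of_rat, of \<theta> "H - emb f" n] by simp
    then have "p dvd cf (H - emb f) n" for n by (rule minimal_polynomial_dvd[OF p \<theta>])
    then obtain S where S: "H - emb f = sg 0 p * S" using coefficientwise_dvd by blast
    obtain s where "decode_poly s = S" using decode_poly_surj by blast
    then have "represents (encode_data ds d) x s" unfolding rep x using S by simp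
    then show "\<exists>s. represents (encode_data ds d) x s" by blast
  qed
qed

lemma decid_represents:
  assumes "rec1 c" "rec1 x" "rec1 s"
  shows "decid (\<lambda>n. represents (c n) (x n) (s n))"
  unfolding represents_def
  by (intro decid_poly_zero recp_diff recp_mult recp_read_terms recp_read_terms_prod recp_set_t_1
      recp_read_coeff recp_decode recv_const rec1_nthc rec1_const assms)

lemma recp_cyc: "rec1 N \<Longrightarrow> recp (\<lambda>n. cyc (N n))"
  unfolding cyc_def
  by (intro recp_prod_range recp_diff recp_term recp_const recv_const recq_const rec1_suc rec1_diff
      rec1_const rec1_p2 rec1_id)

lemma recp_tpow: "rec1 N \<Longrightarrow> recp (\<lambda>n. tpow (N n))"
  unfolding tpow_def by (intro recp_diff recp_term recp_const recv_const recq_const)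

lemma decid_multiplicity_cert:
  assumes "rec1 N" "recp F" "recp Q" "recp S" "recp A" "recp B" "recp R" "rec1 e"
  shows "decid (\<lambda>n. multiplicity_cert (N n) (F n) (Q n) (S n) (A n) (B n) (R n) (e n) i)"
  unfolding multiplicity_cert_def
  by (intro decid_and decid_not decid_poly_zero recp_diff recp_mult recp_add recp_drop_var recp_cyc
      recp_tpow recp_norms recp_power assms)

text \<open>
The entries of \<open>w\<close> are the codes of a polynomial \<open>f\<close>, of a witness that it is the given one, and of
a certificate, followed by the multiplicity.  The first alternative is the case of a constant.
\<close>

definition multiplicity_witness :: "nat \<Rightarrow> nat \<Rightarrow> bool" where
  "multiplicity_witness n w \<longleftrightarrow> represents (p1 n) (nthc w 0) (nthc w 1) \<and>
    ((\<forall>i\<in>set ds. drop_var i (set_t_1 (decode_poly (nthc w 0))) - set_t_1 (decode_poly (nthc w 0)) = 0) \<and> nthc w 7 = p2 n ^ CARD('d) \<or>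
     (\<exists>i\<in>set ds. multiplicity_cert (p2 n) (set_t_1 (decode_poly (nthc w 0))) (set_t_1 (decode_poly (nthc w 2))) (decode_poly (nthc w 3))
        (set_t_1 (decode_poly (nthc w 4))) (set_t_1 (decode_poly (nthc w 5))) (set_t_1 (drop_var i (decode_poly (nthc w 6)))) (nthc w 7) i))"

lemma rec1_power_const: "rec1 f \<Longrightarrow> rec1 (\<lambda>n. f n ^ k)"
  by (induction k) (auto intro: rec1_const rec1_mult)

lemma decid_multiplicity_witness: "decid (\<lambda>m. multiplicity_witness (p1 m) (p2 m))"
  unfolding multiplicity_witness_def
  by (intro decid_and decid_or decid_finite_all decid_finite_ex decid_represents decid_poly_zero
      decid_multiplicity_cert decid_eq recp_diff recp_drop_var recp_set_t_1 recp_decode rec1_power_const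
      rec1_nthc rec1_const rec1_p1 rec1_p2 rec1_id)

lemma multiplicity_witness_iff:
  assumes N: "N \<ge> 1" and f: "irreducible f" "0 \<in> supp f" and c: "contraction_data N f p e"
    and d: "abs_factorization f d"
  shows "\<exists>w. multiplicity_witness (pr (encode_data ds d) N) w"
    and "multiplicity_witness (pr (encode_data ds d) N) w \<Longrightarrow> nthc w 7 = e"
proof -
  have const: "e = N ^ CARD('d)" if "\<forall>i\<in>set ds. cwidth i f = 0"
  proof -
    have "n = 0" if n: "n \<in> supp f" for n
    proof -
      have "n $ i = (0 :: int ^ 'd) $ i" for i
        using \<open>\<forall>i\<in>set ds. cwidth i f = 0\<close> n f(2) set_ds unfolding cwidth_eq_0_iff by blast
      then show ?thesis by (simp add: vec_eq_iff)
    qed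
    then have "supp f = {0}" using f(2) by blast
    then show ?thesis by (rule decimation_constant_multiplicity[OF N f(1) _ c])
  qed
  obtain x where x: "decode_poly x = emb f" using decode_poly_surj by blast
  then have tx: "set_t_1 (decode_poly x) = emb f" by (simp add: set_t_1_emb)
  then obtain s where s: "represents (encode_data ds d) x s" using represents_iff[OF d] by blast
  show "\<exists>w. multiplicity_witness (pr (encode_data ds d) N) w"
  proof (cases "\<forall>i\<in>set ds. cwidth i f = 0")
    case True
    then have "\<forall>i\<in>set ds. drop_var i (emb f) - emb f = 0" using drop_var_emb[OF f(2)] by blast
    then have "multiplicity_witness (pr (encode_data ds d) N) (list_encode [x, s, 0, 0, 0, 0, 0, e])"
      unfolding multiplicity_witness_def nthc_list_encode using s tx const[OF True]
      by (simp add: numeral_eq_Suc)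
    then show ?thesis by blast
  next
    case False
    then obtain i where i: "i \<in> set ds" "cwidth i f > 0" by auto
    obtain Q S A B R where cert: "multiplicity_cert N (emb f) (set_t_1 Q) S (set_t_1 A) (set_t_1 B) (set_t_1 (drop_var i R)) e i"
      using multiplicity_cert_complete[OF N f c i(2)] by blast
    obtain q where q: "decode_poly q = Q" using decode_poly_surj by blast
    obtain s2 where s2: "decode_poly s2 = S" using decode_poly_surj by blast
    obtain a where a: "decode_poly a = A" using decode_poly_surj by blast
    obtain b where b: "decode_poly b = B" using decode_poly_surj by blast
    obtain r where r: "decode_poly r = R" using decode_poly_surj by blast
    have "multiplicity_witness (pr (encode_data ds d) N) (list_encode [x, s, q, s2, a, b, r, e])"
      unfolding multiplicity_witness_def nthc_list_encode using s tx cert i(1)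
      by (auto simp: q s2 a b r numeral_eq_Suc)
    then show ?thesis by blast
  qed
  assume w: "multiplicity_witness (pr (encode_data ds d) N) w"
  then have "represents (encode_data ds d) (nthc w 0) (nthc w 1)" by (simp add: multiplicity_witness_def)
  then have F: "set_t_1 (decode_poly (nthc w 0)) = emb f" using represents_iff[OF d] by blast
  from w consider "\<forall>i\<in>set ds. cwidth i f = 0" "nthc w 7 = N ^ CARD('d)"
    | i where "multiplicity_cert N (emb f) (set_t_1 (decode_poly (nthc w 2))) (decode_poly (nthc w 3))
        (set_t_1 (decode_poly (nthc w 4))) (set_t_1 (decode_poly (nthc w 5))) (set_t_1 (drop_var i (decode_poly (nthc w 6)))) (nthc w 7) i"
    unfolding multiplicity_witness_def F drop_var_emb[OF f(2)] by auto
  then show "nthc w 7 = e"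
  proof cases
    case 1
    then show ?thesis using const by simp
  next
    case 2
    then show ?thesis by (rule multiplicity_cert_sound[OF N f c])
  qed
qed

text \<open>The program does not depend on \<open>f\<close>: it searches for the least witness and returns its last entry.\<close>

lemma multiplicity_program:
  "\<exists>P. \<forall>f d N p e. N \<ge> 1 \<longrightarrow> irreducible f \<longrightarrow> 0 \<in> supp f \<longrightarrow> contraction_data N f p e \<longrightarrow>
    abs_factorization f d \<longrightarrow> computes P [encode_data ds d, N] e"
proof -
  have "rec1 (\<lambda>m. nthc (p2 m) 7)" by (intro rec1_nthc rec1_p2 rec1_id rec1_const)
  from search_program[OF decid_multiplicity_witness this] obtain P where
    P: "\<And>n. \<exists>w. multiplicity_witness n w \<Longrightarrow> computes P [n] (nthc (LEAST w. multiplicity_witness n w) 7)"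
    by auto
  obtain R where R: "\<And>m n. computes R [m, n] (pr m n)" using rec2_pr unfolding rec2_def by blast
  have "computes (Comp P [R]) [encode_data ds d, N] e"
    if "N \<ge> 1" "irreducible f" "0 \<in> supp f" "contraction_data N f p e" "abs_factorization f d" for f d N p e
  proof -
    note wit = multiplicity_witness_iff[OF that]
    have "nthc (LEAST w. multiplicity_witness (pr (encode_data ds d) N) w) 7 = e"
      by (rule wit(2)[OF LeastI_ex[OF wit(1)]])
    then show ?thesis using computes_Comp1[OF R P[OF wit(1)]] by simp
  qed
  then show ?thesis by blast
qed

text \<open>A canonical code of \<open>f\<close>; it makes \<open>Q\<close> independent of the presentation of the factorization.\<close>

definition least_code :: "('d, int) laurent \<Rightarrow> nat" where
  "least_code f = (LEAST y. decode_poly y = emb f)"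

text \<open>The code bounds the exponents and thereby the total width, which is what the arithmetic argument needs.\<close>

definition Qwidth :: "nat \<Rightarrow> nat" where
  "Qwidth y = 2 * y * CARD('d)"

text \<open>A number that exceeds both bounds in \<open>no_common_factor_with_rotation\<close>.\<close>

definition Qbound :: "nat \<Rightarrow> nat" where
  "Qbound y = (Qwidth y ^ 2 + 1) + (Qwidth y + 1) ^ CARD('d)"

lemma total_width_least_code:
  assumes "irreducible f"
  shows "total_width f \<le> Qwidth (least_code f)"
proof -
  have f0: "f \<noteq> 0" using assms by (simp add: irreducible_def)
  have "decode_poly (least_code f) = emb f"
    unfolding least_code_def using decode_poly_surj by (rule LeastI_ex)
  then have b: "\<bar>n $ i\<bar> \<le> int (least_code f)" if "n \<in> supp f" for n i
    using supp_decode_poly_bound[of n "least_code f"] that by simp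
  have "cwidth i f \<le> 2 * least_code f" for i
  proof -
    have "hi (axis i 1) f \<le> int (least_code f)" "hi (- axis i 1) f \<le> int (least_code f)"
      using b by (auto intro!: hi_le[OF f0] simp: dp_axis dp_simps abs_le_iff)
    then have "int (cwidth i f) \<le> int (2 * least_code f)" by (simp add: width_int[OF f0])
    then show ?thesis by linarith
  qed
  then have "total_width f \<le> (\<Sum>i\<in>(UNIV :: 'd set). 2 * least_code f)"
    unfolding total_width_def by (intro sum_mono)
  then show ?thesis by (simp add: Qwidth_def mult.commute)
qed

lemma rec1_fact: "rec1 f \<Longrightarrow> rec1 (\<lambda>n. fact (f n))"
proof -
  have "rec_nat 1 (\<lambda>k y. Suc k * y) j = fact j" for j by (induction j) simp_all
  moreover have "rec2 (\<lambda>k y. Suc k * y)"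
    by (intro rec2_app2[OF rec2_mult] rec1_app2[OF rec1_Suc] rec2_fst rec2_snd)
  ultimately have "rec1 (\<lambda>j. fact j)" using rec1_primrec[of "\<lambda>k y. Suc k * y" 1] by simp
  then show "rec1 f \<Longrightarrow> rec1 (\<lambda>n. fact (f n))" by (rule rec1_comp)
qed

text \<open>Two searches are composed: the first finds some code of \<open>f\<close>, the second its least code.\<close>

lemma Q_program:
  "\<exists>P. \<forall>f d. abs_factorization f d \<longrightarrow> computes P [encode_data ds d] (fact (Qbound (least_code f)))"
proof -
  have "decid (\<lambda>m. represents (p1 m) (nthc (p2 m) 0) (nthc (p2 m) 1))"
    by (intro decid_represents rec1_nthc rec1_p1 rec1_p2 rec1_id rec1_const)
  moreover have "rec1 (\<lambda>m. nthc (p2 m) 0)" by (intro rec1_nthc rec1_p2 rec1_id rec1_const)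
  ultimately obtain P1 where P1: "\<And>c. \<exists>w. represents c (nthc w 0) (nthc w 1) \<Longrightarrow>
      computes P1 [c] (nthc (LEAST w. represents c (nthc w 0) (nthc w 1)) 0)"
    using search_program[of "\<lambda>c w. represents c (nthc w 0) (nthc w 1)" "\<lambda>m. nthc (p2 m) 0"] by auto
  have "decid (\<lambda>m. decode_poly (p2 m) - set_t_1 (decode_poly (p1 m)) = 0)"
    by (intro decid_poly_zero recp_diff recp_set_t_1 recp_decode rec1_p1 rec1_p2 rec1_id)
  moreover have "rec1 (\<lambda>m. fact (Qbound (p2 m)))"
    unfolding Qbound_def Qwidth_def
    by (intro rec1_fact rec1_add rec1_power_const rec1_mult rec1_const rec1_p2 rec1_id)
  ultimately obtain P2 where P2: "\<And>x. \<exists>y. decode_poly y - set_t_1 (decode_poly x) = 0 \<Longrightarrow>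
      computes P2 [x] (fact (Qbound (LEAST y. decode_poly y - set_t_1 (decode_poly x) = 0)))"
    using search_program[of "\<lambda>x y. decode_poly y - set_t_1 (decode_poly x) = 0" "\<lambda>m. fact (Qbound (p2 m))"] by auto
  have "computes (Comp P2 [P1]) [encode_data ds d] (fact (Qbound (least_code f)))"
    if d: "abs_factorization f d" for f d
  proof -
    define c where "c = encode_data ds d"
    obtain x where "decode_poly x = emb f" using decode_poly_surj by blast
    then have "set_t_1 (decode_poly x) = emb f" by (simp add: set_t_1_emb)
    then obtain s where s: "represents c x s" using represents_iff[OF d] unfolding c_def by blast
    then have ex: "\<exists>w. represents c (nthc w 0) (nthc w 1)"
      by (intro exI[of _ "list_encode [x, s]"]) (simp add: nthc_list_encode del: list_encode.simps)
    define y where "y = nthc (LEAST w. represents c (nthc w 0) (nthc w 1)) 0"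
    have "represents c y (nthc (LEAST w. represents c (nthc w 0) (nthc w 1)) 1)"
      unfolding y_def by (rule LeastI_ex[OF ex])
    then have y: "set_t_1 (decode_poly y) = emb f" using represents_iff[OF d] unfolding c_def by blast
    have "computes P1 [c] y" unfolding y_def by (rule P1[OF ex])
    moreover have "computes P2 [y] (fact (Qbound (least_code f)))"
      using P2[of y] decode_poly_surj[of "emb f"] unfolding y least_code_def by simp
    ultimately show ?thesis unfolding c_def by (rule computes_Comp1)
  qed
  then show ?thesis by blast
qed

end

theorem theorem8p12:
  fixes ds :: "'d::finite list"
  assumes "distinct ds" and "set ds = UNIV"
  shows "\<exists>mult_prog Q_prog. \<forall>f :: ('d, int) laurent.
    irreducible f \<longrightarrow> adjusted f \<longrightarrow> Poly_Mapping.lookup f 0 > 0 \<longrightarrow>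
    (\<exists>(g :: nat \<Rightarrow> ('d, int) laurent) (e :: nat \<Rightarrow> nat).
      (\<forall>N\<ge>1.
         irreducible_in (sublattice_ring N) (g N) \<and> e N \<ge> 1 \<and>
         principal_ideal_in UNIV f \<inter> sublattice_ring N
           = principal_ideal_in (sublattice_ring N) (g N) \<and>
         decimation N f = to_complex (g N) ^ e N \<and>
         (\<forall>c. abs_factorization f c \<longrightarrow> computes mult_prog [encode_data ds c, N] (e N)) \<and>
         (\<forall>k\<ge>1. principal_ideal_in UNIV (f ^ k) \<inter> sublattice_ring N
           = principal_ideal_in (sublattice_ring N) (g N ^ k))) \<and>
      (finite_index (group_closure (Poly_Mapping.keys f)) \<longrightarrow>
         (\<exists>Q::nat. Q \<ge> 1 \<and>
           (\<forall>c. abs_factorization f c \<longrightarrow> computes Q_prog [encode_data ds c] Q) \<and>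
           (\<forall>N\<ge>1. coprime N Q \<longrightarrow> e N = 1))))"
proof -
  interpret coordinates ds using assms by unfold_locales
  obtain mult_prog where mult_prog: "\<And>f d N p e. N \<ge> 1 \<Longrightarrow> irreducible f \<Longrightarrow> 0 \<in> supp f \<Longrightarrow>
      contraction_data N f p e \<Longrightarrow> abs_factorization f d \<Longrightarrow> computes mult_prog [encode_data ds d, N] e"
    using multiplicity_program by blast
  obtain Q_prog where Q_prog: "\<And>f d. abs_factorization f d \<Longrightarrow>
      computes Q_prog [encode_data ds d] (fact (Qbound (least_code f)))"
    using Q_program by blast
  show ?thesis
  proof (rule exI[of _ mult_prog], rule exI[of _ Q_prog], intro allI impI)
    fix f :: "('d, int) laurent"
    assume f: "irreducible f" "adjusted f" "cf f 0 > 0"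
    have f0: "0 \<in> supp f" using f(3) by (simp add: in_keys_iff)
    have "\<exists>p e. contraction_data N f p e" if "N \<ge> 1" for N
      using normalized_contraction[OF that f] unfolding contraction_data_def .
    then obtain p e where pe: "\<And>N. N \<ge> 1 \<Longrightarrow> contraction_data N f (p N) (e N)" by metis
    define g where "g N = dilate N (p N)" for N
    show "\<exists>(g :: nat \<Rightarrow> ('d, int) laurent) (e :: nat \<Rightarrow> nat).
      (\<forall>N\<ge>1.
         irreducible_in (sublattice_ring N) (g N) \<and> e N \<ge> 1 \<and>
         principal_ideal_in UNIV f \<inter> sublattice_ring N
           = principal_ideal_in (sublattice_ring N) (g N) \<and>
         decimation N f = to_complex (g N) ^ e N \<and>
         (\<forall>c. abs_factorization f c \<longrightarrow> computes mult_prog [encode_data ds c, N] (e N)) \<and>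
         (\<forall>k\<ge>1. principal_ideal_in UNIV (f ^ k) \<inter> sublattice_ring N
           = principal_ideal_in (sublattice_ring N) (g N ^ k))) \<and>
      (finite_index (group_closure (supp f)) \<longrightarrow>
         (\<exists>Q::nat. Q \<ge> 1 \<and>
           (\<forall>c. abs_factorization f c \<longrightarrow> computes Q_prog [encode_data ds c] Q) \<and>
           (\<forall>N\<ge>1. coprime N Q \<longrightarrow> e N = 1)))"
    proof (intro exI[of _ g] exI[of _ e] conjI allI impI)
      fix N :: nat assume N: "1 \<le> N"
      have c: "irreducible (p N)" "e N \<ge> 1" "0 \<in> supp (p N)" "f dvd dilate N (p N)"
        "decimation N f = to_complex (dilate N (p N ^ e N))" "\<And>h. f dvd dilate N h \<Longrightarrow> p N dvd h"
        using pe[OF N] unfolding contraction_data_def by blast+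
      show "irreducible_in (sublattice_ring N) (g N)"
        unfolding g_def by (rule irreducible_in_sublattice_dilate[OF N c(1)])
      show "1 \<le> e N" by (rule c(2))
      have powers: "f ^ k dvd dilate N h \<longleftrightarrow> p N ^ k dvd h" for k h
        by (rule contraction_powers[OF N f(1) c(3,4,6)])
      have ideal: "principal_ideal_in UNIV (f ^ k) \<inter> sublattice_ring N
          = principal_ideal_in (sublattice_ring N) (g N ^ k)" for k
        using contraction_ideal[OF N powers, of k] by (simp add: g_def ring_mapD(7)[OF ring_map_dilate])
      show "principal_ideal_in UNIV f \<inter> sublattice_ring N = principal_ideal_in (sublattice_ring N) (g N)"
        using ideal[of 1] by simp
      show "principal_ideal_in UNIV (f ^ k) \<inter> sublattice_ring N
          = principal_ideal_in (sublattice_ring N) (g N ^ k)" if "1 \<le> k" for k by (rule ideal)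
      show "decimation N f = to_complex (g N) ^ e N"
        by (simp add: c(5) g_def ring_mapD(7)[OF ring_map_dilate] ring_mapD(7)[OF ring_map_to_complex])
      show "computes mult_prog [encode_data ds d, N] (e N)" if "abs_factorization f d" for d
        by (rule mult_prog[OF N f(1) f0 pe[OF N] that])
    next
      assume index: "finite_index (group_closure (supp f))"
      show "\<exists>Q::nat. Q \<ge> 1 \<and>
           (\<forall>c. abs_factorization f c \<longrightarrow> computes Q_prog [encode_data ds c] Q) \<and>
           (\<forall>N\<ge>1. coprime N Q \<longrightarrow> e N = 1)"
      proof (intro exI[of _ "fact (Qbound (least_code f))"] conjI allI impI)
        show "1 \<le> (fact (Qbound (least_code f)) :: nat)" by (simp add: Suc_le_eq)
        show "computes Q_prog [encode_data ds d] (fact (Qbound (least_code f)))"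
          if "abs_factorization f d" for d by (rule Q_prog[OF that])
        fix N :: nat
        assume N: "1 \<le> N" and cop: "coprime N (fact (Qbound (least_code f)) :: nat)"
        define W where "W = Qwidth (least_code f)"
        have cop': "coprime a N" if "0 < a" "a \<le> max (W ^ 2 + 1) ((W + 1) ^ CARD('d))" for a
        proof -
          have "a \<le> Qbound (least_code f)" using that(2) by (auto simp: Qbound_def W_def)
          then have "a dvd fact (Qbound (least_code f))" using that(1) by (intro dvd_fact) auto
          then show ?thesis using cop coprime_divisors[of a _ N N] by (metis coprime_commute dvd_refl)
        qed
        have c: "e N \<ge> 1" "f dvd dilate N (p N)" "decimation N f = to_complex (dilate N (p N ^ e N))"
          using pe[OF N] unfolding contraction_data_def by blast+
        have "f ^ e N dvd dilate N (p N) ^ e N" using c(2) by (rule dvd_power_same)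
        then have "to_complex (f ^ e N) dvd to_complex (dilate N (p N ^ e N))"
          unfolding ring_mapD(7)[OF ring_map_dilate] by (rule ring_map_dvd[OF ring_map_to_complex])
        then have "to_complex f ^ e N dvd decimation N f"
          unfolding c(3) ring_mapD(7)[OF ring_map_to_complex] .
        moreover have "v = 0" if "\<forall>n\<in>supp f. dp v n = 0" for v
          by (rule finite_index_imp_full_rank[OF index that])
        ultimately have "e N \<le> 1"
          using decimation_multiplicity_one[OF f(1) f0 _ total_width_least_code[OF f(1)] N]
            cop' unfolding W_def by blast
        then show "e N = 1" using c(1) by simp
      qed
    qed
  qed
qed

end
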